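(* Let $0\le m\le n$ be integers, let $F,G$ be a pair of dual random functions ($F:\{0,1\}^n\to\{0,1\}^m$, $G=F^\perp:\{0,1\}^n\to\{0,1\}^{n-m}$), let $r:\mathbb R\to\mathbb R$ be a function, and let $\rho_{ABE}$ be a normalized state in the standard form, where $A$ is an $n$-qubit space. Then the six inequalities of the form $$a\le r(b)$$ with $$a\in\{{\rm E}_F\,Q^{{\rm PA},F}(\rho_{Z^AE}),\ {\rm E}_G\,Q^{{\rm EC},G}(\rho_{X^AB}),\ {\rm E}_G\,Q^{{\rm DC},G}(\rho_{X^AB})\},\qquad b\in\{H_{\rm min}(Z^A|E)_\rho,\ n-H_{\rm max}(X^A|B)_\rho\}$$ are all equivalent; that is, if one of the six inequalities is true, then all six are true.
   Context: All Hilbert spaces are finite-dimensional; logarithms are base 2. A normalized state is a positive semidefinite operator of trace 1. $A=(\mathbb C^2)^{\otimes n}$ has the $z$ basis $\{|z\rangle\}_{z\in\{0,1\}^n}$ (computational basis, eigenbasis of the Pauli $\sigma_Z$'s) and the $x$ basis $\{|\tilde x\rangle\}_{x\in\{0,1\}^n}$, the product eigenbasis of the Pauli $\sigma_X$'s ($\sigma_X|\tilde x_i\rangle=(-1)^{x_i}|\tilde x_i\rangle$ on each qubit). Measured states: for a state $\rho_{AV}$, $\rho_{Z^AV}=\sum_z(|z\rangle\langle z|_A\otimes I_V)\rho_{AV}(|z\rangle\langle z|_A\otimes I_V)=\sum_z|z\rangle\langle z|_A\otimes\rho^z_V$ and $\rho_{X^AV}=\sum_x(|\tilde x\rangle\langle\tilde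 x|_A\otimes I_V)\rho_{AV}(|\tilde x\rangle\langle\tilde x|_A\otimes I_V)=\sum_x|\tilde x\rangle\langle\tilde x|_A\otimes\tilde\rho^x_V$. $\rho_{AV}$ is classical in $Z^A$ (resp. $X^A$) if $\rho_{AV}=\rho_{Z^AV}$ (resp. $\rho_{AV}=\rho_{X^AV}$). A tripartite state $\rho_{ABE}$ is in the standard form if it is pure (rank one) and either $\rho_{AE}={\rm Tr}_B\rho_{ABE}$ is classical in $Z^A$ or $\rho_{AB}={\rm Tr}_E\rho_{ABE}$ is classical in $X^A$. Entropies: $H_{\rm min}(U|V)_\rho=-\log\min\{{\rm Tr}(\sigma):\sigma_V\ge0,\ \rho_{UV}\le I_U\otimes\sigma_V\}$ and $H_{\rm max}(U|V)_\rho=\max_{\sigma_V\ge0,{\rm Tr}\sigma=1}\log\big(|\mathcal U|\,\|\sqrt{\rho_{UV}}\sqrt{|\mathcal U|^{-1}I_U\otimes\sigma_V}\|_1^2\big)$, with $|\mathcal U|$ the alphabet size of $U$. $H_{\rm min}(Z^A|E)_\rho$ and $H_{\rm max}(X^A|B)_\rho$ are these quantities for $\rho_{Z^AE}$ and $\rho_{X^AB}$ with $U=A$ (alphabet $\{0,1\}^n$). Indices: for linear $f:\{0,1\}^n\to\{0,1\}^m$ put $\rho^f_{KE}=\sum_k|k\rangle\langle k|_K\otimes\sum_{z\in f^{-1}(k)}\rho^z_E$ and $Q^{{\rm PA},f}(\rho_{Z^AE})={\rm Tr}(\rho_{Z^AE})-2^{H_{\rm max}(K|E)_{\rho^f}-m}$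 (privacy amplification; alphabet of $K$ is $\{0,1\}^m$). Error correction with quantum side information: given $x$ and $\tilde\rho^x_B$, the receiver computes $s=g(x)$, measures $B$ by a POVM $M^s=\{M^{s,e}\}_{e\in\{0,1\}^n}$, outputs $y=x+e$, and fails if $y\ne0$: $Q^{{\rm EC},g}(\rho_{X^AB})=\min_{\{M^s\}}\sum_x\sum_{e:\,x+e\ne0}{\rm Tr}(\tilde\rho^xM^{g(x),e})$. Data compression with quantum side information: the decoder receives $s=g(x)$ and $\tilde\rho^x_B$, measures $B$ by a POVM $M^s$, outputs $x'=e$, and fails if $x'\ne x$: $Q^{{\rm DC},g}(\rho_{X^AB})=\min_{\{M^s\}}\sum_x\sum_{e\ne x}{\rm Tr}(\tilde\rho^xM^{g(x),e})$. The minima are over all families of POVMs indexed by $s\in\{0,1\}^{n-m}$. Duality: linear surjective $f:\{0,1\}^n\to\{0,1\}^m$, $g:\{0,1\}^n\to\{0,1\}^{n-m}$, given by full-rank matrices over $\mathbb F_2$ of sizes $m\times n$ and $(n-m)\times n$, are dual ($f\perp g$) if $fg^T=0$. A random function $F$ is a random variable with values in a finite set of functions, and ${\rm E}_F\,r(F)=\sum_f\Pr[F=f]\,r(f)$. A pair of random functions $F,G$ is dual ($G=F^\perp$) if they are chosen from sets $\{f_1,f_2,\dots\}$ and $\{g_1,g_2,\dots\}$ of the same size with $f_i\perp g_i$ and $\Pr[F=f_i]=\Pr[G=g_i]$ for all $i$. *)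

theory Defs
  imports
    "HOL-Analysis.Analysis"
    "HOL-Probability.Probability_Mass_Function"
    "HOL-Library.Z2"
    "HOL-Library.Type_Length"
    "Jordan_Normal_Form.DL_Rank"
begin

no_notation vec_index (infixl "$" 100)
no_notation scalar_prod (infix "\<bullet>" 70)
hide_const (open) Matrix.mat Matrix.row Matrix.vec

section \<open>Bit strings\<close>

text \<open>
  The set \<open>{0,1}\<^sup>n\<close> as a finite type, so that it can index matrices; \<open>n = LENGTH('n)\<close>.  The sort
  \<open>len0\<close> (rather than \<open>finite\<close> or \<open>len\<close>) admits \<open>n = 0\<close>, and the numeral types realize every
  \<open>n\<close>.
\<close>

typedef (overloaded) 'n bits = "carrier_vec (LENGTH('n::len0)) :: bit Matrix.vec set"
  morphisms vec_of_bits bits_of_vec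
  by (rule exI[of _ "0\<^sub>v (LENGTH('n))"]) simp

setup_lifting type_definition_bits

instantiation bits :: (len0) ab_group_add
begin

lift_definition zero_bits :: "'a bits" is "0\<^sub>v (LENGTH('a))" by simp
lift_definition plus_bits :: "'a bits \<Rightarrow> 'a bits \<Rightarrow> 'a bits" is "(+)" by simp
lift_definition uminus_bits :: "'a bits \<Rightarrow> 'a bits" is uminus by simp
lift_definition minus_bits :: "'a bits \<Rightarrow> 'a bits \<Rightarrow> 'a bits" is "(-)" by simp

instance
  by standard (transfer; auto intro!: eq_vecI simp: algebra_simps)+

end

definition bit_nth :: "'n::len0 bits \<Rightarrow> nat \<Rightarrow> bit" where
  "bit_nth x i = vec_index (vec_of_bits x) i"

lemma UNIV_bit: "UNIV = {0, 1 :: bit}"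
  by (auto intro: bit_not_one_iff)

lemma bij_betw_bit_nth:
  "bij_betw (\<lambda>x :: 'n::len0 bits. restrict (bit_nth x) {..<LENGTH('n)}) UNIV
     ({..<LENGTH('n)} \<rightarrow>\<^sub>E (UNIV :: bit set))"
proof (rule bij_betwI')
  fix x y :: "'n bits"
  show "(restrict (bit_nth x) {..<LENGTH('n)} = restrict (bit_nth y) {..<LENGTH('n)}) = (x = y)"
  proof
    assume eq: "restrict (bit_nth x) {..<LENGTH('n)} = restrict (bit_nth y) {..<LENGTH('n)}"
    have "vec_of_bits x = vec_of_bits y"
    proof (rule eq_vecI)
      show "dim_vec (vec_of_bits x) = dim_vec (vec_of_bits y)"
        using vec_of_bits[of x] vec_of_bits[of y] by simp
      fix i assume "i < dim_vec (vec_of_bits y)"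
      then have "i < LENGTH('n)" using vec_of_bits[of y] by simp
      then show "vec_index (vec_of_bits x) i = vec_index (vec_of_bits y) i"
        using fun_cong[OF eq, of i] by (simp add: bit_nth_def)
    qed
    then show "x = y" by (simp add: vec_of_bits_inject)
  qed simp
next
  fix h :: "nat \<Rightarrow> bit"
  assume h: "h \<in> {..<LENGTH('n)} \<rightarrow>\<^sub>E UNIV"
  have "vec_of_bits (bits_of_vec (Matrix.vec (LENGTH('n)) h) :: 'n bits) = Matrix.vec (LENGTH('n)) h"
    by (rule bits_of_vec_inverse) simp
  then have "h = restrict (bit_nth (bits_of_vec (Matrix.vec (LENGTH('n)) h) :: 'n bits)) {..<LENGTH('n)}"
    using h by (auto simp: bit_nth_def fun_eq_iff PiE_def extensional_def)
  then show "\<exists>x\<in>UNIV :: 'n bits set. h = restrict (bit_nth x) {..<LENGTH('n)}" by blast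
qed simp

instance bits :: (len0) finite
proof
  have "finite (UNIV :: bit set)" by (simp add: UNIV_bit)
  then have "finite ({..<LENGTH('a)} \<rightarrow>\<^sub>E (UNIV :: bit set))" by (intro finite_PiE) auto
  then show "finite (UNIV :: 'a bits set)"
    using bij_betw_finite[OF bij_betw_bit_nth] by blast
qed

lemma card_bits: "CARD('n::len0 bits) = 2 ^ LENGTH('n)"
proof -
  have "card (UNIV :: bit set) = 2" by (simp add: UNIV_bit)
  then show ?thesis
    using bij_betw_same_card[OF bij_betw_bit_nth[where 'n = 'n]] by (simp add: card_PiE)
qed


section \<open>Operators\<close>

text \<open>
  The Hilbert space with orthonormal basis indexed by the finite type \<open>'i\<close> is \<open>complex^'i\<close>, and the
  tensor product of the spaces for \<open>'i\<close> and \<open>'j\<close> is \<open>complex^('i \<times> 'j)\<close>.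
\<close>

type_synonym 'i op = "complex^'i^'i"

definition dagger :: "'i::finite op \<Rightarrow> 'i op" where
  "dagger A = map_matrix cnj (transpose A)"

definition psd :: "'i::finite op \<Rightarrow> bool" where
  "psd A \<longleftrightarrow> dagger A = A \<and> (\<forall>v. 0 \<le> Re (\<Sum>i\<in>UNIV. cnj (v $ i) * (A *v v) $ i))"

definition op_le :: "'i::finite op \<Rightarrow> 'i op \<Rightarrow> bool" where
  "op_le A B \<longleftrightarrow> psd (B - A)"

definition op_sqrt :: "'i::finite op \<Rightarrow> 'i op" where
  "op_sqrt A = (THE S. psd S \<and> S ** S = A)"

definition trace_norm :: "'i::finite op \<Rightarrow> real" where
  "trace_norm A = Re (trace (op_sqrt (dagger A ** A)))"

definition kron :: "'i::finite op \<Rightarrow> 'j::finite op \<Rightarrow> ('i \<times> 'j) op" where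
  "kron A B = (\<chi> p q. A $ fst p $ fst q * B $ snd p $ snd q)"

definition ket_bra :: "complex^'i::finite \<Rightarrow> 'i op" where
  "ket_bra v = (\<chi> i j. v $ i * cnj (v $ j))"

definition normalized_state :: "'i::finite op \<Rightarrow> bool" where
  "normalized_state \<rho> \<longleftrightarrow> psd \<rho> \<and> trace \<rho> = 1"

definition reduce_AB :: "('a::finite \<times> 'b::finite \<times> 'e::finite) op \<Rightarrow> ('a \<times> 'b) op" where
  "reduce_AB \<rho> = (\<chi> p q. \<Sum>e\<in>UNIV. \<rho> $ (fst p, snd p, e) $ (fst q, snd q, e))"

definition reduce_AE :: "('a::finite \<times> 'b::finite \<times> 'e::finite) op \<Rightarrow> ('a \<times> 'e) op" where
  "reduce_AE \<rho> = (\<chi> p q. \<Sum>b\<in>UNIV. \<rho> $ (fst p, b, snd p) $ (fst q, b, snd q))"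


section \<open>The two bases and measured states\<close>

definition zket :: "'n::len0 bits \<Rightarrow> complex^('n bits)" where
  "zket z = axis z 1"

text \<open>\<open>qubit_x b c\<close> is the amplitude \<open>\<langle>c|\<close> of the single-qubit eigenvector of \<open>\<sigma>\<^sub>X\<close> for \<open>(-1)\<^sup>b\<close>.\<close>

definition qubit_x :: "bit \<Rightarrow> bit \<Rightarrow> complex" where
  "qubit_x b c = (if b = 1 \<and> c = 1 then - 1 else 1) / complex_of_real (sqrt 2)"

lemma qubit_x_eigenvector: "qubit_x b (c + 1) = (if b = 1 then - 1 else 1) * qubit_x b c"
  by (cases b; cases c) (auto simp: qubit_x_def)

definition xket :: "'n::len0 bits \<Rightarrow> complex^('n bits)" where
  "xket x = (\<chi> z. \<Prod>i<LENGTH('n). qubit_x (bit_nth x i) (bit_nth z i))"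

definition measured :: "('n::len0 bits \<Rightarrow> complex^('n bits)) \<Rightarrow> ('n bits \<times> 'v::finite) op
    \<Rightarrow> ('n bits \<times> 'v) op" where
  "measured ket \<rho> = (\<Sum>u\<in>UNIV. kron (ket_bra (ket u)) (mat 1) ** \<rho> ** kron (ket_bra (ket u)) (mat 1))"

text \<open>
  \<open>block ket u \<rho>\<close> is \<open>(\<langle>u| \<otimes> I) \<rho> (|u\<rangle> \<otimes> I)\<close>, i.e. \<open>\<rho>\<^sup>z\<close> for \<open>ket = zket\<close> and the tilded \<open>\<rho>\<^sup>x\<close> for
  \<open>ket = xket\<close>.
\<close>

definition block :: "('n::len0 bits \<Rightarrow> complex^('n bits)) \<Rightarrow> 'n bits \<Rightarrow> ('n bits \<times> 'v::finite) op
    \<Rightarrow> 'v op" where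
  "block ket u \<rho> = (\<chi> v w. \<Sum>a\<in>UNIV. \<Sum>a'\<in>UNIV. cnj (ket u $ a) * \<rho> $ (a, v) $ (a', w) * ket u $ a')"

lemma measured_eq_block:
  fixes \<rho> :: "('a::len0 bits \<times> 'b::finite) op"
  shows
  "measured ket \<rho> = (\<Sum>u\<in>UNIV. kron (ket_bra (ket u)) (block ket u \<rho>))"
proof -
  have cart: "sum h UNIV = (\<Sum>a\<in>UNIV. \<Sum>w\<in>UNIV. h (a, w))" for h :: "'a bits \<times> 'b \<Rightarrow> complex"
    by (simp add: sum.cartesian_product)
  have l: "(\<Sum>q\<in>UNIV. (ket_bra k $ a $ fst q * (mat 1 :: 'b op) $ v $ snd q) * h q)
      = k $ a * (\<Sum>a'\<in>UNIV. cnj (k $ a') * h (a', v))"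
    for k :: "complex^('a bits)" and a v and h :: "'a bits \<times> 'b \<Rightarrow> complex"
  proof -
    have "(\<Sum>q\<in>UNIV. (ket_bra k $ a $ fst q * (mat 1 :: 'b op) $ v $ snd q) * h q)
      = (\<Sum>a'\<in>UNIV. \<Sum>w\<in>UNIV. if v = w then k $ a * (cnj (k $ a') * h (a', w)) else 0)"
      unfolding cart by (intro sum.cong refl) (auto simp: ket_bra_def Finite_Cartesian_Product.mat_def)
    then show ?thesis by (simp add: sum_distrib_left)
  qed
  have r: "(\<Sum>q\<in>UNIV. h q * (ket_bra k $ fst q $ a * (mat 1 :: 'b op) $ snd q $ v))
      = (\<Sum>a'\<in>UNIV. h (a', v) * k $ a') * cnj (k $ a)"
    for k :: "complex^('a bits)" and a v and h :: "'a bits \<times> 'b \<Rightarrow> complex"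
  proof -
    have "(\<Sum>q\<in>UNIV. h q * (ket_bra k $ fst q $ a * (mat 1 :: 'b op) $ snd q $ v))
      = (\<Sum>a'\<in>UNIV. \<Sum>w\<in>UNIV. if w = v then h (a', w) * k $ a' * cnj (k $ a) else 0)"
      unfolding cart by (intro sum.cong refl) (auto simp: ket_bra_def Finite_Cartesian_Product.mat_def)
    then show ?thesis by (simp add: sum_distrib_right)
  qed
  have sw: "(\<Sum>a'\<in>UNIV. (k $ a * (\<Sum>c\<in>UNIV. cnj (k $ c) * h c a')) * k $ a') * cnj (k $ b)
      = k $ a * cnj (k $ b) * (\<Sum>c\<in>UNIV. \<Sum>a'\<in>UNIV. cnj (k $ c) * h c a' * k $ a')"
    for k :: "complex^('a bits)" and a b and h :: "'a bits \<Rightarrow> 'a bits \<Rightarrow> complex"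
    by (subst sum.swap) (simp add: sum_distrib_left sum_distrib_right mult_ac)
  have "kron (ket_bra k) (mat 1) ** \<rho> ** kron (ket_bra k) (mat 1) = kron (ket_bra k) (block ket u \<rho>)"
    if "k = ket u" for k u
    unfolding that[symmetric] vec_eq_iff
    by (simp add: kron_def matrix_matrix_mult_def l r block_def that[symmetric] sw)
       (simp add: ket_bra_def)
  then show ?thesis by (simp add: measured_def)
qed

definition standard_form :: "('n::len0 bits \<times> 'b::finite \<times> 'e::finite) op \<Rightarrow> bool" where
  "standard_form \<rho> \<longleftrightarrow> rank \<rho> = 1 \<and>
     (measured zket (reduce_AE \<rho>) = reduce_AE \<rho> \<or> measured xket (reduce_AB \<rho>) = reduce_AB \<rho>)"


section \<open>Entropies\<close>

text \<open>
  Minima and maxima over operators are written \<open>INF\<close> and \<open>SUP\<close>, here and for the indices below; by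
  compactness they are all attained.
\<close>

definition H_min :: "('u::finite \<times> 'v::finite) op \<Rightarrow> real" where
  "H_min \<rho> = - log 2 (INF \<sigma> \<in> {\<sigma>. psd \<sigma> \<and> op_le \<rho> (kron (mat 1) \<sigma>)}. Re (trace \<sigma>))"

text \<open>
  The maximum over \<open>\<sigma>\<close> is taken inside the logarithm: \<open>log 0\<close> has to count as \<open>- \<infinity>\<close>, whereas
  \<open>log 2 0 = 0\<close> in HOL, so states \<open>\<sigma>\<close> with vanishing fidelity would spoil a maximum of logarithms.
\<close>

definition H_max :: "('u::finite \<times> 'v::finite) op \<Rightarrow> real" where
  "H_max \<rho> = log 2 (SUP \<sigma> \<in> {\<sigma>. normalized_state \<sigma>}.
     real CARD('u) * (trace_norm (op_sqrt \<rho> ** op_sqrt (kron ((1 / real CARD('u)) *\<^sub>R mat 1) \<sigma>)))\<^sup>2)"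


section \<open>Performance indices\<close>

definition hashed :: "('n::len0 bits \<Rightarrow> 'm::len0 bits) \<Rightarrow> ('n bits \<times> 'e::finite) op
    \<Rightarrow> ('m bits \<times> 'e) op" where
  "hashed f \<rho> = (\<Sum>k\<in>UNIV. kron (ket_bra (zket k)) (\<Sum>z\<in>f -` {k}. block zket z \<rho>))"

definition Q_PA :: "('n::len0 bits \<Rightarrow> 'm::len0 bits) \<Rightarrow> ('n bits \<times> 'e::finite) op \<Rightarrow> real" where
  "Q_PA f \<rho> = Re (trace \<rho>) - 2 powr (H_max (hashed f \<rho>) - real LENGTH('m))"

definition povm :: "('o::finite \<Rightarrow> 'b::finite op) \<Rightarrow> bool" where
  "povm M \<longleftrightarrow> (\<forall>e. psd (M e)) \<and> (\<Sum>e\<in>UNIV. M e) = mat 1"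

definition Q_EC :: "('n::len0 bits \<Rightarrow> 'l::len0 bits) \<Rightarrow> ('n bits \<times> 'b::finite) op \<Rightarrow> real" where
  "Q_EC g \<rho> = (INF M \<in> {M :: 'l bits \<Rightarrow> 'n bits \<Rightarrow> 'b op. \<forall>s. povm (M s)}.
     \<Sum>x\<in>UNIV. \<Sum>e | x + e \<noteq> 0. Re (trace (block xket x \<rho> ** M (g x) e)))"

definition Q_DC :: "('n::len0 bits \<Rightarrow> 'l::len0 bits) \<Rightarrow> ('n bits \<times> 'b::finite) op \<Rightarrow> real" where
  "Q_DC g \<rho> = (INF M \<in> {M :: 'l bits \<Rightarrow> 'n bits \<Rightarrow> 'b op. \<forall>s. povm (M s)}.
     \<Sum>x\<in>UNIV. \<Sum>e | e \<noteq> x. Re (trace (block xket x \<rho> ** M (g x) e)))"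


section \<open>Dual (random) functions\<close>

definition represents :: "bit Matrix.mat \<Rightarrow> ('n::len0 bits \<Rightarrow> 'k::len0 bits) \<Rightarrow> bool" where
  "represents M h \<longleftrightarrow> M \<in> carrier_mat LENGTH('k) LENGTH('n) \<and>
     (\<forall>z. vec_of_bits (h z) = M *\<^sub>v vec_of_bits z)"

definition dual_functions :: "('n::len0 bits \<Rightarrow> 'm::len0 bits) \<Rightarrow> ('n bits \<Rightarrow> 'l::len0 bits) \<Rightarrow> bool" where
  "dual_functions f g \<longleftrightarrow> (\<exists>M N. represents M f \<and> represents N g \<and>
     vec_space.rank LENGTH('m) M = LENGTH('m) \<and> vec_space.rank LENGTH('l) N = LENGTH('l) \<and>
     M * transpose_mat N = 0\<^sub>m LENGTH('m) LENGTH('l))"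

definition dual_random_functions ::
    "('n::len0 bits \<Rightarrow> 'm::len0 bits) pmf \<Rightarrow> ('n bits \<Rightarrow> 'l::len0 bits) pmf \<Rightarrow> bool" where
  "dual_random_functions F G \<longleftrightarrow> (\<exists>(k::nat) f g.
     inj_on f {..<k} \<and> inj_on g {..<k} \<and>
     set_pmf F \<subseteq> f ` {..<k} \<and> set_pmf G \<subseteq> g ` {..<k} \<and>
     (\<forall>i<k. dual_functions (f i) (g i) \<and> pmf F (f i) = pmf G (g i)))"

end

theory Submission
  imports Defs
begin

text \<open>
  Write the pure state as \<open>\<Sum>z. |z\<rangle> |\<psi> z\<rangle>\<close>, with \<open>\<psi> z\<close> a matrix from \<open>B\<close> to \<open>E\<close>, so that the \<open>x\<close> basis
  components are the Fourier transforms of \<open>\<psi>\<close>. By Uhlmann's theorem the fidelity in privacy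
  amplification is the maximum of \<open>\<parallel>\<Sum>k. W k \<phi>\<^sub>k\<^sup>*\<parallel>\<^sup>2\<close> over families of contractions \<open>W\<close>, where \<open>\<phi>\<^sub>k\<close>
  purifies the hashed state given \<open>k\<close>. Fourier transforming along the fibers of \<open>f\<close> turns every
  decoder for the dual function \<open>g\<close> into such a family. The converse uses that \<open>B\<close> holds a copy of \<open>z\<close>
  or \<open>E\<close> holds a copy of \<open>x\<close>. Hence the privacy amplification and data compression indices
  coincide for each dual pair. Applied to the identity map, with the roles of \<open>z, E\<close> and \<open>x, B\<close>
  exchanged, the same equality and the duality of the semidefinite program for guessing
  probabilities give \<open>H_min = n - H_max\<close>.
\<close>

section \<open>Adjoints and contractions\<close>

text \<open>A decoder always yields contractions, but a given family of contractions need not come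
  from a decoder: in the overlap, the contributions of different \<open>x\<close> may interfere.
  Standard form controls this. If \<open>B\<close> holds a copy of \<open>z\<close>, the decoder
  constructed below makes all contributions equal; if \<open>E\<close> holds a copy of
  \<open>x\<close>, they are mutually orthogonal. The two cases need different decoders with
  different normalizations, \<open>1 / sqrt (2 ^ m)\<close> and
  \<open>1 / sqrt (2 ^ m * 2 ^ n)\<close>, and in both the overlap is reproduced exactly. Duality of
  the functions enters only through three facts about characters, collected in
  \<open>dual_maps\<close>. This abstraction admits the identity paired with the map to the empty
  string, so the entropy relation needs no separate argument. Contractions between spaces of
  arbitrary dimensions take the place of unitaries in Uhlmann's theorem, so no dimension has to be
  padded. Optima are compared through bounds for each single operator, with an epsilon in the
  semidefinite duality, instead of through optimizers.\<close>

lemmas cart_eq_iff = Finite_Cartesian_Product.vec_eq_iff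

text \<open>Rectangular, unlike \<open>dagger\<close>: purifications are maps between different
  spaces.\<close>

definition adj :: "complex^'p::finite^'q::finite \<Rightarrow> complex^'q^'p" where
  "adj A = (\<chi> i j. cnj (A $ j $ i))"

lemma dagger_eq_adj: "dagger A = adj A"
  by (simp add: dagger_def adj_def cart_eq_iff map_matrix_def transpose_def)

lemma adj_adj [simp]: "adj (adj A) = A"
  by (simp add: adj_def cart_eq_iff)

lemma adj_mult: "adj (A ** B) = adj B ** adj A"
  by (simp add: adj_def cart_eq_iff matrix_matrix_mult_def mult.commute)

lemma adj_add: "adj (A + B) = adj A + adj B"
  by (simp add: adj_def cart_eq_iff)

lemma adj_diff: "adj (A - B) = adj A - adj B"
  by (simp add: adj_def cart_eq_iff)

lemma adj_scaleR: "adj (c *\<^sub>R A) = c *\<^sub>R adj A"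
  by (simp add: adj_def cart_eq_iff)

lemma adj_zero [simp]: "adj 0 = 0"
  by (simp add: adj_def cart_eq_iff)

lemma adj_mat1 [simp]: "adj (mat 1) = mat 1"
  by (auto simp: adj_def cart_eq_iff Finite_Cartesian_Product.mat_def)

lemma linear_adj: "linear adj"
  by (intro linearI adj_add adj_scaleR)

lemma adj_sum: "adj (sum h S) = (\<Sum>x\<in>S. adj (h x))"
  by (rule linear_sum[OF linear_adj])

lemma linear_matrix_mult_left: "linear (\<lambda>A :: complex^'q::finite^'r::finite. A ** (B :: complex^'p::finite^'q))"
  by (rule linearI)
     (simp_all add: cart_eq_iff matrix_matrix_mult_def distrib_right sum.distrib scaleR_right.sum)

lemma linear_matrix_mult_right: "linear (\<lambda>B :: complex^'p::finite^'q::finite. (A :: complex^'q^'r::finite) ** B)"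
  by (rule linearI)
     (simp_all add: cart_eq_iff matrix_matrix_mult_def distrib_left sum.distrib scaleR_right.sum)

lemma linear_matrix_vector_left: "linear (\<lambda>A :: complex^'p::finite^'q::finite. A *v x)"
  by (rule linearI)
     (simp_all add: cart_eq_iff matrix_vector_mult_def distrib_right sum.distrib scaleR_right.sum)

lemma matrix_vector_scaleR: "A *v (c *\<^sub>R x) = c *\<^sub>R (A *v x)" for A :: "complex^'p::finite^'q::finite"
  by (simp add: cart_eq_iff matrix_vector_mult_def scaleR_right.sum)

lemma matrix_vector_axis: "(A *v axis j 1) $ i = A $ i $ j" for A :: "complex^'p::finite^'q::finite"
  by (simp add: matrix_vector_mult_def axis_def if_distrib[of "(*) _"] cong: if_cong)

lemmas matrix_mult_sum_left = linear_sum[OF linear_matrix_mult_left]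
lemmas matrix_mult_sum_right = linear_sum[OF linear_matrix_mult_right]
lemmas matrix_mult_diff_left = linear_diff[OF linear_matrix_mult_left]
lemmas matrix_mult_diff_right = linear_diff[OF linear_matrix_mult_right]
lemmas matrix_mult_add_left = linear_add[OF linear_matrix_mult_left]
lemmas matrix_mult_add_right = linear_add[OF linear_matrix_mult_right]
lemmas matrix_mult_scaleR_left = linear_scale[OF linear_matrix_mult_left]
lemmas matrix_mult_scaleR_right = linear_scale[OF linear_matrix_mult_right]
lemmas matrix_mult_zero_left = linear_0[OF linear_matrix_mult_left]
lemmas matrix_mult_zero_right = linear_0[OF linear_matrix_mult_right]
lemmas sum_matrix_vector = linear_sum[OF linear_matrix_vector_left]
lemmas scaleR_matrix_vector = linear_scale[OF linear_matrix_vector_left]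

lemmas matrix_mult_linear =
  matrix_mult_diff_left matrix_mult_diff_right matrix_mult_add_left matrix_mult_add_right
  matrix_mult_scaleR_left matrix_mult_scaleR_right matrix_mult_zero_left matrix_mult_zero_right

text \<open>The \<open>inner\<close> of complex vectors is the real part of the Hermitian form. It
  already determines norms and positivity, and it makes the theory of real inner product spaces
  applicable.\<close>

lemma inner_adj: "inner (A *v x) y = inner x (adj A *v y)"
  for A :: "complex^'p::finite^'q::finite"
proof -
  have i: "inner (a * b) c = inner b (cnj a * c)" for a b c :: complex
    by (simp add: inner_complex_def algebra_simps)
  have "inner (A *v x) y = (\<Sum>i\<in>UNIV. \<Sum>j\<in>UNIV. inner (x $ j) (cnj (A $ i $ j) * y $ i))"
    by (simp add: inner_vec_def matrix_vector_mult_def inner_sum_left i)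
  also have "\<dots> = inner x (adj A *v y)"
    by (subst sum.swap) (simp add: inner_vec_def matrix_vector_mult_def adj_def inner_sum_right)
  finally show ?thesis .
qed

lemma inner_eq_trace: "inner A B = Re (trace (adj A ** B))"
  for A B :: "complex^'p::finite^'q::finite"
  unfolding inner_vec_def trace_def matrix_matrix_mult_def adj_def inner_complex_def
  by (subst sum.swap) (simp add: sum.distrib)

lemma trace_mult_commute: "trace (A ** B) = trace (B ** A)"
  for A :: "complex^'p::finite^'q::finite"
  unfolding trace_def matrix_matrix_mult_def
  by (simp, subst sum.swap) (simp add: mult.commute)

lemma norm_adj [simp]: "norm (adj A) = norm A"
proof -
  have "inner (adj A) (adj A) = inner A A"
    using trace_mult_commute[of A "adj A"] by (simp add: inner_eq_trace)
  then show ?thesis by (simp add: norm_eq_sqrt_inner)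
qed

lemma norm_sq_columns: "(norm A)\<^sup>2 = (\<Sum>j\<in>UNIV. (norm (A *v axis j 1))\<^sup>2)"
  for A :: "complex^'p::finite^'q::finite"
proof -
  have *: "(norm x)\<^sup>2 = (\<Sum>i\<in>UNIV. (norm (x $ i))\<^sup>2)" for x :: "'a::real_normed_vector^'c::finite"
    by (simp add: norm_vec_def L2_set_def sum_nonneg)
  show ?thesis
    unfolding * matrix_vector_axis by (rule sum.swap)
qed

text \<open>Operator norm at most one. Contractions replace the partial isometries of polar
  decompositions; they compose freely and exist between any two spaces.\<close>

definition contraction :: "complex^'p::finite^'q::finite \<Rightarrow> bool" where
  "contraction W \<longleftrightarrow> (\<forall>x. norm (W *v x) \<le> norm x)"

lemma contraction_mult: "contraction V \<Longrightarrow> contraction W \<Longrightarrow> contraction (V ** W)"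
  unfolding contraction_def by (metis matrix_vector_mul_assoc order.trans)

lemma contraction_adj: "contraction W \<Longrightarrow> contraction (adj W)"
  unfolding contraction_def
proof
  fix y assume W: "\<forall>x. norm (W *v x) \<le> norm x"
  let ?z = "adj W *v y"
  have "norm ?z * norm ?z = inner (W *v ?z) y"
    by (simp add: inner_adj flip: power2_eq_square power2_norm_eq_inner)
  also have "\<dots> \<le> norm (W *v ?z) * norm y" by (rule norm_cauchy_schwarz)
  also have "\<dots> \<le> norm ?z * norm y" using W by (simp add: mult_right_mono)
  finally show "norm ?z \<le> norm y"
    by (cases "norm ?z = 0") simp_all
qed

lemma norm_contraction_mult: "contraction W \<Longrightarrow> norm (W ** A) \<le> norm A"
proof (rule power2_le_imp_le)
  assume "contraction W"
  then show "(norm (W ** A))\<^sup>2 \<le> (norm A)\<^sup>2"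
    by (auto simp: norm_sq_columns contraction_def power_mono simp flip: matrix_vector_mul_assoc
        intro!: sum_mono)
qed simp

section \<open>Positive semidefinite operators\<close>

lemma psd_iff: "psd A \<longleftrightarrow> adj A = A \<and> (\<forall>v. 0 \<le> inner v (A *v v))"
  unfolding psd_def dagger_eq_adj inner_vec_def by (simp add: inner_complex_def)

lemma psd_adj [dest]: "psd A \<Longrightarrow> adj A = A"
  by (simp add: psd_iff)

lemma psd_zero [simp]: "psd 0"
  by (simp add: psd_iff)

lemma psd_mat1 [simp]: "psd (mat 1)"
  by (simp add: psd_iff)

lemma psd_add: "psd A \<Longrightarrow> psd B \<Longrightarrow> psd (A + B)"
  by (simp add: psd_iff adj_add matrix_vector_mult_add_rdistrib inner_add_right)

lemma psd_scaleR: "psd A \<Longrightarrow> 0 \<le> c \<Longrightarrow> psd (c *\<^sub>R A)"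
  by (simp add: psd_iff adj_scaleR scaleR_matrix_vector)

lemma psd_conj: "psd A \<Longrightarrow> psd (adj B ** A ** B)"
  by (auto simp: psd_iff adj_mult matrix_mul_assoc inner_adj[symmetric] simp flip: matrix_vector_mul_assoc)

lemma psd_adj_mult: "psd (adj B ** B)"
  using psd_conj[OF psd_mat1, of B] by simp

lemma psd_mult_adj: "psd (B ** adj B)"
  using psd_adj_mult[of "adj B"] by simp

lemma inner_mult_adj_vector: "inner v ((adj B ** B) *v v) = (norm (B *v v))\<^sup>2"
  by (metis inner_adj inner_commute matrix_vector_mul_assoc power2_norm_eq_inner)

section \<open>The spectral theorem\<close>

text \<open>Maximize the Rayleigh quotient over the unit sphere of \<open>T\<close>. Perturbing the
  maximizer in directions of \<open>T\<close> shows that the residual \<open>l x - A x\<close> is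
  orthogonal to \<open>T\<close>; it also lies in \<open>T\<close>, so it vanishes.\<close>

lemma symmetric_on_subspace_has_eigenvector:
  fixes A :: "complex^'i::finite^'i"
  assumes A: "adj A = A" and T: "Real_Vector_Spaces.subspace T" "T \<noteq> {0}" and AT: "\<And>x. x \<in> T \<Longrightarrow> A *v x \<in> T"
  obtains x d where "x \<in> T" "norm x = 1" "A *v x = d *\<^sub>R x"
proof -
  let ?K = "T \<inter> sphere 0 1"
  have K1: "compact ?K" using T by (intro closed_Int_compact closed_subspace) auto
  have K2: "?K \<noteq> {}"
  proof -
    obtain x where "x \<in> T" "x \<noteq> 0" using T subspace_0 by blast
    then have "(1 / norm x) *\<^sub>R x \<in> ?K" using T by (auto simp: subspace_scale)
    then show ?thesis by blast
  qed
  have K3: "continuous_on ?K (\<lambda>x. inner x (A *v x))"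
    by (intro continuous_intros matrix_vector_mult_linear_continuous_on)
  obtain x where x: "x \<in> ?K" and max: "\<And>y. y \<in> ?K \<Longrightarrow> inner y (A *v y) \<le> inner x (A *v x)"
    using continuous_attains_sup[OF K1 K2 K3] by blast
  define l where "l = inner x (A *v x)"
  have bound: "inner y (A *v y) \<le> l * inner y y" if "y \<in> T" for y
  proof (cases "y = 0")
    case False
    have "(1 / norm y) *\<^sub>R y \<in> ?K" using that T False by (auto simp: subspace_scale)
    from max[OF this] have "inner y (A *v y) / (norm y)\<^sup>2 \<le> l"
      by (simp add: l_def matrix_vector_scaleR power2_eq_square)
    then show ?thesis using False by (simp add: field_simps power2_norm_eq_inner)
  qed simp
  have "inner w (l *\<^sub>R x - A *v x) = 0" if w: "w \<in> T" for w
  proof -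
    define a where "a = inner w (l *\<^sub>R x - A *v x)"
    define b where "b = l * inner w w - inner w (A *v w)"
    have b: "b \<ge> 0" using bound[OF w] by (simp add: b_def)
    have key: "2 * t * a + t\<^sup>2 * b \<ge> 0" for t
    proof -
      have "x + t *\<^sub>R w \<in> T" using x w T by (auto intro: subspace_add subspace_scale)
      from bound[OF this]
      have "inner (x + t *\<^sub>R w) (A *v (x + t *\<^sub>R w)) \<le> l * inner (x + t *\<^sub>R w) (x + t *\<^sub>R w)" .
      moreover have "inner x (A *v w) = inner w (A *v x)"
        using A inner_adj[of A w x] inner_adj[of A x w] by (simp add: inner_commute)
      ultimately show ?thesis using x
        by (simp add: matrix_vector_right_distrib matrix_vector_scaleR a_def b_def power2_eq_square l_def inner_commute norm_eq_1 algebra_simps)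
    qed
    have "a = 0"
    proof (rule ccontr)
      assume "a \<noteq> 0"
      \<comment> \<open>\<open>t = - u\<close> almost minimizes the quadratic in \<open>key\<close>;
        the \<open>+ 1\<close> avoids a division by \<open>b = 0\<close>.\<close>
      define u where "u = a / (b + 1)"
      have a: "a = u * (b + 1)" using b by (simp add: u_def)
      have "2 * (- u) * a + (- u)\<^sup>2 * b = - (u\<^sup>2 * (b + 2))"
        unfolding a by (simp add: algebra_simps power2_eq_square)
      moreover have "u\<^sup>2 * (b + 2) > 0" using \<open>a \<noteq> 0\<close> a b by auto
      ultimately show False using key[of "- u"] by simp
    qed
    then show ?thesis by (simp add: a_def)
  qed
  moreover have "l *\<^sub>R x - A *v x \<in> T" using x T AT by (auto intro: subspace_diff subspace_scale)
  ultimately have "l *\<^sub>R x - A *v x = 0" by (metis inner_eq_zero_iff)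
  then show ?thesis using that[of x l] x by simp
qed

section \<open>Complex inner product and orthonormal eigenvectors\<close>

definition cinner :: "complex^'i::finite \<Rightarrow> complex^'i \<Rightarrow> complex" where
  "cinner u v = (\<Sum>i\<in>UNIV. cnj (u $ i) * v $ i)"

lemma Re_cinner: "Re (cinner u v) = inner u v"
  by (simp add: cinner_def inner_vec_def inner_complex_def)

lemma Im_cinner: "Im (cinner u v) = inner (\<i> *s u) v"
  by (simp add: cinner_def inner_vec_def inner_complex_def)

lemma cinner_self: "cinner u u = of_real ((norm u)\<^sup>2)"
  by (simp add: complex_eq_iff Re_cinner power2_norm_eq_inner)
     (simp add: cinner_def mult.commute)

lemma cinner_commute: "cinner u v = cnj (cinner v u)"
  by (simp add: cinner_def mult.commute)

lemma cinner_adj: "cinner (A *v x) y = cinner x (adj A *v y)"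
proof -
  have "cinner (A *v x) y = (\<Sum>i\<in>UNIV. \<Sum>j\<in>UNIV. cnj (x $ j) * (cnj (A $ i $ j) * y $ i))"
    by (simp add: cinner_def matrix_vector_mult_def sum_distrib_left sum_distrib_right mult_ac)
  also have "\<dots> = cinner x (adj A *v y)"
    by (subst sum.swap) (simp add: cinner_def matrix_vector_mult_def adj_def sum_distrib_left)
  finally show ?thesis .
qed

text \<open>Hermitian orthogonality to \<open>u\<close> is real orthogonality to \<open>u\<close>
  and to \<open>\<i> *s u\<close>. These are twice \<open>card S\<close> real conditions in a space
  of real dimension twice \<open>CARD('i)\<close>.\<close>

lemma exists_orthogonal_to_few:
  fixes u :: "'i::finite \<Rightarrow> complex^'i"
  assumes "S \<noteq> UNIV"
  obtains x where "x \<noteq> 0" "\<And>i. i \<in> S \<Longrightarrow> cinner (u i) x = 0"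
proof -
  let ?T = "u ` S \<union> (\<lambda>i. \<i> *s u i) ` S"
  have "card S < CARD('i)" using assms by (simp add: psubset_card_mono psubset_eq)
  have "Real_Vector_Spaces.dim ?T \<le> card ?T" by (rule dim_le_card') simp
  also have "\<dots> \<le> card (u ` S) + card ((\<lambda>i. \<i> *s u i) ` S)" by (rule card_Un_le)
  also have "\<dots> \<le> card S + card S" by (intro add_mono card_image_le) auto
  also have "\<dots> < DIM(complex^'i)" using \<open>card S < CARD('i)\<close> by simp
  finally obtain x where x: "x \<noteq> 0" "\<And>y. y \<in> Real_Vector_Spaces.span ?T \<Longrightarrow> inner x y = 0"
    using orthogonal_to_subspace_exists[of ?T] unfolding real_inner_class.orthogonal_def by metis
  show ?thesis
  proof (rule that[OF x(1)])
    fix i assume "i \<in> S"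
    then have "inner x (u i) = 0" "inner x (\<i> *s u i) = 0"
      by (auto intro!: x(2) span_base)
    then show "cinner (u i) x = 0"
      by (simp add: complex_eq_iff Re_cinner Im_cinner inner_commute)
  qed
qed

text \<open>The orthogonal complement of the eigenvectors found so far is invariant under
  \<open>A\<close>, hence contains another one. Indexing them by the type \<open>'i\<close> makes
  them the columns of a square matrix when \<open>S\<close> is everything.\<close>

lemma orthonormal_eigenvectors:
  fixes A :: "complex^'i::finite^'i" and S :: "'i set"
  assumes A: "adj A = A"
  shows "\<exists>u d. (\<forall>i\<in>S. A *v u i = (d i :: real) *\<^sub>R u i) \<and>
    (\<forall>i\<in>S. \<forall>j\<in>S. cinner (u i) (u j) = (if i = j then 1 else 0))"
  using finite[of S]
proof (induction S rule: finite_induct)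
  case (insert k S)
  then obtain u and d :: "'i \<Rightarrow> real" where u: "\<And>i. i \<in> S \<Longrightarrow> A *v u i = d i *\<^sub>R u i"
      "\<And>i j. i \<in> S \<Longrightarrow> j \<in> S \<Longrightarrow> cinner (u i) (u j) = (if i = j then 1 else 0)" by blast
  let ?T = "{x. \<forall>i\<in>S. cinner (u i) x = 0}"
  have T1: "Real_Vector_Spaces.subspace ?T"
    by (auto simp: real_vector.subspace_def cinner_def distrib_left sum.distrib scaleR_right.sum[symmetric])
  have T2: "?T \<noteq> {0}"
  proof -
    have "S \<noteq> UNIV" using insert by auto
    then obtain x where "x \<noteq> 0" "\<And>i. i \<in> S \<Longrightarrow> cinner (u i) x = 0"
      using exists_orthogonal_to_few by blast
    then show ?thesis by blast
  qed
  have T3: "A *v x \<in> ?T" if "x \<in> ?T" for x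
  proof -
    have "cinner (u i) (A *v x) = d i *\<^sub>R cinner (u i) x" if "i \<in> S" for i
      using cinner_adj[of A "u i" x] A u(1)[OF that]
      by (simp add: cinner_def scaleR_right.sum)
    then show ?thesis using that by simp
  qed
  obtain x e where x: "x \<in> ?T" "norm x = 1" "A *v x = e *\<^sub>R x"
    by (rule symmetric_on_subspace_has_eigenvector[OF A T1 T2 T3])
  have x0: "cinner (u i) x = 0" "cinner x (u i) = 0" if "i \<in> S" for i
    using x(1) that cinner_commute[of x "u i"] by simp_all
  have xx: "cinner x x = 1" using x(2) by (simp add: cinner_self)
  have "\<forall>i\<in>insert k S. A *v (u(k := x)) i = (d(k := e)) i *\<^sub>R (u(k := x)) i"
    using u(1) x(3) by auto
  moreover have "\<forall>i\<in>insert k S. \<forall>j\<in>insert k S.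
      cinner ((u(k := x)) i) ((u(k := x)) j) = (if i = j then 1 else 0)"
    using u(2) xx x0 insert.hyps by auto
  ultimately show ?case by blast
qed simp

section \<open>Diagonal operators and unitary diagonalization\<close>

definition diag_op :: "('i::finite \<Rightarrow> real) \<Rightarrow> complex^'i^'i" where
  "diag_op d = (\<chi> i j. if i = j then of_real (d i) else 0)"

lemma diag_op_mult: "diag_op d ** diag_op e = diag_op (\<lambda>i. d i * e i)"
  by (auto simp: diag_op_def cart_eq_iff matrix_matrix_mult_def if_distrib[of "\<lambda>x. x * _"] cong: if_cong)

lemma adj_diag_op [simp]: "adj (diag_op d) = diag_op d"
  by (auto simp: adj_def diag_op_def cart_eq_iff)

lemma diag_op_mult_vector: "diag_op d *v x = (\<chi> i. d i *\<^sub>R x $ i)"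
  by (auto simp: diag_op_def cart_eq_iff matrix_vector_mult_def scaleR_conv_of_real
      if_distrib[of "\<lambda>x. x * _"] cong: if_cong)

lemma psd_diag_op_iff: "psd (diag_op d) \<longleftrightarrow> (\<forall>i. 0 \<le> d i)"
proof
  assume "psd (diag_op d)"
  then have "0 \<le> inner (axis i 1) (diag_op d *v axis i 1)" for i by (simp add: psd_iff)
  then show "\<forall>i. 0 \<le> d i"
    by (simp add: inner_axis' diag_op_mult_vector)
next
  assume "\<forall>i. 0 \<le> d i"
  then show "psd (diag_op d)"
    by (auto simp: psd_iff diag_op_mult_vector inner_vec_def intro!: sum_nonneg mult_nonneg_nonneg)
qed

theorem spectral_theorem:
  fixes A :: "complex^'i::finite^'i"
  assumes A: "adj A = A"
  obtains U :: "complex^'i^'i" and d where "adj U ** U = mat 1" "U ** adj U = mat 1" "A = U ** diag_op d ** adj U"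
proof -
  obtain u and d :: "'i \<Rightarrow> real" where u: "\<And>i. A *v u i = d i *\<^sub>R u i"
      "\<And>i j. cinner (u i) (u j) = (if i = j then 1 else 0)"
    using orthonormal_eigenvectors[OF A, of UNIV] by auto
  define U where "U = (\<chi> j i. u i $ j)"
  have U: "adj U ** U = mat 1"
    using u(2) by (auto simp: cart_eq_iff U_def adj_def matrix_matrix_mult_def cinner_def
        Finite_Cartesian_Product.mat_def)
  then have U': "U ** adj U = mat 1" by (simp add: matrix_left_right_inverse)
  have "(A ** U) $ j $ i = (U ** diag_op d) $ j $ i" for j i
  proof -
    have "(A ** U) $ j $ i = (A *v u i) $ j"
      by (simp add: matrix_matrix_mult_def matrix_vector_mult_def U_def)
    also have "\<dots> = (U ** diag_op d) $ j $ i"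
      by (simp add: u(1) matrix_matrix_mult_def U_def diag_op_def if_distrib[where f = "\<lambda>x. _ * x"]
          cong: if_cong) (simp add: scaleR_conv_of_real)
    finally show ?thesis .
  qed
  then have "A ** U = U ** diag_op d" by (simp add: cart_eq_iff)
  then have "A = U ** diag_op d ** adj U"
    by (metis U' matrix_mul_assoc matrix_mul_rid)
  then show ?thesis using that U U' by blast
qed

lemma psd_spectral:
  fixes A :: "complex^'i::finite^'i"
  assumes A: "psd A"
  obtains U :: "complex^'i^'i" and d where "adj U ** U = mat 1" "U ** adj U = mat 1" "A = U ** diag_op d ** adj U" "\<forall>i. 0 \<le> d i"
proof -
  obtain U :: "complex^'i^'i" and d where U: "adj U ** U = mat 1" "U ** adj U = mat 1" "A = U ** diag_op d ** adj U"
    by (rule spectral_theorem[OF psd_adj[OF A]])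
  have "adj U ** A ** U = (adj U ** U) ** diag_op d ** (adj U ** U)"
    unfolding U(3) by (simp add: matrix_mul_assoc)
  then have "adj U ** A ** U = diag_op d" using U by simp
  then have "psd (diag_op d)" using psd_conj[OF A, of U] by simp
  then show ?thesis using that[OF U] by (simp add: psd_diag_op_iff)
qed

lemma unitary_conj_mult:
  "adj U ** U = mat 1 \<Longrightarrow> (U ** A ** adj U) ** (U ** B ** adj U) = U ** (A ** B) ** adj U"
  for U :: "complex^'i::finite^'i"
  by (metis matrix_mul_assoc matrix_mul_rid)

section \<open>Square roots, pseudo-inverses and the trace norm\<close>

lemma psd_sqrt_exists:
  fixes A :: "complex^'i::finite^'i"
  assumes "psd A"
  shows "\<exists>S. psd S \<and> S ** S = A"
proof -
  obtain U :: "complex^'i^'i" and d where U: "adj U ** U = mat 1" "U ** adj U = mat 1" "A = U ** diag_op d ** adj U" "\<forall>i. 0 \<le> d i"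
    by (rule psd_spectral[OF assms])
  let ?S = "U ** diag_op (\<lambda>i. sqrt (d i)) ** adj U"
  have "psd ?S" using psd_conj[of "diag_op (\<lambda>i. sqrt (d i))" "adj U"] U(4) by (simp add: psd_diag_op_iff)
  moreover have "?S ** ?S = A"
    using U by (simp add: unitary_conj_mult diag_op_mult)
  ultimately show ?thesis by blast
qed

text \<open>The residual \<open>w\<close> satisfies \<open>S w = - t w\<close>. For
  \<open>t > 0\<close> positivity forces \<open>w = 0\<close>; for \<open>t = 0\<close> the norm of
  \<open>S v\<close> vanishes directly.\<close>

lemma psd_sqrt_eigenvector:
  assumes S: "psd S" and e: "(S ** S) *v v = t\<^sup>2 *\<^sub>R v" and t: "t \<ge> 0"
  shows "S *v v = t *\<^sub>R v"
proof -
  define w where "w = S *v v - t *\<^sub>R v"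
  have "S *v w = - (t *\<^sub>R w)"
    using e by (simp add: w_def matrix_vector_mult_diff_distrib matrix_vector_scaleR
        scaleR_diff_right power2_eq_square flip: matrix_vector_mul_assoc)
  then have *: "0 \<le> - (t * inner w w)" using S by (metis psd_iff inner_minus_right inner_scaleR_right)
  show ?thesis
  proof (cases "t = 0")
    case True
    then have "(S ** S) *v v = 0" using e by simp
    then have "norm (S *v v) = 0"
      using inner_mult_adj_vector[of v S] S by (simp add: psd_adj)
    then show ?thesis using True by simp
  next
    case False
    then have "t > 0" using t by simp
    then have "inner w w = 0" using * by (metis inner_ge_zero mult_pos_pos neg_0_le_iff_le not_less order_le_less)
    then show ?thesis by (simp add: w_def)
  qed
qed

text \<open>Each vector of an eigenbasis of \<open>T\<close> is an eigenvector of
  \<open>S ** S\<close> for the squared eigenvalue, and positivity leaves only one root for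
  \<open>S\<close>.\<close>

lemma psd_sqrt_unique:
  fixes S T :: "complex^'i::finite^'i"
  assumes "psd S" "psd T" "S ** S = T ** T"
  shows "S = T"
proof -
  obtain U :: "complex^'i^'i" and d where U: "adj U ** U = mat 1" "U ** adj U = mat 1" "T = U ** diag_op d ** adj U" "\<forall>i. 0 \<le> d i"
    by (rule psd_spectral[OF assms(2)])
  have TU: "T ** U = U ** diag_op d" unfolding U(3) by (metis U(1) matrix_mul_assoc matrix_mul_rid)
  have T: "T *v (U *v axis i 1) = d i *\<^sub>R (U *v axis i 1)" for i
  proof -
    have "diag_op d *v axis i 1 = d i *\<^sub>R axis i 1"
      by (auto simp: diag_op_mult_vector cart_eq_iff axis_def)
    then show ?thesis
      using TU by (simp add: matrix_vector_mul_assoc) (simp add: matrix_vector_scaleR flip: matrix_vector_mul_assoc)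
  qed
  have "S *v (U *v axis i 1) = T *v (U *v axis i 1)" for i
    unfolding T
    by (rule psd_sqrt_eigenvector)
       (use assms U(4) T in \<open>simp_all add: matrix_vector_scaleR power2_eq_square flip: matrix_vector_mul_assoc\<close>)
  then have "(S ** U) *v axis i 1 = (T ** U) *v axis i 1" for i
    by (simp flip: matrix_vector_mul_assoc)
  then have "S ** U = T ** U"
    unfolding cart_eq_iff by (metis matrix_vector_axis)
  then show ?thesis using U by (metis matrix_mul_assoc matrix_mul_rid)
qed

lemma op_sqrt_eq: "psd S \<Longrightarrow> S ** S = A \<Longrightarrow> op_sqrt A = S"
  unfolding op_sqrt_def by (rule the_equality) (auto intro: psd_sqrt_unique)

lemma
  assumes "psd A"
  shows psd_op_sqrt: "psd (op_sqrt A)" and op_sqrt_square: "op_sqrt A ** op_sqrt A = A"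
  using psd_sqrt_exists[OF assms] op_sqrt_eq by metis+

section \<open>Pseudo-inverses, factorization and support projections\<close>

lemma mult_adj_eq_zero: "A ** adj A = 0 \<Longrightarrow> A = 0"
  for A :: "complex^'p::finite^'q::finite"
proof -
  assume "A ** adj A = 0"
  then have "inner (adj A) (adj A) = 0" by (simp add: inner_eq_trace trace_def)
  then show ?thesis by (metis adj_adj adj_zero inner_eq_zero_iff)
qed

text \<open>\<open>H\<close> is the Moore-Penrose inverse of \<open>G\<close> and \<open>P\<close>
  the projection onto its range: in an eigenbasis, nonzero eigenvalues are inverted and zero stays
  zero.\<close>

lemma pseudo_inverse_exists:
  fixes G :: "complex^'i::finite^'i"
  assumes "adj G = G"
  obtains H P where "adj H = H" "adj P = P" "P ** P = P" "G ** H = P" "H ** G = P" "P ** G = G"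
proof -
  obtain U :: "complex^'i^'i" and d where U: "adj U ** U = mat 1" "U ** adj U = mat 1" "G = U ** diag_op d ** adj U"
    by (rule spectral_theorem[OF assms])
  define h where "h i = (if d i = 0 then 0 else 1 / d i)" for i
  define p where "p i = (if d i = 0 then 0 else 1 :: real)" for i
  have e: "(\<lambda>i. d i * h i) = p" "(\<lambda>i. h i * d i) = p" "(\<lambda>i. p i * p i) = p" "(\<lambda>i. p i * d i) = d"
    by (auto simp: h_def p_def)
  note mult = unitary_conj_mult[OF U(1)] diag_op_mult e
  have hermitian: "adj (U ** diag_op x ** adj U) = U ** diag_op x ** adj U" for x
    by (simp add: adj_mult matrix_mul_assoc)
  show ?thesis
  proof (rule that)
    show "adj (U ** diag_op h ** adj U) = U ** diag_op h ** adj U" by (rule hermitian)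
    show "adj (U ** diag_op p ** adj U) = U ** diag_op p ** adj U" by (rule hermitian)
    show "(U ** diag_op p ** adj U) ** (U ** diag_op p ** adj U) = U ** diag_op p ** adj U"
      by (simp only: mult)
    show "G ** (U ** diag_op h ** adj U) = U ** diag_op p ** adj U" by (simp only: U(3) mult)
    show "(U ** diag_op h ** adj U) ** G = U ** diag_op p ** adj U" by (simp only: U(3) mult)
    show "(U ** diag_op p ** adj U) ** G = G" by (simp only: U(3) mult)
  qed
qed

text \<open>Two purifications of one operator differ by a contraction on the purifying space.
  \<open>C\<close> is the pseudo-inverse \<open>adj B ** H\<close> of \<open>B\<close> applied to
  \<open>A\<close>, and \<open>C ** adj C\<close> is a projection. With a positive root in place of
  \<open>A\<close> or \<open>B\<close> this serves as the polar decomposition.\<close>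

lemma douglas_factorization:
  fixes A :: "complex^'p::finite^'v::finite" and B :: "complex^'q::finite^'v"
  assumes eq: "A ** adj A = B ** adj B"
  obtains C where "contraction C" "A = B ** C"
proof -
  define G where "G = B ** adj B"
  have "adj G = G" by (simp add: G_def adj_mult)
  then obtain H P where H: "adj H = H" "adj P = P" "P ** P = P" "G ** H = P" "H ** G = P" "P ** G = G"
    by (rule pseudo_inverse_exists)
  \<comment> \<open>\<open>A\<close> and \<open>B\<close> both have the range of \<open>G\<close>,
    so \<open>P\<close> fixes them: the defect \<open>X - P ** X\<close> times its adjoint is
    zero.\<close>
  have fixes_range: "P ** X = X" if "X ** adj X = G" for X :: "complex^'r::finite^'v"
  proof -
    have GP: "G ** P = G" using H(2,6) \<open>adj G = G\<close> adj_mult[of P G] by simp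
    have "(X - P ** X) ** adj (X - P ** X) =
        X ** adj X - (X ** adj X) ** P - P ** (X ** adj X) + P ** ((X ** adj X) ** P)"
      by (simp add: adj_diff adj_mult H matrix_mult_linear matrix_mul_assoc)
    also have "\<dots> = 0" by (simp add: that GP H)
    finally have "X - P ** X = 0" by (rule mult_adj_eq_zero)
    then show ?thesis by simp
  qed
  define C where "C = adj B ** H ** A"
  have "B ** C = P ** A" by (simp add: C_def matrix_mul_assoc H flip: G_def)
  then have 1: "A = B ** C" using fixes_range[of A] eq by (simp add: G_def)
  define Q where "Q = adj B ** H ** B"
  have Q: "adj Q = Q" "Q ** Q = Q"
  proof -
    show "adj Q = Q" by (simp add: Q_def adj_mult H matrix_mul_assoc)
    have "Q ** Q = adj B ** H ** ((G ** H) ** B)" by (simp add: Q_def G_def matrix_mul_assoc)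
    also have "\<dots> = adj B ** H ** (P ** B)" by (simp only: H(4))
    finally show "Q ** Q = Q" using fixes_range[of B] by (simp add: G_def Q_def)
  qed
  have CC: "C ** adj C = Q"
  proof -
    have "C ** adj C = adj B ** H ** (A ** adj A) ** H ** B"
      by (simp add: C_def adj_mult H matrix_mul_assoc)
    also have "\<dots> = Q ** Q" by (simp add: eq Q_def matrix_mul_assoc)
    finally show ?thesis using Q by simp
  qed
  have "contraction (adj C)"
    unfolding contraction_def
  proof
    fix y
    have "(norm (adj C *v y))\<^sup>2 = inner y (Q *v y)"
      using inner_mult_adj_vector[of y "adj C"] CC by simp
    also have "\<dots> \<le> norm y * norm (Q *v y)" by (rule norm_cauchy_schwarz)
    finally have le: "(norm (adj C *v y))\<^sup>2 \<le> norm y * norm (Q *v y)" .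
    have "(norm (Q *v y))\<^sup>2 = (norm (adj C *v y))\<^sup>2"
      using inner_mult_adj_vector[of y "adj C"] inner_mult_adj_vector[of y Q] CC Q by simp
    then have "norm (Q *v y) = norm (adj C *v y)" by simp
    with le show "norm (adj C *v y) \<le> norm y"
      by (cases "norm (adj C *v y) = 0") (simp_all add: power2_eq_square mult.commute[of "norm y"])
  qed
  then have "contraction C" using contraction_adj by fastforce
  then show ?thesis using 1 that by blast
qed

text \<open>\<open>P\<close> projects onto the orthogonal complement of the kernel of
  \<open>B\<close>. The factor \<open>Y\<close> lets an identity \<open>B ** adj B' = 0\<close> pass
  to the support projections.\<close>

lemma support_projection_exists:
  fixes B :: "complex^'p::finite^'v::finite"
  obtains P Y where "adj P = P" "P ** P = P" "B ** P = B" "P = Y ** B"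
proof -
  define G where "G = adj B ** B"
  have "adj G = G" by (simp add: G_def adj_mult)
  then obtain H P where H: "adj H = H" "adj P = P" "P ** P = P" "G ** H = P" "H ** G = P" "P ** G = G"
    by (rule pseudo_inverse_exists)
  have GP: "G ** P = G" using H(2,6) \<open>adj G = G\<close> adj_mult[of P G] by simp
  have "adj (B - B ** P) ** (B - B ** P) = G - G ** P - P ** G + P ** (G ** P)"
    by (simp add: adj_diff adj_mult H matrix_mult_linear matrix_mul_assoc G_def)
  also have "\<dots> = 0" by (simp add: GP H)
  finally have "adj (B - B ** P) = 0"
    using mult_adj_eq_zero[of "adj (B - B ** P)"] by simp
  then have "B ** P = B" by (metis adj_adj adj_zero eq_iff_diff_eq_0)
  moreover have "P = (H ** adj B) ** B" using H(5) by (simp add: G_def matrix_mul_assoc)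
  ultimately show ?thesis using that H by blast
qed

section \<open>Positivity of traces and the variational formula for the trace norm\<close>

lemma psd_mult_trace_nonneg: "psd A \<Longrightarrow> psd M \<Longrightarrow> 0 \<le> Re (trace (A ** M))"
proof -
  assume A: "psd A" and M: "psd M"
  let ?R = "op_sqrt M"
  have "trace (A ** M) = trace (A ** ?R ** ?R)" by (simp add: matrix_mul_assoc[symmetric] op_sqrt_square[OF M])
  also have "\<dots> = trace (adj ?R ** A ** ?R)"
    using psd_op_sqrt[OF M] by (metis psd_adj trace_mult_commute matrix_mul_assoc)
  finally have "trace (A ** M) = trace (adj ?R ** A ** ?R)" .
  moreover have "0 \<le> Re (trace X)" if "psd X" for X :: "'a op"
  proof -
    have "0 \<le> Re (X $ i $ i)" for i
      using that[unfolded psd_iff, THEN conjunct2, rule_format, of "axis i 1"]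
      by (simp add: inner_axis' matrix_vector_axis)
    then show ?thesis by (simp add: trace_def sum_nonneg)
  qed
  ultimately show ?thesis using psd_conj[OF A, of ?R] by simp
qed

text \<open>With \<open>?S\<close> the absolute value of \<open>A\<close>, factorization gives
  \<open>A = adj C ** ?S\<close>. Splitting \<open>?S\<close> into two equal roots and applying
  Cauchy-Schwarz in the Hilbert-Schmidt norm leaves the trace of \<open>?S\<close>.\<close>

lemma trace_norm_ge:
  assumes "contraction W"
  shows "Re (trace (W ** A)) \<le> trace_norm A"
proof -
  let ?S = "op_sqrt (adj A ** A)"
  let ?R = "op_sqrt ?S"
  have S: "psd ?S" "?S ** ?S = adj A ** A" by (simp_all add: psd_op_sqrt op_sqrt_square psd_adj_mult)
  have R: "psd ?R" "?R ** ?R = ?S" by (simp_all add: psd_op_sqrt op_sqrt_square S)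
  obtain C where C: "contraction C" "adj A = ?S ** C"
    using douglas_factorization[of "adj A" ?S] S by (auto simp: psd_adj)
  have "A = adj C ** ?S" using C(2) by (metis adj_adj adj_mult psd_adj S(1))
  then have "trace (W ** A) = trace (W ** adj C ** ?R ** ?R)"
    by (simp add: R(2) matrix_mul_assoc[symmetric])
  also have "\<dots> = trace (adj ?R ** ((W ** adj C) ** ?R))"
    using R by (metis psd_adj trace_mult_commute matrix_mul_assoc)
  finally have "Re (trace (W ** A)) = inner ?R ((W ** adj C) ** ?R)" by (simp add: inner_eq_trace)
  also have "\<dots> \<le> norm ?R * norm ((W ** adj C) ** ?R)" by (rule norm_cauchy_schwarz)
  also have "\<dots> \<le> norm ?R * norm ?R"
    by (intro mult_left_mono norm_contraction_mult contraction_mult contraction_adj C assms) simp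
  also have "\<dots> = inner ?R ?R" by (simp add: power2_eq_square flip: power2_norm_eq_inner)
  also have "\<dots> = trace_norm A"
    by (simp add: inner_eq_trace psd_adj R trace_norm_def dagger_eq_adj)
  finally show ?thesis .
qed

text \<open>Factorization in the other direction writes the absolute value of \<open>A\<close> as a
  contraction times \<open>A\<close>.\<close>

lemma trace_norm_attained:
  obtains W where "contraction W" "Re (trace (W ** A)) = trace_norm A"
proof -
  let ?S = "op_sqrt (adj A ** A)"
  have S: "psd ?S" "?S ** ?S = adj A ** A" by (simp_all add: psd_op_sqrt op_sqrt_square psd_adj_mult)
  obtain C where C: "contraction C" "?S = adj A ** C"
    using douglas_factorization[of ?S "adj A"] S by (auto simp: psd_adj)
  have "?S = adj C ** A" using C(2) by (metis adj_adj adj_mult psd_adj S(1))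
  then have "trace_norm A = Re (trace (adj C ** A))"
    unfolding trace_norm_def dagger_eq_adj by simp
  then show ?thesis using that contraction_adj C(1) by metis
qed

section \<open>Fidelities of block-diagonal operators\<close>

lemma sum_prod_UNIV: "sum h UNIV = (\<Sum>a\<in>UNIV. \<Sum>b\<in>UNIV. h (a, b))"
  by (simp add: sum.cartesian_product)

lemma kron_mult: "kron A B ** kron C D = kron (A ** C) (B ** D)"
  by (simp add: kron_def cart_eq_iff matrix_matrix_mult_def sum_prod_UNIV sum_product mult_ac)

lemma adj_kron: "adj (kron A B) = kron (adj A) (adj B)"
  by (simp add: kron_def cart_eq_iff adj_def)

lemma linear_kron_left: "linear (\<lambda>A. kron A B)"
  by (rule linearI) (simp_all add: kron_def cart_eq_iff distrib_right)

lemma linear_kron_right: "linear (kron A)"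
  by (rule linearI) (simp_all add: kron_def cart_eq_iff distrib_left)

lemmas kron_zero_left [simp] = linear_0[OF linear_kron_left]

lemma trace_kron: "trace (kron A B) = trace A * trace B"
  by (simp add: trace_def kron_def sum_prod_UNIV sum_product)

lemma linear_Re_trace: "linear (\<lambda>A :: complex^'i::finite^'i. Re (trace A))"
  by (rule linearI) (simp_all add: trace_def sum.distrib sum_distrib_left)

lemma trace_scaleR: "trace (c *\<^sub>R A) = of_real c * trace A" for A :: "complex^'i::finite^'i"
  by (simp add: trace_def scaleR_conv_of_real[of _ "_ :: complex"] sum_distrib_left)

lemmas Re_trace_sum = linear_sum[OF linear_Re_trace]
lemmas Re_trace_scaleR = linear_scale[OF linear_Re_trace]
lemmas Re_trace_add = linear_add[OF linear_Re_trace]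
lemmas Re_trace_diff = linear_diff[OF linear_Re_trace]

lemma adj_ket_bra [simp]: "adj (ket_bra v) = ket_bra v"
  by (simp add: adj_def ket_bra_def cart_eq_iff mult.commute)

lemma ket_bra_mult: "ket_bra u ** ket_bra v = (\<chi> i j. cinner u v * (u $ i * cnj (v $ j)))"
  by (simp add: ket_bra_def cart_eq_iff matrix_matrix_mult_def cinner_def sum_distrib_left sum_distrib_right mult_ac)

lemma trace_ket_bra: "trace (ket_bra v) = cinner v v"
  by (simp add: trace_def ket_bra_def cinner_def mult.commute)

definition orthonormal_basis :: "('u::finite \<Rightarrow> complex^'u) \<Rightarrow> bool" where
  "orthonormal_basis ket \<longleftrightarrow> (\<forall>k l. cinner (ket k) (ket l) = (if k = l then 1 else 0))"

lemma orthonormal_basis_complete: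
  assumes "orthonormal_basis ket"
  shows "(\<Sum>k\<in>UNIV. ket_bra (ket k)) = mat 1"
proof -
  define U where "U = (\<chi> j k. ket k $ j)"
  have "adj U ** U = mat 1"
    using assms by (auto simp: cart_eq_iff U_def adj_def matrix_matrix_mult_def cinner_def
        orthonormal_basis_def Finite_Cartesian_Product.mat_def)
  then have "U ** adj U = mat 1" by (simp add: matrix_left_right_inverse)
  moreover have "(\<Sum>k\<in>UNIV. ket_bra (ket k)) = U ** adj U"
    by (simp add: cart_eq_iff matrix_matrix_mult_def U_def adj_def ket_bra_def)
  ultimately show ?thesis by simp
qed

text \<open>Classical-quantum operators. The basis is kept arbitrary to cover \<open>zket\<close>
  and \<open>xket\<close> at once.\<close>

definition block_diag :: "('u::finite \<Rightarrow> complex^'u) \<Rightarrow> ('u \<Rightarrow> 'v::finite op) \<Rightarrow> ('u \<times> 'v) op" where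
  "block_diag ket S = (\<Sum>k\<in>UNIV. kron (ket_bra (ket k)) (S k))"

definition gram :: "('k \<Rightarrow> complex^'p::finite^'v::finite) \<Rightarrow> 'k \<Rightarrow> 'v op" where
  "gram \<phi> k = \<phi> k ** adj (\<phi> k)"

lemma psd_gram [simp]: "psd (gram \<phi> k)"
  by (simp add: gram_def psd_mult_adj)

text \<open>The objective of \<open>H_max\<close> on classical-quantum operators: the alphabet size
  cancels against the normalization of the maximally mixed register, whose root enters the trace
  norm linearly and is then squared.\<close>

definition fidelity :: "('k::finite \<Rightarrow> 'v::finite op) \<Rightarrow> 'v op \<Rightarrow> real" where
  "fidelity R \<sigma> = (\<Sum>k\<in>UNIV. trace_norm (op_sqrt (R k) ** op_sqrt \<sigma>))\<^sup>2"

context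
  fixes ket :: "'u::finite \<Rightarrow> complex^'u"
  assumes ket: "orthonormal_basis ket"
begin

lemma block_diag_mult: "block_diag ket S ** block_diag ket T = block_diag ket (\<lambda>k. S k ** T k)"
proof -
  have kb: "ket_bra (ket k) ** ket_bra (ket l) = (if k = l then ket_bra (ket k) else 0)" for k l
    using ket unfolding ket_bra_mult orthonormal_basis_def by (auto simp: ket_bra_def cart_eq_iff)
  have "block_diag ket S ** block_diag ket T =
      (\<Sum>k\<in>UNIV. \<Sum>l\<in>UNIV. if k = l then kron (ket_bra (ket k)) (S k ** T k) else 0)"
    unfolding block_diag_def matrix_mult_sum_left matrix_mult_sum_right
    by (intro sum.cong refl) (simp add: kron_mult kb)
  then show ?thesis by (simp add: block_diag_def)
qed

lemma adj_block_diag: "adj (block_diag ket S) = block_diag ket (\<lambda>k. adj (S k))"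
  by (simp add: block_diag_def adj_sum adj_kron)

lemma psd_block_diag:
  assumes "\<And>k. psd (S k)"
  shows "psd (block_diag ket S)"
proof -
  have "block_diag ket S = adj (block_diag ket (\<lambda>k. op_sqrt (S k))) ** block_diag ket (\<lambda>k. op_sqrt (S k))"
    by (simp add: adj_block_diag block_diag_mult psd_adj[OF psd_op_sqrt[OF assms]] op_sqrt_square[OF assms])
  then show ?thesis by (metis psd_adj_mult)
qed

lemma op_sqrt_block_diag:
  assumes "\<And>k. psd (S k)"
  shows "op_sqrt (block_diag ket S) = block_diag ket (\<lambda>k. op_sqrt (S k))"
  by (intro op_sqrt_eq psd_block_diag psd_op_sqrt assms)
     (simp add: block_diag_mult op_sqrt_square assms)

lemma Re_trace_block_diag: "Re (trace (block_diag ket S)) = (\<Sum>k\<in>UNIV. Re (trace (S k)))"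
proof -
  have "trace (kron (ket_bra (ket k)) (S k)) = trace (S k)" for k
    using ket by (simp add: trace_kron trace_ket_bra orthonormal_basis_def)
  then show ?thesis by (simp add: block_diag_def Re_trace_sum)
qed

lemma trace_norm_block_diag: "trace_norm (block_diag ket S) = (\<Sum>k\<in>UNIV. trace_norm (S k))"
  by (simp add: trace_norm_def dagger_eq_adj adj_block_diag block_diag_mult op_sqrt_block_diag
      psd_adj_mult Re_trace_block_diag)

lemma kron_mat1_eq_block_diag: "kron (mat 1) \<sigma> = block_diag ket (\<lambda>_. \<sigma>)"
  by (simp add: block_diag_def orthonormal_basis_complete[OF ket, symmetric] linear_sum[OF linear_kron_left])

lemma op_le_block_diag_iff: "op_le (block_diag ket R) (kron (mat 1) \<sigma>) \<longleftrightarrow> (\<forall>k. psd (\<sigma> - R k))"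
proof -
  have d: "kron (mat 1) \<sigma> - block_diag ket R = block_diag ket (\<lambda>k. \<sigma> - R k)"
    unfolding kron_mat1_eq_block_diag
    by (simp add: block_diag_def sum_subtractf linear_diff[OF linear_kron_right])
  have "psd (S k)" if S: "psd (block_diag ket S)" for S :: "'u \<Rightarrow> 'v::finite op" and k
  proof -
    \<comment> \<open>The isometry that tensors with \<open>ket k\<close>; compression by it
      extracts the block \<open>k\<close>.\<close>
    define J :: "complex^'v^('u \<times> 'v)" where "J = (\<chi> p w. if snd p = w then ket k $ fst p else 0)"
    have JL: "(adj J ** X) $ v $ q = (\<Sum>a\<in>UNIV. cnj (ket k $ a) * X $ (a, v) $ q)"
      for X :: "complex^('u \<times> 'v)^('u \<times> 'v)" and v q
      by (simp add: J_def adj_def matrix_matrix_mult_def sum_prod_UNIV if_distrib[of "\<lambda>x. x * _"]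
          if_distrib[of cnj] cong: if_cong)
    have JR: "(Y ** J) $ v $ w = (\<Sum>a\<in>UNIV. Y $ v $ (a, w) * ket k $ a)"
      for Y :: "complex^('u \<times> 'v)^'v" and v w
      by (simp add: J_def matrix_matrix_mult_def sum_prod_UNIV if_distrib[of "\<lambda>x. _ * x"] cong: if_cong)
    have "adj J ** kron (ket_bra (ket l)) (S l) ** J = (if l = k then S k else 0)" for l
    proof -
      have "(adj J ** kron (ket_bra (ket l)) (S l) ** J) $ v $ w =
          cinner (ket k) (ket l) * cinner (ket l) (ket k) * S l $ v $ w" for v w
        unfolding JL JR
        by (simp add: kron_def ket_bra_def cinner_def sum_product sum_distrib_left sum_distrib_right mult_ac)
           (rule sum.swap)
      then show ?thesis using ket by (auto simp: cart_eq_iff orthonormal_basis_def)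
    qed
    then have "adj J ** block_diag ket S ** J = S k"
      by (simp add: block_diag_def matrix_mult_sum_left matrix_mult_sum_right)
    then show ?thesis using psd_conj[OF S, of J] by simp
  qed
  then show ?thesis unfolding op_le_def d by (auto intro: psd_block_diag)
qed

lemma fidelity_block_diag:
  fixes R :: "'u \<Rightarrow> 'v::finite op"
  assumes R: "\<And>k. psd (R k)" and \<sigma>: "psd \<sigma>"
  shows "real CARD('u) * (trace_norm (op_sqrt (block_diag ket R) **
      op_sqrt (kron ((1 / real CARD('u)) *\<^sub>R mat 1) \<sigma>)))\<^sup>2 = fidelity R \<sigma>"
proof -
  let ?c = "1 / real CARD('u)"
  have scale: "trace_norm (c *\<^sub>R A) = c * trace_norm A" if "c \<ge> 0" for c and A :: "('u \<times> 'v) op"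
  proof -
    have "op_sqrt (adj (c *\<^sub>R A) ** (c *\<^sub>R A)) = c *\<^sub>R op_sqrt (adj A ** A)"
      by (intro op_sqrt_eq psd_scaleR that psd_op_sqrt psd_adj_mult)
         (simp add: adj_scaleR matrix_mult_linear op_sqrt_square psd_adj_mult)
    then show ?thesis by (simp add: trace_norm_def dagger_eq_adj Re_trace_scaleR)
  qed
  have "op_sqrt (kron (?c *\<^sub>R mat 1) \<sigma>) = sqrt ?c *\<^sub>R block_diag ket (\<lambda>_. op_sqrt \<sigma>)"
  proof (rule op_sqrt_eq)
    show "psd (sqrt ?c *\<^sub>R block_diag ket (\<lambda>_. op_sqrt \<sigma>))"
      by (intro psd_scaleR psd_block_diag psd_op_sqrt \<sigma>) simp
    show "(sqrt ?c *\<^sub>R block_diag ket (\<lambda>_. op_sqrt \<sigma>)) ** (sqrt ?c *\<^sub>R block_diag ket (\<lambda>_. op_sqrt \<sigma>))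
        = kron (?c *\<^sub>R mat 1) \<sigma>"
      by (simp add: matrix_mult_linear block_diag_mult op_sqrt_square \<sigma> linear_scale[OF linear_kron_left]
          kron_mat1_eq_block_diag)
  qed
  then have "op_sqrt (block_diag ket R) ** op_sqrt (kron (?c *\<^sub>R mat 1) \<sigma>)
      = sqrt ?c *\<^sub>R block_diag ket (\<lambda>k. op_sqrt (R k) ** op_sqrt \<sigma>)"
    by (simp add: matrix_mult_linear op_sqrt_block_diag R block_diag_mult)
  then have "trace_norm (op_sqrt (block_diag ket R) ** op_sqrt (kron (?c *\<^sub>R mat 1) \<sigma>))
      = sqrt ?c * (\<Sum>k\<in>UNIV. trace_norm (op_sqrt (R k) ** op_sqrt \<sigma>))"
    by (simp add: scale trace_norm_block_diag del: real_sqrt_divide)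
  then show ?thesis by (simp add: fidelity_def power_mult_distrib)
qed

end

text \<open>
  The next two lemmas are Uhlmann's theorem: the matrix \<open>\<phi> k\<close> is a purification of \<open>\<phi> k ** adj (\<phi> k)\<close>.
\<close>

lemma fidelity_le_overlap:
  fixes \<phi> :: "'u::finite \<Rightarrow> complex^'p::finite^'v::finite"
  assumes "normalized_state \<sigma>"
  obtains W :: "'u \<Rightarrow> complex^'p^'v" where "\<And>k. contraction (W k)"
    "fidelity (gram \<phi>) \<sigma> \<le> (norm (\<Sum>k\<in>UNIV. W k ** adj (\<phi> k)))\<^sup>2"
proof -
  have \<sigma>: "psd \<sigma>" "trace \<sigma> = 1" using assms by (simp_all add: normalized_state_def)
  let ?S = "op_sqrt \<sigma>"
  have "\<exists>W :: complex^'p^'v. contraction W \<and>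
      trace_norm (op_sqrt (\<phi> k ** adj (\<phi> k)) ** ?S) = Re (trace (W ** adj (\<phi> k) ** ?S))" for k
  proof -
    let ?R = "op_sqrt (\<phi> k ** adj (\<phi> k))"
    have R: "psd ?R" "?R ** ?R = \<phi> k ** adj (\<phi> k)"
      by (simp_all add: psd_op_sqrt op_sqrt_square psd_mult_adj)
    obtain Y where Y: "contraction Y" "?R = \<phi> k ** Y"
      using douglas_factorization[of ?R "\<phi> k"] R by (auto simp: psd_adj)
    have RY: "?R = adj Y ** adj (\<phi> k)" using Y(2) by (metis adj_mult psd_adj R(1))
    obtain C where C: "contraction C" "Re (trace (C ** (?R ** ?S))) = trace_norm (?R ** ?S)"
      by (rule trace_norm_attained)
    have "C ** (?R ** ?S) = (C ** adj Y) ** adj (\<phi> k) ** ?S"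
      by (subst RY) (simp only: matrix_mul_assoc)
    then show ?thesis
      using C contraction_mult[OF C(1) contraction_adj[OF Y(1)]] by metis
  qed
  then obtain W :: "'u \<Rightarrow> complex^'p^'v" where W: "\<And>k. contraction (W k)"
    "\<And>k. trace_norm (op_sqrt (\<phi> k ** adj (\<phi> k)) ** ?S) = Re (trace (W k ** adj (\<phi> k) ** ?S))"
    by metis
  let ?X = "\<Sum>k\<in>UNIV. W k ** adj (\<phi> k)"
  have S: "norm ?S = 1"
  proof -
    have "(norm ?S)\<^sup>2 = 1"
      using \<sigma> by (simp add: power2_norm_eq_inner inner_eq_trace psd_adj psd_op_sqrt op_sqrt_square)
    then show ?thesis using power2_eq_iff_nonneg[of "norm ?S" 1] by simp
  qed
  have "(\<Sum>k\<in>UNIV. trace_norm (op_sqrt (\<phi> k ** adj (\<phi> k)) ** ?S)) = Re (trace (?X ** ?S))"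
    by (simp add: W(2) matrix_mult_sum_left Re_trace_sum)
  also have "\<dots> = inner ?S ?X"
    using \<sigma> by (simp add: inner_eq_trace psd_adj psd_op_sqrt trace_mult_commute[of ?X])
  finally have eq: "(\<Sum>k\<in>UNIV. trace_norm (op_sqrt (\<phi> k ** adj (\<phi> k)) ** ?S)) = inner ?S ?X" .
  have "\<bar>inner ?S ?X\<bar> \<le> norm ?X" using Cauchy_Schwarz_ineq2[of ?S ?X] S by simp
  then have "(inner ?S ?X)\<^sup>2 \<le> (norm ?X)\<^sup>2" by (simp flip: abs_le_square_iff)
  then show ?thesis by (intro that[of W] W(1)) (simp only: fidelity_def gram_def eq)
qed

lemma overlap_le_fidelity:
  fixes \<phi> :: "'u::finite \<Rightarrow> complex^'p::finite^'v::finite" and W :: "'u \<Rightarrow> complex^'p^'q::finite"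
  assumes W: "\<And>k. contraction (W k)"
  obtains \<sigma> where "normalized_state \<sigma>"
    "(norm (\<Sum>k\<in>UNIV. W k ** adj (\<phi> k)))\<^sup>2 \<le> fidelity (gram \<phi>) \<sigma>"
proof -
  define X where "X = (\<Sum>k\<in>UNIV. W k ** adj (\<phi> k))"
  show ?thesis
  proof (cases "X = 0")
    \<comment> \<open>The overlap vanishes, so any state serves; the maximally mixed one shows that
      states exist.\<close>
    case True
    have "normalized_state ((1 / real CARD('v)) *\<^sub>R mat 1 :: 'v op)"
      unfolding normalized_state_def
      by (intro conjI psd_scaleR psd_mat1)
         (simp_all add: trace_def Finite_Cartesian_Product.mat_def scaleR_conv_of_real[of _ "1 :: complex"])
    then show ?thesis using that True by (simp add: X_def fidelity_def)
  next
    case False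
    define Z where "Z = op_sqrt (adj X ** X)"
    have Z: "psd Z" "Z ** Z = adj X ** X"
      by (simp_all add: Z_def psd_op_sqrt op_sqrt_square psd_adj_mult)
    have nZ: "norm Z = norm X"
    proof -
      have "(norm Z)\<^sup>2 = (norm X)\<^sup>2"
        using Z by (simp add: power2_norm_eq_inner inner_eq_trace psd_adj)
      then show ?thesis by simp
    qed
    obtain C' where C': "contraction C'" "Z = adj X ** C'"
      using douglas_factorization[of Z "adj X"] Z by (auto simp: psd_adj)
    define C where "C = adj C'"
    have C: "contraction C" "Z = C ** X"
      using contraction_adj[OF C'(1)] C'(2) Z(1) unfolding C_def
      by (auto dest!: psd_adj) (metis adj_adj adj_mult)
    \<comment> \<open>The state that makes Cauchy-Schwarz sharp: its root is proportional to the
      absolute value \<open>Z\<close> of \<open>X\<close>.\<close>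
    define \<sigma> where "\<sigma> = (1 / (norm X)\<^sup>2) *\<^sub>R (Z ** Z)"
    have S: "op_sqrt \<sigma> = (1 / norm X) *\<^sub>R Z"
      by (intro op_sqrt_eq psd_scaleR Z) (simp_all add: \<sigma>_def matrix_mult_linear power2_eq_square)
    have "trace (Z ** Z) = (norm X)\<^sup>2"
    proof -
      have "Re (trace (Z ** Z)) = (norm X)\<^sup>2"
        using Z nZ by (metis inner_eq_trace power2_norm_eq_inner psd_adj)
      moreover have "Im (trace (adj A ** A)) = 0" for A :: "complex^'v^'q"
        by (simp add: trace_def adj_def matrix_matrix_mult_def mult.commute)
      ultimately show ?thesis using Z(2) by (simp add: complex_eq_iff)
    qed
    then have "trace \<sigma> = 1"
      using False trace_scaleR[of "1 / (norm X)\<^sup>2" "Z ** Z"] by (simp add: \<sigma>_def scaleR_conv_of_real)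
    moreover have "psd \<sigma>" using psd_adj_mult[of X] by (simp add: \<sigma>_def Z psd_scaleR)
    ultimately have \<sigma>: "normalized_state \<sigma>" by (simp add: normalized_state_def)
    have le: "Re (trace (C ** (W k ** adj (\<phi> k)) ** op_sqrt \<sigma>))
        \<le> trace_norm (op_sqrt (\<phi> k ** adj (\<phi> k)) ** op_sqrt \<sigma>)" for k
    proof -
      define R where "R = op_sqrt (\<phi> k ** adj (\<phi> k))"
      have R: "psd R" "R ** R = \<phi> k ** adj (\<phi> k)"
        by (simp_all add: R_def psd_op_sqrt op_sqrt_square psd_mult_adj)
      obtain Y where Y: "contraction Y" "\<phi> k = R ** Y"
        using douglas_factorization[of "\<phi> k" R] R by (auto simp: psd_adj)
      have "adj (\<phi> k) = adj Y ** R" using Y(2) by (metis adj_mult psd_adj R(1))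
      then have "C ** (W k ** adj (\<phi> k)) ** op_sqrt \<sigma> = (C ** W k ** adj Y) ** (R ** op_sqrt \<sigma>)"
        by (simp add: matrix_mul_assoc)
      then show ?thesis
        using trace_norm_ge[of "C ** W k ** adj Y"] C(1) W Y(1)
        by (simp add: contraction_mult contraction_adj R_def)
    qed
    have "norm X = Re (trace (Z ** op_sqrt \<sigma>))"
    proof -
      have "Re (trace (Z ** op_sqrt \<sigma>)) = (norm X)\<^sup>2 / norm X"
        using \<open>trace (Z ** Z) = _\<close> by (simp add: S matrix_mult_linear Re_trace_scaleR)
      then show ?thesis using False by (simp add: power2_eq_square)
    qed
    also have "\<dots> = (\<Sum>k\<in>UNIV. Re (trace (C ** (W k ** adj (\<phi> k)) ** op_sqrt \<sigma>)))"
      by (simp add: C(2) X_def matrix_mult_sum_right matrix_mult_sum_left Re_trace_sum)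
    also have "\<dots> \<le> (\<Sum>k\<in>UNIV. trace_norm (op_sqrt (\<phi> k ** adj (\<phi> k)) ** op_sqrt \<sigma>))"
      by (intro sum_mono le)
    finally show ?thesis using that[OF \<sigma>] by (simp add: X_def fidelity_def gram_def power_mono)
  qed
qed

section \<open>Duality for guessing probabilities\<close>

lemma Re_trace_mult_ket_bra: "Re (trace (A ** ket_bra v)) = inner v (A *v v)"
proof -
  have "trace (A ** ket_bra v) = cinner v (A *v v)"
    by (simp add: trace_def matrix_matrix_mult_def ket_bra_def cinner_def matrix_vector_mult_def
        sum_distrib_left mult_ac)
  then show ?thesis by (simp add: Re_cinner)
qed

lemma psd_ket_bra: "psd (ket_bra v)"
proof -
  have "inner w (ket_bra v *v w) = (cmod (cinner v w))\<^sup>2" for w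
  proof -
    have "ket_bra v *v w = (\<chi> i. cinner v w * v $ i)"
      by (simp add: cart_eq_iff ket_bra_def matrix_vector_mult_def cinner_def sum_distrib_left sum_distrib_right mult_ac)
    then have "cinner w (ket_bra v *v w) = cinner v w * cinner w v"
      by (simp add: cinner_def sum_distrib_left sum_distrib_right mult_ac) (rule sum.swap)
    also have "\<dots> = of_real ((cmod (cinner v w))\<^sup>2)"
      by (subst cinner_commute[of w v]) (rule complex_norm_square[symmetric])
    finally show ?thesis by (metis Re_cinner Re_complex_of_real)
  qed
  then show ?thesis by (simp add: psd_iff)
qed

lemma psd_trace_zero: "psd H \<Longrightarrow> Re (trace H) \<le> 0 \<Longrightarrow> H = 0"
proof -
  assume H: "psd H" "Re (trace H) \<le> 0"
  let ?Q = "op_sqrt H"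
  have "inner ?Q ?Q \<le> 0" using H by (simp add: inner_eq_trace psd_adj psd_op_sqrt op_sqrt_square)
  then have "?Q = 0" by (metis inner_eq_zero_iff inner_ge_zero order_antisym)
  then show ?thesis using op_sqrt_square[OF H(1)] by (simp add: matrix_mult_linear)
qed

definition success :: "('z::finite \<Rightarrow> 'v::finite op) \<Rightarrow> ('z \<Rightarrow> 'v op) \<Rightarrow> real" where
  "success R M = (\<Sum>z\<in>UNIV. Re (trace (R z ** M z)))"

text \<open>Weak duality: each \<open>R z\<close> is replaced by its upper bound
  \<open>\<sigma>\<close>, and the measurement sums to the identity.\<close>

lemma success_le_trace:
  assumes M: "povm M" and \<sigma>: "\<And>z. psd (\<sigma> - R z)"
  shows "success R M \<le> Re (trace \<sigma>)"
proof -
  have "Re (trace (R z ** M z)) \<le> Re (trace (\<sigma> ** M z))" for z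
    using psd_mult_trace_nonneg[OF \<sigma>, of "M z" z] M
    by (simp add: povm_def matrix_mult_linear Re_trace_diff)
  then have "success R M \<le> (\<Sum>z\<in>UNIV. Re (trace (\<sigma> ** M z)))"
    unfolding success_def by (rule sum_mono)
  also have "\<dots> = Re (trace (\<sigma> ** (\<Sum>z\<in>UNIV. M z)))"
    by (simp add: matrix_mult_sum_right Re_trace_sum)
  finally show ?thesis using M by (simp add: povm_def)
qed

lemma trivial_povm: "povm (\<lambda>z :: 'z::finite. if z = z0 then mat 1 else 0)"
  by (simp add: povm_def)

text \<open>
  Separating \<open>(I, \<alpha>)\<close> from the cone of all \<open>(\<Sum>z. M z, success R M)\<close> with \<open>M z\<close> positive. The
  anti-Hermitian matrices are added to the cone to make the separating functional Hermitian.
\<close>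

lemma success_duality:
  fixes R :: "'z::finite \<Rightarrow> 'v::finite op"
  assumes herm: "\<And>z. adj (R z) = R z" and less: "\<And>M. povm M \<Longrightarrow> success R M < \<alpha>"
  obtains \<sigma> where "\<And>z. psd (\<sigma> - R z)" "Re (trace \<sigma>) \<le> \<alpha>"
proof -
  define E where "E M K = ((\<Sum>z\<in>UNIV. M z) + (K - adj K), success R M)"
    for M :: "'z \<Rightarrow> 'v op" and K :: "'v op"
  define S where "S = {E M K |M K. \<forall>z. psd (M z)}"
  have E_lin: "E (\<lambda>z. u *\<^sub>R M z + v *\<^sub>R M' z) (u *\<^sub>R K + v *\<^sub>R K') = u *\<^sub>R E M K + v *\<^sub>R E M' K'" for u v M M' K K'
    by (simp add: E_def success_def sum.distrib scaleR_right.sum[symmetric] adj_add adj_scaleR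
        matrix_mult_linear Re_trace_add Re_trace_scaleR sum_distrib_left scaleR_right_diff_distrib
        scaleR_add_right)
  have comb: "u *\<^sub>R x + v *\<^sub>R y \<in> S" if xy: "x \<in> S" "y \<in> S" "0 \<le> u" "0 \<le> v" for u v x y
  proof -
    obtain M K M' K' where "x = E M K" "\<forall>z. psd (M z)" "y = E M' K'" "\<forall>z. psd (M' z)"
      using xy(1,2) by (auto simp: S_def)
    then have "u *\<^sub>R x + v *\<^sub>R y = E (\<lambda>z. u *\<^sub>R M z + v *\<^sub>R M' z) (u *\<^sub>R K + v *\<^sub>R K')"
        and "\<forall>z. psd (u *\<^sub>R M z + v *\<^sub>R M' z)"
      using xy by (auto simp: E_lin intro: psd_add psd_scaleR)
    then show ?thesis unfolding S_def by blast
  qed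
  let ?p = "(mat 1 :: 'v op, \<alpha>)"
  have "?p \<notin> S"
  proof
    assume "?p \<in> S"
    then obtain M K where eq: "?p = E M K" and M: "\<forall>z. psd (M z)" by (auto simp: S_def)
    then have 1: "(\<Sum>z\<in>UNIV. M z) + (K - adj K) = mat 1" and \<alpha>: "\<alpha> = success R M" by (auto simp: E_def)
    \<comment> \<open>Adding the adjoint equation cancels the anti-Hermitian part, so
      \<open>M\<close> alone sums to the identity.\<close>
    have 2: "(\<Sum>z\<in>UNIV. M z) + (adj K - K) = mat 1"
      using arg_cong[OF 1, of adj] M by (simp add: adj_add adj_diff adj_sum psd_adj)
    have "2 *\<^sub>R (\<Sum>z\<in>UNIV. M z) =
        ((\<Sum>z\<in>UNIV. M z) + (K - adj K)) + ((\<Sum>z\<in>UNIV. M z) + (adj K - K))"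
      by (simp add: scaleR_2)
    also have "\<dots> = 2 *\<^sub>R mat 1" by (simp only: 1 2 scaleR_2)
    finally have "(\<Sum>z\<in>UNIV. M z) = mat 1" by simp
    then have "povm M" using M by (simp add: povm_def)
    then show False using less \<alpha> by blast
  qed
  then have "0 \<notin> (\<lambda>x. x - ?p) ` S" by (auto simp: zero_prod_def)
  moreover have "convex ((\<lambda>x. x - ?p) ` S)"
    unfolding convex_translation_subtract_eq by (rule convexI) (auto intro: comb)
  ultimately obtain a where a: "a \<noteq> 0" "\<And>x. x \<in> S \<Longrightarrow> 0 \<le> inner a (x - ?p)"
    using separating_hyperplane_set_0[of "(\<lambda>x. x - ?p) ` S"] by auto
  obtain H c where Hc: "a = (H, c)" by (cases a)
  have "E (\<lambda>_. 0) 0 = 0"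
    by (simp add: E_def success_def matrix_mult_linear trace_def zero_prod_def)
  then have "0 \<in> S"
    unfolding S_def by (intro CollectI exI[of _ "\<lambda>_. 0"] exI[of _ 0]) simp
  then have p: "inner a ?p \<le> 0" using a(2)[OF \<open>0 \<in> S\<close>] by (simp only: inner_diff_right inner_zero_right)
  have pos: "0 \<le> inner a x" if "x \<in> S" for x
  proof (rule ccontr)
    assume neg: "\<not> 0 \<le> inner a x"
    \<comment> \<open>A separating functional is nonnegative on the whole cone: otherwise this
      multiple of \<open>x\<close> would give it the value \<open>-1\<close> at the difference from
      \<open>?p\<close>.\<close>
    let ?t = "(1 - inner a ?p) / - inner a x"
    have "?t \<ge> 0" using neg p by (simp add: divide_simps)
    then have "?t *\<^sub>R x \<in> S" using comb[OF that that, of ?t 0] by simp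
    from a(2)[OF this] have "0 \<le> ?t * inner a x - inner a ?p" by (simp add: inner_diff_right)
    also have "?t * inner a x = - (1 - inner a ?p)" using neg by simp
    finally show False by (simp only:)
  qed
  have Hpos: "0 \<le> inner H ((\<Sum>z\<in>UNIV. M z) + (K - adj K)) + c * success R M" if "\<forall>z. psd (M z)" for M K
    using pos[of "E M K"] that by (auto simp: S_def Hc E_def inner_prod_def)
  have "adj H = H"
  proof -
    \<comment> \<open>The cone contains every \<open>K - adj K\<close>; testing with
      \<open>H\<close> and \<open>- H\<close> shows that \<open>H\<close> has no anti-Hermitian
      part.\<close>
    have "0 \<le> inner H (K - adj K)" for K
      using Hpos[of "\<lambda>_. 0" K] by (simp add: success_def trace_def matrix_mult_linear)
    from this[of H] this[of "- H"] have "inner H (H - adj H) = 0"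
      using adj_scaleR[of "-1" H] by (simp add: inner_diff_right)
    moreover have "inner (adj H) (adj H) = inner H H" by (simp flip: power2_norm_eq_inner)
    ultimately have "inner (H - adj H) (H - adj H) = 0"
      by (simp add: inner_diff_left inner_diff_right inner_commute)
    then show ?thesis by simp
  qed
  have trH: "inner H (mat 1) = Re (trace H)"
    by (simp add: inner_eq_trace \<open>adj H = H\<close>)
  have Rpos: "0 \<le> inner v (H *v v) + c * inner v (R z *v v)" for z v
  proof -
    let ?M = "\<lambda>y. if y = z then ket_bra v else 0"
    have "success R ?M = inner v (R z *v v)"
    proof -
      have "success R ?M = (\<Sum>y\<in>UNIV. if y = z then inner v (R z *v v) else 0)"
        unfolding success_def
        by (intro sum.cong refl)
           (auto simp: Re_trace_mult_ket_bra matrix_mult_linear linear_0[OF linear_Re_trace])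
      then show ?thesis by simp
    qed
    then show ?thesis
      using Hpos[of ?M 0]
      by (simp add: psd_ket_bra inner_eq_trace[of H "ket_bra v"] \<open>adj H = H\<close> Re_trace_mult_ket_bra)
  qed
  \<comment> \<open>Excludes degenerate hyperplanes. For \<open>c = 0\<close> the positive operator
    \<open>H\<close> would have nonpositive trace and vanish; for \<open>c > 0\<close> a trivial
    measurement, whose success is strictly below \<open>\<alpha>\<close>, contradicts the sign at
    \<open>?p\<close>.\<close>
  have "c < 0"
  proof (rule ccontr)
    assume "\<not> c < 0"
    then consider "c = 0" | "c > 0" by linarith
    then show False
    proof cases
      case 1
      have "psd H" using Rpos 1 \<open>adj H = H\<close> by (simp add: psd_iff)
      moreover have "Re (trace H) \<le> 0" using p 1 trH by (simp add: Hc inner_prod_def)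
      ultimately have "H = 0" by (rule psd_trace_zero)
      then show False using a(1) Hc 1 by (simp add: zero_prod_def)
    next
      case 2
      let ?M = "\<lambda>y :: 'z. if y = undefined then mat 1 else 0 :: 'v op"
      have "0 \<le> inner H (mat 1) + c * success R ?M"
        using Hpos[of ?M 0] trivial_povm[of undefined] by (simp add: povm_def)
      also have "\<dots> < inner H (mat 1) + c * \<alpha>" using less[OF trivial_povm] 2 by simp
      also have "\<dots> \<le> 0" using p by (simp add: Hc inner_prod_def)
      finally show False by simp
    qed
  qed
  \<comment> \<open>Rescaling makes the second component of the functional \<open>-1\<close>, which
    turns \<open>Rpos\<close> into feasibility of \<open>\<sigma>\<close>.\<close>
  define e where "e = inverse (- c)"
  have e: "e > 0" "e * c = - 1" using \<open>c < 0\<close> by (simp_all add: e_def)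
  define \<sigma> where "\<sigma> = e *\<^sub>R H"
  have "psd (\<sigma> - R z)" for z
  proof -
    have "0 \<le> e * inner v (H *v v) - inner v (R z *v v)" for v
    proof -
      have "0 \<le> e * (inner v (H *v v) + c * inner v (R z *v v))"
        using Rpos[of v z] e(1) by simp
      also have "\<dots> = e * inner v (H *v v) + (e * c) * inner v (R z *v v)" by (simp add: algebra_simps)
      finally show ?thesis by (simp add: e(2))
    qed
    then show ?thesis
      by (simp add: psd_iff adj_diff \<sigma>_def adj_scaleR \<open>adj H = H\<close> herm matrix_vector_mult_diff_rdistrib
          scaleR_matrix_vector inner_diff_right)
  qed
  moreover have "Re (trace \<sigma>) \<le> \<alpha>"
  proof -
    have "e * (Re (trace H) + c * \<alpha>) \<le> 0"
      using p trH e(1) by (simp add: Hc inner_prod_def mult_nonneg_nonpos)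
    also have "e * (Re (trace H) + c * \<alpha>) = e * Re (trace H) + (e * c) * \<alpha>" by (simp add: algebra_simps)
    finally show ?thesis by (simp add: e(2) \<sigma>_def Re_trace_scaleR)
  qed
  ultimately show ?thesis using that by blast
qed

section \<open>Pure states\<close>

text \<open>The trace provides a nonzero row \<open>i\<close>, all rows are multiples of it, and
  hermiticity determines the multiples. \<open>?v\<close> is column \<open>i\<close> divided by the
  root of the diagonal entry, which fixes the phase so that its component \<open>i\<close> is
  positive.\<close>

lemma pure_state_eq_ket_bra:
  fixes \<rho> :: "'i::finite op"
  assumes psd: "psd \<rho>" and tr: "trace \<rho> = 1" and rk: "rank \<rho> = 1"
  obtains v where "\<rho> = ket_bra v"
proof -
  have herm: "cnj (\<rho> $ i $ j) = \<rho> $ j $ i" for i j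
    using arg_cong[OF psd_adj[OF psd], of "\<lambda>X. X $ j $ i"] by (simp add: adj_def)
  have "\<exists>i. Re (\<rho> $ i $ i) > 0"
  proof (rule ccontr)
    assume "\<not> ?thesis"
    then have "Re (trace \<rho>) \<le> 0" by (auto simp: trace_def not_less intro!: sum_nonpos)
    then show False using tr by simp
  qed
  then obtain i where i: "Re (\<rho> $ i $ i) > 0" by blast
  define d where "d = Re (\<rho> $ i $ i)"
  have d: "\<rho> $ i $ i = of_real d"
    using herm[of i i] by (simp add: d_def complex_eq_iff)
  have "d > 0" using i by (simp add: d_def)
  have "\<rho> $ i \<noteq> 0" using d \<open>d > 0\<close> by (metis of_real_eq_0_iff less_irrefl zero_index)
  have rows: "\<rho> $ j \<in> Finite_Cartesian_Product.rows \<rho>" for j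
    by (auto simp: Finite_Cartesian_Product.rows_def Finite_Cartesian_Product.row_def)
  have "Finite_Cartesian_Product.rows \<rho> \<subseteq> vec.span {\<rho> $ i}"
    using rk vec.card_ge_dim_independent[of "{\<rho> $ i}" "Finite_Cartesian_Product.rows \<rho>"] \<open>\<rho> $ i \<noteq> 0\<close> rows[of i]
    by (simp add: row_rank_def_gen)
  then have "\<exists>c. \<rho> $ j = c *s \<rho> $ i" for j
    using rows[of j] by (auto simp: vec.span_singleton)
  then obtain c where c: "\<And>j. \<rho> $ j = c j *s \<rho> $ i" by metis
  have "\<rho> $ j $ i = c j * of_real d" for j
    by (subst c) (simp add: d)
  then have cj: "c j = \<rho> $ j $ i / of_real d" for j
    using \<open>d > 0\<close> by simp
  have entry: "\<rho> $ j $ k = \<rho> $ j $ i * cnj (\<rho> $ k $ i) / of_real d" for j k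
    by (subst c) (simp add: cj herm)
  let ?v = "\<chi> j. \<rho> $ j $ i / of_real (sqrt d)"
  have sq: "complex_of_real (sqrt d) * of_real (sqrt d) = of_real d"
    using \<open>d > 0\<close> by (simp flip: of_real_mult)
  have kb: "ket_bra ?v $ j $ k = \<rho> $ j $ i * cnj (\<rho> $ k $ i) / (of_real (sqrt d) * of_real (sqrt d))" for j k
    by (simp add: ket_bra_def)
  have "\<rho> $ j $ k = ket_bra ?v $ j $ k" for j k
    by (rule trans[OF entry[of j k] sym[OF kb[of j k, unfolded sq]]])
  then have "\<rho> = ket_bra ?v" unfolding cart_eq_iff by blast
  then show ?thesis by (rule that)
qed

section \<open>Characters of bit strings and dual functions\<close>

text \<open>The character \<open>(-1)^(x . z)\<close>. Being real, it acts on vectors and matrices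
  alike through \<open>scaleR\<close>.\<close>

definition chi :: "'n::len0 bits \<Rightarrow> 'n bits \<Rightarrow> real" where
  "chi x z = (\<Prod>i<LENGTH('n). if bit_nth x i = 1 \<and> bit_nth z i = 1 then - 1 else 1)"

lemma dim_vec_of_bits [simp]: "dim_vec (vec_of_bits (x :: 'n::len0 bits)) = LENGTH('n)"
  using vec_of_bits[of x] by simp

lemma bit_nth_add: "i < LENGTH('n) \<Longrightarrow> bit_nth (x + y) i = bit_nth x i + bit_nth (y :: 'n::len0 bits) i"
  by (simp add: bit_nth_def plus_bits.rep_eq)

lemma bits_eqI: "(\<And>i. i < LENGTH('n) \<Longrightarrow> bit_nth x i = bit_nth y i) \<Longrightarrow> x = (y :: 'n::len0 bits)"
  unfolding bit_nth_def vec_of_bits_inject[symmetric] by (rule eq_vecI) simp_all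

lemma bit_nth_zero [simp]: "i < LENGTH('n) \<Longrightarrow> bit_nth (0 :: 'n::len0 bits) i = 0"
  by (simp add: bit_nth_def zero_bits.rep_eq)

lemma bits_add_self [simp]: "x + x = (0 :: 'n::len0 bits)"
  by (rule bits_eqI) (simp add: bit_nth_add)

lemma bits_add_eq_0_iff: "x + y = 0 \<longleftrightarrow> x = (y :: 'n::len0 bits)"
  by (metis bits_add_self add_right_cancel)

lemma bits_add_cancel [simp]: "x + y + y = (x :: 'n::len0 bits)"
  by (simp add: add.assoc)

lemma chi_commute: "chi x z = chi z x"
  by (simp add: chi_def conj_commute)

lemma chi_add_left: "chi (x + y) z = chi x z * chi y z"
proof -
  have step: "(if a + b = 1 \<and> c = 1 then - 1 else 1 :: real) =
      (if a = 1 \<and> c = 1 then - 1 else 1) * (if b = 1 \<and> c = 1 then - 1 else 1)" for a b c :: bit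
    by (cases a; cases b) simp_all
  show ?thesis
    unfolding chi_def prod.distrib[symmetric]
    by (intro prod.cong refl) (simp only: bit_nth_add lessThan_iff step)
qed

lemma chi_add_right: "chi z (x + y) = chi z x * chi z y"
  using chi_add_left[of x y z] by (simp add: chi_commute)

lemma chi_zero_left [simp]: "chi 0 z = 1"
  by (simp add: chi_def)

lemma chi_zero_right [simp]: "chi z 0 = 1"
  by (simp add: chi_def)

lemma chi_mult_self [simp]: "chi x z * chi x z = 1"
  using chi_add_left[of x x z] by simp

lemma abs_chi [simp]: "\<bar>chi x z\<bar> = 1"
  using chi_mult_self[of x z] by (metis abs_mult_self_eq abs_one abs_mult power2_eq_1_iff power2_eq_square abs_minus)

lemma chi_cases: "chi x z = 1 \<or> chi x z = - 1"
  using abs_chi[of x z] by linarith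

lemma chi_eq_scalar_prod:
  "chi x z = (if scalar_prod (vec_of_bits x) (vec_of_bits z) = 1 then - 1 else 1)"
proof -
  define sgn_bit :: "bit \<Rightarrow> real" where "sgn_bit b = (if b = 1 then - 1 else 1)" for b
  have add: "sgn_bit (a + b) = sgn_bit a * sgn_bit b" for a b
    by (cases a; cases b) (simp_all add: sgn_bit_def)
  have zero: "sgn_bit 0 = 1" by (simp add: sgn_bit_def)
  have sum: "sgn_bit (sum h S) = (\<Prod>i\<in>S. sgn_bit (h i))" for h and S :: "nat set"
    by (induction S rule: infinite_finite_induct) (simp_all only: sum.insert prod.insert sum.empty prod.empty sum.infinite prod.infinite
        add zero not_False_eq_True)
  have mult: "(if a = 1 \<and> b = 1 then - 1 else 1) = sgn_bit (a * b)" for a b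
    by (cases a; cases b) (simp_all add: sgn_bit_def)
  show ?thesis
    unfolding chi_def mult
    by (simp add: scalar_prod_def bit_nth_def lessThan_atLeast0 flip: sum)
       (simp add: sgn_bit_def)
qed

text \<open>Shifting by \<open>y\<close> permutes \<open>A\<close> and flips the sign of every
  summand.\<close>

lemma sum_chi_eq_0:
  assumes "\<And>x. x \<in> A \<Longrightarrow> x + y \<in> A" and "chi y w = - 1"
  shows "(\<Sum>x\<in>A. chi x w) = 0"
proof -
  have "(\<Sum>x\<in>A. chi x w) = (\<Sum>x\<in>A. chi (x + y) w)"
    by (rule sum.reindex_bij_witness[of _ "\<lambda>x. x + y" "\<lambda>x. x + y"]) (auto simp: assms)
  then show ?thesis by (simp add: chi_add_left assms(2) sum_negf)
qed

lemma exists_chi_eq_minus_1: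
  assumes "w \<noteq> (0 :: 'n::len0 bits)"
  shows "\<exists>y. chi y w = - 1"
proof -
  obtain i where i: "i < LENGTH('n)" "bit_nth w i \<noteq> 0" using assms bits_eqI[of w 0] by (metis bit_nth_zero)
  define y :: "'n bits" where "y = bits_of_vec (unit_vec (LENGTH('n)) i)"
  have "vec_of_bits y = unit_vec (LENGTH('n)) i" by (simp add: y_def bits_of_vec_inverse)
  then have "chi y w = - 1"
    using i by (simp add: chi_eq_scalar_prod bit_nth_def scalar_prod_left_unit vec_of_bits)
  then show ?thesis ..
qed

lemma sum_chi_mult: "(\<Sum>x\<in>UNIV. chi x z * chi x z') = (if z = z' then 2 ^ LENGTH('n) else 0)"
  for z z' :: "'n::len0 bits"
proof (cases "z = z'")
  case False
  then have "z + z' \<noteq> 0" by (simp add: bits_add_eq_0_iff)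
  then obtain y where "chi y (z + z') = - 1" using exists_chi_eq_minus_1 by blast
  then have "(\<Sum>x\<in>UNIV. chi x (z + z')) = 0" by (intro sum_chi_eq_0) simp_all
  then show ?thesis using False by (simp add: chi_add_right)
qed (simp add: card_bits)

text \<open>What duality means for characters. By the first clause, moving \<open>x\<close> within a
  fiber of \<open>g\<close> changes the character on a fiber of \<open>f\<close> only by a global
  sign; by the third, characters from different fibers of \<open>f\<close> are orthogonal on each
  fiber of \<open>g\<close>.\<close>

definition dual_maps :: "('n::len0 bits \<Rightarrow> 'm::len0 bits) \<Rightarrow> ('n bits \<Rightarrow> 'l::len0 bits) \<Rightarrow> bool" where
  "dual_maps f g \<longleftrightarrow>
     (\<forall>x x' z z'. g x = g x' \<and> f z = f z' \<longrightarrow> chi (x + x') (z + z') = 1) \<and>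
     (\<forall>s. card (g -` {s}) = 2 ^ LENGTH('m)) \<and>
     (\<forall>s z z'. f z \<noteq> f z' \<longrightarrow> (\<Sum>x\<in>g -` {s}. chi x z * chi x z') = 0)"

text \<open>The identity keeps all of \<open>z\<close>, so its partner sends the empty string and
  has a single fiber. This instance describes guessing without a syndrome.\<close>

lemma dual_maps_id: "dual_maps (\<lambda>z :: 'n::len0 bits. z) (\<lambda>_. s0 :: 0 bits)"
proof -
  have eq: "s = s0" for s :: "0 bits" by (rule bits_eqI) simp
  have "(\<lambda>_ :: 'n bits. s0) -` {s} = UNIV" for s using eq[of s] by auto
  then show ?thesis by (simp add: dual_maps_def card_bits sum_chi_mult)
qed

text \<open>A maximal independent set of columns has as many elements as the dimension, hence is a
  basis.\<close>

lemma (in vec_space) full_row_rank_surj: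
  assumes A: "A \<in> carrier_mat n nc" and rank: "rank A = n" and y: "y \<in> carrier_vec n"
  shows "\<exists>x\<in>carrier_vec nc. A *\<^sub>v x = y"
proof -
  have cols: "set (cols A) \<subseteq> carrier_vec n" using cols_dim A by blast
  obtain S where S: "maximal S (\<lambda>T. T \<subseteq> set (cols A) \<and> lin_indpt T)" "finite S"
    using maximal_exists_superset[of "set (cols A)" "\<lambda>T. T \<subseteq> set (cols A) \<and> lin_indpt T" "{}"]
      finite_lin_indpt2[of "{}"] by auto
  then have S': "S \<subseteq> set (cols A)" "lin_indpt S" by (auto simp: maximal_def)
  have "card S = n" using rank_card_indpt[OF A S(1)] rank by simp
  then have "card S = dim" using dim_is_n by (rule trans[OF _ sym])
  then have "basis S" using dim_li_is_basis[OF fin_dim S(2)] S' cols by auto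
  then have "y \<in> span S" using y by (simp add: basis_def)
  then have "y \<in> col_space A" using span_is_monotone[OF S'(1)] by (auto simp: col_space_def)
  then show ?thesis using A col_space_eq[OF A] by auto
qed

lemma represents_add:
  fixes h :: "'n::len0 bits \<Rightarrow> 'k::len0 bits"
  assumes "represents M h"
  shows "h (x + y) = h x + h y"
proof -
  have "vec_of_bits (h (x + y)) = vec_of_bits (h x + h y)"
    using assms mult_add_distrib_mat_vec[of M "LENGTH('k)", OF _ vec_of_bits[of x] vec_of_bits[of y]]
    by (simp add: represents_def plus_bits.rep_eq)
  then show ?thesis by (simp add: vec_of_bits_inject)
qed

lemma represents_surj:
  fixes h :: "'n::len0 bits \<Rightarrow> 'k::len0 bits"
  assumes h: "represents M h" and rank: "vec_space.rank LENGTH('k) M = LENGTH('k)"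
  shows "surj h"
proof -
  have "\<exists>x. h x = y" for y
  proof -
    have "M \<in> carrier_mat LENGTH('k) LENGTH('n)" using h by (simp add: represents_def)
    from vec_space.full_row_rank_surj[OF this rank vec_of_bits[of y]]
    obtain v where v: "v \<in> carrier_vec LENGTH('n)" "M *\<^sub>v v = vec_of_bits y" by auto
    then have "vec_of_bits (h (bits_of_vec v)) = vec_of_bits y"
      using h by (simp add: represents_def bits_of_vec_inverse)
    then show ?thesis by (auto simp: vec_of_bits_inject)
  qed
  then show ?thesis by (metis surj_def)
qed

lemma card_fiber:
  fixes g :: "'n::len0 bits \<Rightarrow> 'l::len0 bits"
  assumes add: "\<And>x y. g (x + y) = g x + g y" and surj: "surj g"
  shows "2 ^ LENGTH('l) * card (g -` {s}) = 2 ^ LENGTH('n)"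
proof -
  have same: "card (g -` {s}) = card (g -` {0})" for s
  proof -
    obtain a where a: "g a = s" using surj by (metis surjD)
    have "bij_betw (\<lambda>x. x + a) (g -` {0}) (g -` {s})"
      by (rule bij_betw_byWitness[of _ "\<lambda>x. x + a"]) (auto simp: add a)
    then show ?thesis by (simp add: bij_betw_same_card)
  qed
  have "CARD('n bits) = (\<Sum>t\<in>UNIV. card (g -` {t}))"
    using card_UN_disjoint[of UNIV "\<lambda>t. g -` {t}"] by (simp add: vimage_UN[symmetric] UN_singleton disjoint_iff)
  also have "\<dots> = CARD('l bits) * card (g -` {s})"
  proof -
    have "(\<Sum>t\<in>UNIV. card (g -` {t})) = (\<Sum>t\<in>(UNIV :: 'l bits set). card (g -` {s}))"
      by (intro sum.cong refl) (metis same)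
    then show ?thesis by simp
  qed
  finally show ?thesis by (simp add: card_bits)
qed

text \<open>The transpose \<open>t\<close> of \<open>f\<close> satisfies
  \<open>chi (t a) z = chi a (f z)\<close>. Its image lies in the kernel of \<open>g\<close> because
  the matrices are dual, and it is injective because \<open>f\<close> is onto. As the lengths add
  up, counting makes the image the whole kernel, so two points in one fiber of \<open>g\<close>
  differ by some \<open>t a\<close>.\<close>

lemma dual_functions_imp_dual_maps:
  fixes f :: "'n::len0 bits \<Rightarrow> 'm::len0 bits" and g :: "'n bits \<Rightarrow> 'l::len0 bits"
  assumes dual: "dual_functions f g" and len: "LENGTH('m) + LENGTH('l) = LENGTH('n)"
  shows "dual_maps f g"
proof -
  obtain M N where M: "represents M f" "vec_space.rank LENGTH('m) M = LENGTH('m)"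
    and N: "represents N g" "vec_space.rank LENGTH('l) N = LENGTH('l)"
    and MN: "M * transpose_mat N = 0\<^sub>m LENGTH('m) LENGTH('l)"
    using dual unfolding dual_functions_def by blast
  have Mc: "M \<in> carrier_mat LENGTH('m) LENGTH('n)" and Nc: "N \<in> carrier_mat LENGTH('l) LENGTH('n)"
    using M N by (simp_all add: represents_def)
  have f: "surj f" "\<And>x y. f (x + y) = f x + f y" "\<And>z. vec_of_bits (f z) = M *\<^sub>v vec_of_bits z"
    using represents_surj[OF M] represents_add[OF M(1)] M(1) by (simp_all add: represents_def)
  have g: "surj g" "\<And>x y. g (x + y) = g x + g y" "\<And>z. vec_of_bits (g z) = N *\<^sub>v vec_of_bits z"
    using represents_surj[OF N] represents_add[OF N(1)] N(1) by (simp_all add: represents_def)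
  have card_g: "card (g -` {s}) = 2 ^ LENGTH('m)" for s
  proof -
    have "2 ^ LENGTH('l) * card (g -` {s}) = 2 ^ LENGTH('l) * (2 ^ LENGTH('m) :: nat)"
      using card_fiber[of g s] g by (simp add: len[symmetric] power_add mult.commute)
    then show ?thesis by simp
  qed
  have g0: "g 0 = 0" using g(2)[of 0 0] by simp
  define t :: "'m bits \<Rightarrow> 'n bits" where "t a = bits_of_vec (transpose_mat M *\<^sub>v vec_of_bits a)" for a
  have t: "vec_of_bits (t a) = transpose_mat M *\<^sub>v vec_of_bits a" for a
    unfolding t_def by (rule bits_of_vec_inverse) (use Mc vec_of_bits in \<open>auto intro!: mult_mat_vec_carrier\<close>)
  have chi_t: "chi (t a) z = chi a (f z)" for a z
  proof -
    have "scalar_prod (transpose_mat M *\<^sub>v vec_of_bits a) (vec_of_bits z)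
        = scalar_prod (vec_of_bits a) (M *\<^sub>v vec_of_bits z)"
      using transpose_vec_mult_scalar[OF Mc vec_of_bits[of z] vec_of_bits[of a]] .
    then show ?thesis by (simp add: chi_eq_scalar_prod t f(3))
  qed
  have g_t: "g (t a) = 0" for a
  proof -
    have NM: "N * transpose_mat M = 0\<^sub>m LENGTH('l) LENGTH('m)"
      using arg_cong[OF MN, of transpose_mat] Mc Nc
      by (simp add: transpose_mult[OF Mc transpose_carrier_mat[THEN iffD2, OF Nc]])
    have "vec_of_bits (g (t a)) = (N * transpose_mat M) *\<^sub>v vec_of_bits a"
      unfolding g(3) t using Nc Mc vec_of_bits[of a]
      by (subst assoc_mult_mat_vec[of _ "LENGTH('l)" "LENGTH('n)" _ "LENGTH('m)"]) auto
    also have "\<dots> = vec_of_bits (0 :: 'l bits)"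
      unfolding NM zero_bits.rep_eq using vec_of_bits[of a] by (intro eq_vecI) auto
    finally show ?thesis by (simp add: vec_of_bits_inject)
  qed
  have "inj t"
  proof (rule injI)
    fix a b assume "t a = t b"
    then have "chi (a + b) (f z) = 1" for z
      using chi_t[of a z] chi_t[of b z] by (simp add: chi_add_left)
    then have "chi c (a + b) = 1" for c
      using f(1) by (metis chi_commute surjD)
    then show "a = b" using exists_chi_eq_minus_1[of "a + b"] by (auto simp: bits_add_eq_0_iff)
  qed
  then have "card (range t) = 2 ^ LENGTH('m)" by (simp add: card_image card_bits)
  then have range_t: "range t = g -` {0}"
    using g_t card_g[of 0] by (intro card_subset_eq) auto
  have "chi (x + x') (z + z') = 1" if "g x = g x'" "f z = f z'" for x x' z z'
  proof -
    have "g (x + x') = 0" "f (z + z') = 0" using that f g by simp_all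
    then obtain a where "x + x' = t a" using range_t by blast
    then have "chi (x + x') (z + z') = chi a (f (z + z'))" using chi_t by simp
    then show ?thesis using \<open>f (z + z') = 0\<close> by (simp add: chi_commute[of a])
  qed
  moreover have "(\<Sum>x\<in>g -` {s}. chi x z * chi x z') = 0" if "f z \<noteq> f z'" for s z z'
  proof -
    have "f z + f z' \<noteq> 0" using that by (simp add: bits_add_eq_0_iff)
    then obtain a where "chi a (f z + f z') = - 1" using exists_chi_eq_minus_1 by blast
    then have "chi (t a) (z + z') = - 1" by (simp add: chi_t f)
    then have "(\<Sum>x\<in>g -` {s}. chi x (z + z')) = 0"
      by (intro sum_chi_eq_0[of _ "t a"]) (auto simp: g g_t)
    then show ?thesis by (simp add: chi_add_right)
  qed
  ultimately show ?thesis using card_g unfolding dual_maps_def by blast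
qed

section \<open>Purifications of hashed states\<close>

definition fourier :: "('n::len0 bits \<Rightarrow> 'a::real_vector) \<Rightarrow> 'n bits \<Rightarrow> 'a" where
  "fourier \<psi> x = (1 / sqrt (2 ^ LENGTH('n))) *\<^sub>R (\<Sum>z\<in>UNIV. chi x z *\<^sub>R \<psi> z)"

lemma fourier_inverse: "(\<Sum>x\<in>UNIV. chi x z *\<^sub>R fourier \<psi> x) = sqrt (2 ^ LENGTH('n)) *\<^sub>R \<psi> (z :: 'n::len0 bits)"
proof -
  have "(\<Sum>x\<in>UNIV. chi x z *\<^sub>R fourier \<psi> x)
      = (\<Sum>x\<in>UNIV. \<Sum>z'\<in>UNIV. (1 / sqrt (2 ^ LENGTH('n))) *\<^sub>R ((chi x z * chi x z') *\<^sub>R \<psi> z'))"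
    by (simp add: fourier_def scaleR_sum_right mult_ac)
  also have "\<dots> = (\<Sum>z'\<in>UNIV. (1 / sqrt (2 ^ LENGTH('n))) *\<^sub>R ((\<Sum>x\<in>UNIV. chi x z * chi x z') *\<^sub>R \<psi> z'))"
    by (subst sum.swap) (simp only: scaleR_sum_right scaleR_sum_left)
  also have "\<dots> = (\<Sum>z'\<in>UNIV. if z = z' then (2 ^ LENGTH('n) / sqrt (2 ^ LENGTH('n))) *\<^sub>R \<psi> z' else 0)"
    by (intro sum.cong refl) (simp add: sum_chi_mult)
  finally show ?thesis by (simp add: real_div_sqrt)
qed

lemma fourier_fourier: "fourier (fourier \<psi>) = \<psi>"
proof
  fix z
  show "fourier (fourier \<psi>) z = \<psi> z"
    unfolding fourier_def[of "fourier \<psi>"] using fourier_inverse[of z \<psi>] by (simp add: chi_commute)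
qed

lemma norm_sum_sq: "(norm (\<Sum>i\<in>I. a i))\<^sup>2 = (\<Sum>i\<in>I. \<Sum>j\<in>I. inner (a i) (a j))"
  by (simp add: power2_norm_eq_inner inner_sum_left inner_sum_right) (rule sum.swap)

lemma sum_sq_norm_chi:
  "(\<Sum>x\<in>A. (norm (\<Sum>z\<in>Z. chi x z *\<^sub>R y z))\<^sup>2) =
    (\<Sum>z\<in>Z. \<Sum>z'\<in>Z. (\<Sum>x\<in>A. chi x z * chi x z') * inner (y z) (y z'))"
proof -
  have "(\<Sum>x\<in>A. (norm (\<Sum>z\<in>Z. chi x z *\<^sub>R y z))\<^sup>2) =
      (\<Sum>x\<in>A. \<Sum>z\<in>Z. \<Sum>z'\<in>Z. chi x z * chi x z' * inner (y z) (y z'))"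
    by (simp add: norm_sum_sq mult_ac)
  also have "\<dots> = (\<Sum>z\<in>Z. \<Sum>x\<in>A. \<Sum>z'\<in>Z. chi x z * chi x z' * inner (y z) (y z'))"
    by (rule sum.swap)
  also have "\<dots> = (\<Sum>z\<in>Z. \<Sum>z'\<in>Z. \<Sum>x\<in>A. chi x z * chi x z' * inner (y z) (y z'))"
    by (intro sum.cong refl sum.swap)
  finally show ?thesis by (simp add: sum_distrib_right)
qed

lemma parseval:
  fixes y :: "'n::len0 bits \<Rightarrow> 'a::real_inner"
  shows "(\<Sum>x\<in>UNIV. (norm (\<Sum>z\<in>Z. chi x z *\<^sub>R y z))\<^sup>2) = 2 ^ LENGTH('n) * (\<Sum>z\<in>Z. (norm (y z))\<^sup>2)"
proof -
  have "(\<Sum>z\<in>Z. \<Sum>z'\<in>Z. (\<Sum>x\<in>UNIV. chi x z * chi x z') * inner (y z) (y z'))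
      = (\<Sum>z\<in>Z. \<Sum>z'\<in>Z. if z = z' then 2 ^ LENGTH('n) * (norm (y z))\<^sup>2 else 0)"
    by (intro sum.cong refl) (simp add: sum_chi_mult power2_norm_eq_inner)
  also have "\<dots> = (\<Sum>z\<in>Z. 2 ^ LENGTH('n) * (norm (y z))\<^sup>2)"
    by (intro sum.cong refl) (simp add: finite[of Z])
  finally show ?thesis unfolding sum_sq_norm_chi by (simp add: sum_distrib_left)
qed

lemma sum_fibers: "(\<Sum>k\<in>UNIV. \<Sum>z\<in>f -` {k}. h z) = (\<Sum>z\<in>UNIV. h z)"
  for f :: "'z::finite \<Rightarrow> 'k::finite"
  using sum.group[of "UNIV :: 'z set" "UNIV :: 'k set" f h] by (simp add: vimage_def)

text \<open>Cross terms between different fibers of \<open>f\<close> cancel in the sum over a fiber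
  of \<open>g\<close>. What remains splits over \<open>k\<close>, so that each \<open>W k\<close>
  can be bounded separately.\<close>

lemma fiberwise_pythagoras:
  fixes y :: "'n::len0 bits \<Rightarrow> 'a::real_inner"
  assumes "dual_maps f g"
  shows "(\<Sum>x\<in>g -` {s}. (norm (\<Sum>z\<in>UNIV. chi x z *\<^sub>R y z))\<^sup>2) =
    (\<Sum>x\<in>g -` {s}. \<Sum>k\<in>UNIV. (norm (\<Sum>z\<in>f -` {k}. chi x z *\<^sub>R y z))\<^sup>2)"
proof -
  let ?h = "\<lambda>z z'. (\<Sum>x\<in>g -` {s}. chi x z * chi x z') * inner (y z) (y z')"
  have "(\<Sum>x\<in>g -` {s}. \<Sum>k\<in>UNIV. (norm (\<Sum>z\<in>f -` {k}. chi x z *\<^sub>R y z))\<^sup>2)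
      = (\<Sum>k\<in>UNIV. \<Sum>z\<in>f -` {k}. \<Sum>z'\<in>f -` {k}. ?h z z')"
    by (subst sum.swap) (simp add: sum_sq_norm_chi)
  also have "\<dots> = (\<Sum>k\<in>UNIV. \<Sum>z\<in>f -` {k}. \<Sum>z'\<in>f -` {f z}. ?h z z')"
    by (intro sum.cong refl) auto
  also have "\<dots> = (\<Sum>z\<in>UNIV. \<Sum>z'\<in>f -` {f z}. ?h z z')" by (rule sum_fibers)
  also have "\<dots> = (\<Sum>z\<in>UNIV. \<Sum>z'\<in>UNIV. ?h z z')"
    using assms by (intro sum.cong refl sum.mono_neutral_left) (auto simp: dual_maps_def)
  finally show ?thesis by (simp add: sum_sq_norm_chi)
qed

text \<open>
  \<open>stack f \<psi> k\<close> is the purification \<open>\<Sum>z. \<psi> z \<otimes> \<langle>z|\<close>, with \<open>z\<close> ranging over the fiber of \<open>k\<close>, of the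
  hashed state given \<open>k\<close>.
\<close>

definition stack :: "('n::len0 bits \<Rightarrow> 'm::len0 bits) \<Rightarrow> ('n bits \<Rightarrow> complex^'b::finite^'e::finite) \<Rightarrow>
    'm bits \<Rightarrow> complex^('n bits \<times> 'b)^'e" where
  "stack f \<psi> k = (\<chi> e p. if f (fst p) = k then \<psi> (fst p) $ e $ snd p else 0)"

definition slice :: "complex^('z::finite \<times> 'b::finite)^'q::finite \<Rightarrow> 'z \<Rightarrow> complex^'b^'q" where
  "slice W z = (\<chi> q b. W $ q $ (z, b))"

definition glue :: "('z::finite \<Rightarrow> complex^'b::finite) \<Rightarrow> complex^('z \<times> 'b)" where
  "glue v = (\<chi> p. v (fst p) $ snd p)"

lemma norm_sq_vec: "(norm x)\<^sup>2 = (\<Sum>i\<in>UNIV. (norm (x $ i))\<^sup>2)" for x :: "'a::real_normed_vector^'i::finite"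
  by (simp add: norm_vec_def L2_set_def sum_nonneg)

lemma norm_glue: "(norm (glue v))\<^sup>2 = (\<Sum>z\<in>UNIV. (norm (v z))\<^sup>2)"
  by (simp add: norm_sq_vec sum_prod_UNIV glue_def)

lemma mult_glue: "W *v glue v = (\<Sum>z\<in>UNIV. slice W z *v v z)"
  by (simp add: cart_eq_iff glue_def slice_def matrix_vector_mult_def sum_prod_UNIV)

lemma glue_surj: "\<exists>w. v = glue w"
  by (rule exI[of _ "\<lambda>z. \<chi> b. v $ (z, b)"]) (simp add: glue_def cart_eq_iff)

text \<open>Extending \<open>v\<close> by zero outside \<open>Z\<close> gives a single argument for
  \<open>W\<close>, so the slices are bounded jointly and without the factor of a triangle
  inequality.\<close>

lemma contraction_slices:
  assumes "contraction W"
  shows "(norm (\<Sum>z\<in>Z. slice W z *v v z))\<^sup>2 \<le> (\<Sum>z\<in>Z. (norm (v z))\<^sup>2)"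
proof -
  let ?v = "\<lambda>z. if z \<in> Z then v z else 0"
  have "(norm (W *v glue ?v))\<^sup>2 \<le> (norm (glue ?v))\<^sup>2"
    using assms by (intro power_mono) (simp_all add: contraction_def)
  moreover have "W *v glue ?v = (\<Sum>z\<in>Z. slice W z *v v z)"
    by (simp add: mult_glue if_distrib[of "\<lambda>x. _ *v x"] sum.If_cases cong: if_cong)
  moreover have "(norm (glue ?v))\<^sup>2 = (\<Sum>z\<in>Z. (norm (v z))\<^sup>2)"
    by (simp add: norm_glue if_distrib[of "\<lambda>x. (norm x)\<^sup>2"] sum.If_cases cong: if_cong)
  ultimately show ?thesis by simp
qed

lemma mult_adj_stack: "W ** adj (stack f \<psi> k) = (\<Sum>z\<in>f -` {k}. slice W z ** adj (\<psi> z))"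
proof -
  have "(W ** adj (stack f \<psi> k)) $ q $ e =
      (\<Sum>z\<in>UNIV. if f z = k then (slice W z ** adj (\<psi> z)) $ q $ e else 0)" for q e
    by (auto simp: matrix_matrix_mult_def adj_def stack_def slice_def sum_prod_UNIV intro!: sum.cong)
  then show ?thesis by (simp add: cart_eq_iff sum.If_cases vimage_def)
qed

lemma stack_mult_adj: "stack f \<psi> k ** adj (stack f \<psi> k) = (\<Sum>z\<in>f -` {k}. \<psi> z ** adj (\<psi> z))"
proof -
  have "slice (stack f \<psi> k) z = \<psi> z" if "z \<in> f -` {k}" for z
    using that by (simp add: slice_def stack_def cart_eq_iff)
  then show ?thesis by (simp add: mult_adj_stack)
qed

lemma sum_mult_adj_stack:
  "(\<Sum>k\<in>UNIV. W k ** adj (stack f \<psi> k)) = (\<Sum>z\<in>UNIV. slice (W (f z)) z ** adj (\<psi> z))"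
proof -
  have "(\<Sum>k\<in>UNIV. W k ** adj (stack f \<psi> k)) = (\<Sum>k\<in>UNIV. \<Sum>z\<in>f -` {k}. slice (W (f z)) z ** adj (\<psi> z))"
    unfolding mult_adj_stack by (intro sum.cong refl) auto
  then show ?thesis by (simp only: sum_fibers)
qed

section \<open>From privacy amplification to data compression\<close>

text \<open>Kraus operators of a subnormalized measurement for each syndrome \<open>s\<close>: over
  a fiber, the operators \<open>adj (N x) ** N x\<close> sum to at most the identity.\<close>

definition fiberwise_contraction :: "('x::finite \<Rightarrow> 's) \<Rightarrow> ('x \<Rightarrow> complex^'b::finite^'q::finite) \<Rightarrow> bool" where
  "fiberwise_contraction g N \<longleftrightarrow> (\<forall>s v. (\<Sum>x\<in>g -` {s}. (norm (N x *v v))\<^sup>2) \<le> (norm v)\<^sup>2)"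

lemma bessel_projections:
  fixes P :: "'z::finite \<Rightarrow> complex^'b::finite^'b"
  assumes P: "\<And>z. adj (P z) = P z" "\<And>z. P z ** P z = P z"
    and orth: "\<And>z z'. z \<noteq> z' \<Longrightarrow> P z ** P z' = 0"
  shows "(\<Sum>z\<in>UNIV. (norm (P z *v v))\<^sup>2) \<le> (norm v)\<^sup>2"
proof -
  define w where "w = (\<Sum>z\<in>UNIV. P z *v v)"
  have ip: "inner (P z *v v) (P z' *v v) = (if z = z' then (norm (P z *v v))\<^sup>2 else 0)" for z z'
  proof (cases "z = z'")
    case False
    have "inner (P z *v v) (P z' *v v) = inner v ((P z ** P z') *v v)"
      by (simp add: inner_adj P(1) flip: matrix_vector_mul_assoc)
    then show ?thesis using orth False by simp
  qed (simp add: power2_norm_eq_inner)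
  have vP: "inner v (P z *v v) = (norm (P z *v v))\<^sup>2" for z
    using inner_mult_adj_vector[of v "P z"] by (simp add: P)
  have "(norm w)\<^sup>2 = (\<Sum>z\<in>UNIV. (norm (P z *v v))\<^sup>2)"
    by (simp add: w_def norm_sum_sq ip)
  moreover have "inner v w = (\<Sum>z\<in>UNIV. (norm (P z *v v))\<^sup>2)"
    by (simp add: w_def inner_sum_right vP)
  ultimately have eq: "(norm w)\<^sup>2 = inner v w" "(\<Sum>z\<in>UNIV. (norm (P z *v v))\<^sup>2) = (norm w)\<^sup>2" by simp_all
  have "norm w * norm w \<le> norm v * norm w"
    using eq(1) norm_cauchy_schwarz[of v w] by (simp add: power2_eq_square)
  then have "norm w \<le> norm v" by (cases "norm w = 0") simp_all
  then show ?thesis by (simp add: eq(2) power_mono)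
qed

context
  fixes f :: "'n::len0 bits \<Rightarrow> 'm::len0 bits" and g :: "'n bits \<Rightarrow> 'l::len0 bits"
  assumes dual: "dual_maps f g"
begin

lemma card_fiber_g: "real (card (g -` {s})) = 2 ^ LENGTH('m)"
  using dual by (simp add: dual_maps_def)

text \<open>The supports in \<open>B\<close> are orthogonal, so composing with \<open>P z\<close>
  picks the summand \<open>z\<close> out of the Fourier transform. The two characters cancel and
  every \<open>x\<close> contributes the same operator. In the bound, the pieces
  \<open>P z *v v\<close> share the norm of \<open>v\<close> by Bessel's inequality.\<close>

lemma decoder_of_overlap_Z:
  fixes \<psi> :: "'n bits \<Rightarrow> complex^'b::finite^'e::finite" and W :: "'m bits \<Rightarrow> complex^('n bits \<times> 'b)^'q::finite"
  assumes W: "\<And>k. contraction (W k)"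
    and Z: "\<And>z z'. z \<noteq> z' \<Longrightarrow> \<psi> z ** adj (\<psi> z') = 0"
  obtains N :: "'n bits \<Rightarrow> complex^'b^'q" where "fiberwise_contraction g N"
    "(norm (\<Sum>k\<in>UNIV. W k ** adj (stack f \<psi> k)))\<^sup>2 =
      2 ^ LENGTH('m) * (\<Sum>x\<in>UNIV. (norm (N x ** adj (fourier \<psi> x)))\<^sup>2)"
proof -
  define u where "u z = slice (W (f z)) z" for z
  have "\<exists>P Y. adj P = P \<and> P ** P = P \<and> \<psi> z ** P = \<psi> z \<and> P = Y ** \<psi> z" for z
    by (metis support_projection_exists)
  then obtain P Y where P: "\<And>z. adj (P z) = P z" "\<And>z. P z ** P z = P z" "\<And>z. \<psi> z ** P z = \<psi> z"
      "\<And>z. P z = Y z ** \<psi> z" by metis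
  have PP: "P z ** P z' = 0" if "z \<noteq> z'" for z z'
  proof -
    have "P z ** P z' = (Y z ** \<psi> z) ** adj (Y z' ** \<psi> z')"
      using P(1)[of z'] P(4) by metis
    also have "\<dots> = Y z ** (\<psi> z ** adj (\<psi> z')) ** adj (Y z')" by (simp add: adj_mult matrix_mul_assoc)
    finally show ?thesis using Z[OF that] by (simp add: matrix_mult_linear)
  qed
  have P\<psi>: "P z ** adj (\<psi> z') = (if z = z' then adj (\<psi> z) else 0)" for z z'
  proof -
    have "\<psi> z' ** P z = (if z = z' then \<psi> z else 0)"
    proof (cases "z = z'")
      case False
      have "\<psi> z' ** P z = (\<psi> z' ** P z') ** P z" by (simp only: P(3))
      also have "\<dots> = \<psi> z' ** (P z' ** P z)" by (simp only: matrix_mul_assoc)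
      finally show ?thesis using False PP[of z' z] by (simp add: matrix_mult_linear)
    qed (simp add: P(3))
    then have "adj (\<psi> z' ** P z) = adj (if z = z' then \<psi> z else 0)" by simp
    then show ?thesis by (simp add: adj_mult P(1) split: if_splits)
  qed
  \<comment> \<open>Compensates for the \<open>2 ^ m\<close> points in a fiber of
    \<open>g\<close>.\<close>
  define c where "c = 1 / sqrt (2 ^ LENGTH('m))"
  have c2: "c\<^sup>2 = 1 / 2 ^ LENGTH('m)" by (simp add: c_def power_divide)
  define N where "N x = c *\<^sub>R (\<Sum>z\<in>UNIV. chi x z *\<^sub>R (u z ** P z))" for x
  have "fiberwise_contraction g N"
    unfolding fiberwise_contraction_def
  proof (intro allI)
    fix s v
    have "(\<Sum>x\<in>g -` {s}. (norm (N x *v v))\<^sup>2)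
        = c\<^sup>2 * (\<Sum>x\<in>g -` {s}. (norm (\<Sum>z\<in>UNIV. chi x z *\<^sub>R ((u z ** P z) *v v)))\<^sup>2)"
      by (simp add: N_def scaleR_matrix_vector sum_matrix_vector power_mult_distrib sum_distrib_left)
    also have "\<dots> = c\<^sup>2 * (\<Sum>x\<in>g -` {s}. \<Sum>k\<in>UNIV. (norm (\<Sum>z\<in>f -` {k}. chi x z *\<^sub>R ((u z ** P z) *v v)))\<^sup>2)"
      by (simp only: fiberwise_pythagoras[OF dual])
    also have "\<dots> \<le> c\<^sup>2 * (\<Sum>x\<in>g -` {s}. \<Sum>k\<in>UNIV. \<Sum>z\<in>f -` {k}. (norm (P z *v v))\<^sup>2)"
    proof (intro mult_left_mono sum_mono)
      fix x k
      have "(\<Sum>z\<in>f -` {k}. chi x z *\<^sub>R ((u z ** P z) *v v))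
          = (\<Sum>z\<in>f -` {k}. slice (W k) z *v (chi x z *\<^sub>R (P z *v v)))"
        by (intro sum.cong refl) (auto simp: u_def matrix_vector_scaleR matrix_vector_mul_assoc)
      then show "(norm (\<Sum>z\<in>f -` {k}. chi x z *\<^sub>R ((u z ** P z) *v v)))\<^sup>2 \<le> (\<Sum>z\<in>f -` {k}. (norm (P z *v v))\<^sup>2)"
        using contraction_slices[OF W, where Z = "f -` {k}" and v = "\<lambda>z. chi x z *\<^sub>R (P z *v v)"] by simp
    qed simp
    also have "\<dots> = (\<Sum>z\<in>UNIV. (norm (P z *v v))\<^sup>2)"
      by (simp add: sum_fibers card_fiber_g c2)
    also have "\<dots> \<le> (norm v)\<^sup>2" by (rule bessel_projections[OF P(1,2) PP])
    finally show "(\<Sum>x\<in>g -` {s}. (norm (N x *v v))\<^sup>2) \<le> (norm v)\<^sup>2" .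
  qed
  moreover have "N x ** adj (fourier \<psi> x) = (c / sqrt (2 ^ LENGTH('n))) *\<^sub>R (\<Sum>z\<in>UNIV. u z ** adj (\<psi> z))" for x
  proof -
    have "N x ** adj (fourier \<psi> x) = (c / sqrt (2 ^ LENGTH('n))) *\<^sub>R
        (\<Sum>z\<in>UNIV. \<Sum>z'\<in>UNIV. (chi x z * chi x z') *\<^sub>R (u z ** (P z ** adj (\<psi> z'))))"
      by (simp add: N_def fourier_def adj_scaleR adj_sum matrix_mult_scaleR_left matrix_mult_scaleR_right
          matrix_mult_sum_left matrix_mult_sum_right matrix_mul_assoc scaleR_sum_right mult_ac)
         (subst sum.swap, simp add: mult_ac)
    also have "(\<Sum>z\<in>UNIV. \<Sum>z'\<in>UNIV. (chi x z * chi x z') *\<^sub>R (u z ** (P z ** adj (\<psi> z'))))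
        = (\<Sum>z\<in>UNIV. \<Sum>z'\<in>UNIV. if z = z' then u z ** adj (\<psi> z) else 0)"
      by (intro sum.cong refl) (simp add: P\<psi> matrix_mult_linear)
    finally show ?thesis by simp
  qed
  then have "2 ^ LENGTH('m) * (\<Sum>x\<in>UNIV. (norm (N x ** adj (fourier \<psi> x)))\<^sup>2)
      = (norm (\<Sum>z\<in>UNIV. u z ** adj (\<psi> z)))\<^sup>2"
    by (simp add: card_bits power_mult_distrib power_divide c2)
  ultimately show ?thesis using that by (simp add: sum_mult_adj_stack u_def)
qed

text \<open>Here each \<open>z\<close> contributes the full norm of \<open>v\<close>, so
  \<open>N\<close> carries a further factor \<open>1 / sqrt (2 ^ n)\<close>. The overlap becomes
  \<open>sqrt (2 ^ m)\<close> times the sum of the operators \<open>A x\<close>; these are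
  orthogonal in the Hilbert-Schmidt inner product, so the squared norm of the sum is the sum of the
  squares.\<close>

lemma decoder_of_overlap_X:
  fixes \<psi> :: "'n bits \<Rightarrow> complex^'b::finite^'e::finite" and W :: "'m bits \<Rightarrow> complex^('n bits \<times> 'b)^'q::finite"
  assumes W: "\<And>k. contraction (W k)"
    and X: "\<And>x x'. x \<noteq> x' \<Longrightarrow> adj (fourier \<psi> x) ** fourier \<psi> x' = 0"
  obtains N :: "'n bits \<Rightarrow> complex^'b^'q" where "fiberwise_contraction g N"
    "(norm (\<Sum>k\<in>UNIV. W k ** adj (stack f \<psi> k)))\<^sup>2 =
      2 ^ LENGTH('m) * (\<Sum>x\<in>UNIV. (norm (N x ** adj (fourier \<psi> x)))\<^sup>2)"
proof -
  define u where "u z = slice (W (f z)) z" for z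
  define c where "c = 1 / (sqrt (2 ^ LENGTH('m)) * sqrt (2 ^ LENGTH('n)))"
  have c2: "c\<^sup>2 = 1 / (2 ^ LENGTH('m) * 2 ^ LENGTH('n))" by (simp add: c_def power_divide power_mult_distrib)
  define N where "N x = c *\<^sub>R (\<Sum>z\<in>UNIV. chi x z *\<^sub>R u z)" for x
  have "fiberwise_contraction g N"
    unfolding fiberwise_contraction_def
  proof (intro allI)
    fix s and v :: "complex^'b"
    have "(\<Sum>x\<in>g -` {s}. (norm (N x *v v))\<^sup>2)
        = c\<^sup>2 * (\<Sum>x\<in>g -` {s}. (norm (\<Sum>z\<in>UNIV. chi x z *\<^sub>R (u z *v v)))\<^sup>2)"
      by (simp add: N_def scaleR_matrix_vector sum_matrix_vector power_mult_distrib sum_distrib_left)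
    also have "\<dots> = c\<^sup>2 * (\<Sum>x\<in>g -` {s}. \<Sum>k\<in>UNIV. (norm (\<Sum>z\<in>f -` {k}. chi x z *\<^sub>R (u z *v v)))\<^sup>2)"
      by (simp only: fiberwise_pythagoras[OF dual])
    also have "\<dots> \<le> c\<^sup>2 * (\<Sum>x\<in>g -` {s}. \<Sum>k\<in>UNIV. \<Sum>z\<in>f -` {k}. (norm v)\<^sup>2)"
    proof (intro mult_left_mono sum_mono)
      fix x k
      have "(\<Sum>z\<in>f -` {k}. chi x z *\<^sub>R (u z *v v)) = (\<Sum>z\<in>f -` {k}. slice (W k) z *v (chi x z *\<^sub>R v))"
        by (intro sum.cong refl) (auto simp: u_def matrix_vector_scaleR)
      then show "(norm (\<Sum>z\<in>f -` {k}. chi x z *\<^sub>R (u z *v v)))\<^sup>2 \<le> (\<Sum>z\<in>f -` {k}. (norm v)\<^sup>2)"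
        using contraction_slices[OF W, where Z = "f -` {k}" and v = "\<lambda>z. chi x z *\<^sub>R v"] by simp
    qed simp
    also have "\<dots> = (norm v)\<^sup>2"
      unfolding sum_fibers by (simp add: card_fiber_g c2 card_bits)
    finally show "(\<Sum>x\<in>g -` {s}. (norm (N x *v v))\<^sup>2) \<le> (norm v)\<^sup>2" .
  qed
  moreover have "(norm (\<Sum>z\<in>UNIV. u z ** adj (\<psi> z)))\<^sup>2 =
      2 ^ LENGTH('m) * (\<Sum>x\<in>UNIV. (norm (N x ** adj (fourier \<psi> x)))\<^sup>2)"
  proof -
    define A where "A x = N x ** adj (fourier \<psi> x)" for x
    have AA: "inner (A x) (A x') = (if x = x' then (norm (A x))\<^sup>2 else 0)" for x x'
    proof (cases "x = x'")
      case False
      have "A x' ** adj (A x) = N x' ** (adj (fourier \<psi> x') ** fourier \<psi> x) ** adj (N x)"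
        by (simp add: A_def adj_mult matrix_mul_assoc)
      then have "A x' ** adj (A x) = 0" using X False by (simp add: matrix_mult_linear)
      then show ?thesis using False
        by (simp add: inner_eq_trace trace_mult_commute[of "adj (A x)"] linear_0[OF linear_Re_trace])
    qed (simp add: power2_norm_eq_inner)
    have "u z ** adj (\<psi> z) = (1 / sqrt (2 ^ LENGTH('n))) *\<^sub>R (\<Sum>x\<in>UNIV. chi x z *\<^sub>R (u z ** adj (fourier \<psi> x)))" for z
    proof -
      have "\<psi> z = (1 / sqrt (2 ^ LENGTH('n))) *\<^sub>R (\<Sum>x\<in>UNIV. chi x z *\<^sub>R fourier \<psi> x)"
        by (simp add: fourier_inverse)
      then have "adj (\<psi> z) = (1 / sqrt (2 ^ LENGTH('n))) *\<^sub>R (\<Sum>x\<in>UNIV. chi x z *\<^sub>R adj (fourier \<psi> x))"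
        by (metis (no_types, lifting) adj_scaleR adj_sum sum.cong)
      then show ?thesis
        by (simp add: matrix_mult_scaleR_right matrix_mult_sum_right)
    qed
    then have "(\<Sum>z\<in>UNIV. u z ** adj (\<psi> z)) = (1 / sqrt (2 ^ LENGTH('n))) *\<^sub>R
        (\<Sum>z\<in>UNIV. \<Sum>x\<in>UNIV. chi x z *\<^sub>R (u z ** adj (fourier \<psi> x)))"
      by (simp add: scaleR_sum_right)
    also have "\<dots> = (1 / sqrt (2 ^ LENGTH('n))) *\<^sub>R (\<Sum>x\<in>UNIV. (\<Sum>z\<in>UNIV. chi x z *\<^sub>R u z) ** adj (fourier \<psi> x))"
      by (subst sum.swap) (simp add: matrix_mult_sum_left matrix_mult_scaleR_left)
    also have "\<dots> = sqrt (2 ^ LENGTH('m)) *\<^sub>R (\<Sum>x\<in>UNIV. A x)"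
    proof -
      have "(1 / sqrt (2 ^ LENGTH('n))) = sqrt (2 ^ LENGTH('m)) * c" by (simp add: c_def)
      moreover have "(\<Sum>x\<in>UNIV. A x) = c *\<^sub>R (\<Sum>x\<in>UNIV. (\<Sum>z\<in>UNIV. chi x z *\<^sub>R u z) ** adj (fourier \<psi> x))"
        by (simp add: A_def N_def matrix_mult_scaleR_left flip: scaleR_sum_right)
      ultimately show ?thesis by (simp only: scaleR_scaleR)
    qed
    finally have "(norm (\<Sum>z\<in>UNIV. u z ** adj (\<psi> z)))\<^sup>2 = 2 ^ LENGTH('m) * (norm (\<Sum>x\<in>UNIV. A x))\<^sup>2"
      by (simp add: power_mult_distrib)
    then show ?thesis by (simp add: norm_sum_sq AA) (simp add: A_def)
  qed
  ultimately show ?thesis using that by (simp add: sum_mult_adj_stack u_def)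
qed

text \<open>\<open>V\<close> is a signed copy of \<open>N\<close> that writes \<open>x\<close> to an
  extra output register, so different \<open>x\<close> stay orthogonal. For contractivity, the
  Fourier sum \<open>U x\<close> over a fiber of \<open>f\<close> agrees up to sign for all
  \<open>x\<close> in a fiber of \<open>g\<close>; the operators \<open>N x\<close> of that fiber
  then act on one vector.\<close>

lemma overlap_of_decoder:
  fixes \<psi> :: "'n bits \<Rightarrow> complex^'b::finite^'e::finite" and N :: "'n bits \<Rightarrow> complex^'b^'q::finite"
  assumes N: "fiberwise_contraction g N"
  obtains W :: "'m bits \<Rightarrow> complex^('n bits \<times> 'b)^('n bits \<times> 'q)" where "\<And>k. contraction (W k)"
    "(norm (\<Sum>k\<in>UNIV. W k ** adj (stack f \<psi> k)))\<^sup>2 =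
      2 ^ LENGTH('m) * (\<Sum>x\<in>UNIV. (norm (N x ** adj (fourier \<psi> x)))\<^sup>2)"
proof -
  \<comment> \<open>Parseval contributes \<open>2 ^ n\<close> and averaging over a fiber of
    \<open>g\<close> divides by \<open>2 ^ m\<close>; the square of \<open>c\<close> cancels
    both.\<close>
  define c where "c = sqrt (2 ^ LENGTH('m)) / sqrt (2 ^ LENGTH('n))"
  have c2: "c\<^sup>2 = 2 ^ LENGTH('m) / 2 ^ LENGTH('n)" by (simp add: c_def power_divide)
  define V :: "'n bits \<Rightarrow> complex^'b^('n bits \<times> 'q)"
    where "V z = (\<chi> p b. (c * chi (fst p) z) *\<^sub>R (N (fst p) $ snd p $ b))" for z
  define W :: "'m bits \<Rightarrow> complex^('n bits \<times> 'b)^('n bits \<times> 'q)"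
    where "W k = (\<chi> p r. if f (fst r) = k then V (fst r) $ p $ snd r else 0)" for k
  have slice_W: "slice (W k) z = (if f z = k then V z else 0)" for k z
    by (simp add: slice_def W_def cart_eq_iff)
  have "contraction (W k)" for k
    unfolding contraction_def
  proof
    fix v :: "complex^('n bits \<times> 'b)"
    obtain w where w: "v = glue w" using glue_surj by blast
    define U where "U x = (\<Sum>z\<in>f -` {k}. chi x z *\<^sub>R w z)" for x
    have "W k *v v = (\<Sum>z\<in>f -` {k}. V z *v w z)"
      by (simp add: w mult_glue slice_W if_distrib[of "\<lambda>A. A *v _"] sum.If_cases vimage_def cong: if_cong)
    also have "\<dots> = glue (\<lambda>x. c *\<^sub>R (N x *v U x))"
      by (simp add: cart_eq_iff glue_def V_def U_def matrix_vector_mult_def sum_distrib_left scaleR_sum_right)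
         (auto intro!: allI sum.swap[THEN trans] sum.cong simp: scaleR_conv_of_real[of _ "_ :: complex"] mult_ac)
    finally have "(norm (W k *v v))\<^sup>2 = c\<^sup>2 * (\<Sum>x\<in>UNIV. (norm (N x *v U x))\<^sup>2)"
      by (simp add: norm_glue power_mult_distrib sum_distrib_left)
    also have "(\<Sum>x\<in>UNIV. (norm (N x *v U x))\<^sup>2) = (\<Sum>s\<in>UNIV. \<Sum>x\<in>g -` {s}. (norm (N x *v U x))\<^sup>2)"
      by (rule sum_fibers[symmetric])
    also have "\<dots> \<le> (\<Sum>s\<in>UNIV. \<Sum>x\<in>g -` {s}. (norm (U x))\<^sup>2 / 2 ^ LENGTH('m))"
    proof (rule sum_mono)
      fix s
      have "card (g -` {s}) > 0" using dual by (simp add: dual_maps_def)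
      then obtain y where y: "g y = s" by (metis card_gt_0_iff ex_in_conv vimage_singleton_eq)
      have U: "\<exists>a :: real. \<bar>a\<bar> = 1 \<and> U x = a *\<^sub>R U y" if "x \<in> g -` {s}" for x
      proof (cases "f -` {k} = {}")
        case True
        then show ?thesis by (intro exI[of _ 1]) (simp add: U_def)
      next
        case False
        then obtain z0 where z0: "f z0 = k" by auto
        have "chi x z = chi (x + y) z0 * chi y z" if "z \<in> f -` {k}" for z
        proof -
          have "chi (x + y) (z + z0) = 1"
            using dual y z0 that \<open>x \<in> g -` {s}\<close> by (auto simp: dual_maps_def)
          then have "chi (x + y) z = chi (x + y) z0"
            using chi_cases[of "x + y" z] chi_cases[of "x + y" z0] by (auto simp: chi_add_right)
          moreover have "chi x z = chi (x + y) z * chi y z" by (simp flip: chi_add_left)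
          ultimately show ?thesis by simp
        qed
        then have "U x = chi (x + y) z0 *\<^sub>R U y" by (simp add: U_def scaleR_sum_right)
        then show ?thesis by (intro exI[of _ "chi (x + y) z0"]) simp
      qed
      have eq: "norm (N x *v U x) = norm (N x *v U y)" "norm (U x) = norm (U y)" if "x \<in> g -` {s}" for x
        using U[OF that] by (auto simp: matrix_vector_scaleR)
      have "(\<Sum>x\<in>g -` {s}. (norm (N x *v U x))\<^sup>2) = (\<Sum>x\<in>g -` {s}. (norm (N x *v U y))\<^sup>2)"
        by (intro sum.cong refl) (simp only: eq)
      also have "\<dots> \<le> (norm (U y))\<^sup>2" using N by (simp add: fiberwise_contraction_def)
      also have "\<dots> = (\<Sum>x\<in>g -` {s}. (norm (U y))\<^sup>2 / 2 ^ LENGTH('m))" by (simp add: card_fiber_g)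
      also have "\<dots> = (\<Sum>x\<in>g -` {s}. (norm (U x))\<^sup>2 / 2 ^ LENGTH('m))"
        by (intro sum.cong refl) (simp only: eq)
      finally show "(\<Sum>x\<in>g -` {s}. (norm (N x *v U x))\<^sup>2) \<le> (\<Sum>x\<in>g -` {s}. (norm (U x))\<^sup>2 / 2 ^ LENGTH('m))" .
    qed
    also have "\<dots> = (\<Sum>x\<in>UNIV. (norm (U x))\<^sup>2 / 2 ^ LENGTH('m))" by (rule sum_fibers)
    also have "\<dots> = 2 ^ LENGTH('n) * (\<Sum>z\<in>f -` {k}. (norm (w z))\<^sup>2) / 2 ^ LENGTH('m)"
      by (simp add: sum_divide_distrib[symmetric] U_def parseval)
    finally have "(norm (W k *v v))\<^sup>2 \<le> c\<^sup>2 * (2 ^ LENGTH('n) * (\<Sum>z\<in>f -` {k}. (norm (w z))\<^sup>2) / 2 ^ LENGTH('m))"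
      by (simp add: mult_left_mono)
    also have "\<dots> = (\<Sum>z\<in>f -` {k}. (norm (w z))\<^sup>2)" by (simp add: c2)
    also have "\<dots> \<le> (\<Sum>z\<in>UNIV. (norm (w z))\<^sup>2)" by (intro sum_mono2) simp_all
    also have "\<dots> = (norm v)\<^sup>2" by (simp add: w norm_glue)
    finally show "norm (W k *v v) \<le> norm v" by (rule power2_le_imp_le) simp
  qed
  moreover have "(norm (\<Sum>k\<in>UNIV. W k ** adj (stack f \<psi> k)))\<^sup>2 =
      2 ^ LENGTH('m) * (\<Sum>x\<in>UNIV. (norm (N x ** adj (fourier \<psi> x)))\<^sup>2)"
  proof -
    have rows: "(\<Sum>z\<in>UNIV. V z ** adj (\<psi> z)) $ (x, q) = sqrt (2 ^ LENGTH('m)) *\<^sub>R (N x ** adj (fourier \<psi> x)) $ q" for x q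
    proof -
      have "(V z ** adj (\<psi> z)) $ (x, q) = (c * chi x z) *\<^sub>R (N x ** adj (\<psi> z)) $ q" for z
        by (simp add: V_def cart_eq_iff matrix_matrix_mult_def scaleR_sum_right)
      then have "(\<Sum>z\<in>UNIV. V z ** adj (\<psi> z)) $ (x, q) = (\<Sum>z\<in>UNIV. (c * chi x z) *\<^sub>R (N x ** adj (\<psi> z)) $ q)"
        by simp
      also have "\<dots> = sqrt (2 ^ LENGTH('m)) *\<^sub>R (N x ** adj (fourier \<psi> x)) $ q"
        by (simp add: fourier_def adj_scaleR adj_sum matrix_mult_scaleR_right matrix_mult_sum_right
            scaleR_sum_right c_def)
      finally show ?thesis .
    qed
    have "(\<Sum>k\<in>UNIV. W k ** adj (stack f \<psi> k)) = (\<Sum>z\<in>UNIV. V z ** adj (\<psi> z))"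
      by (simp add: sum_mult_adj_stack slice_W)
    moreover have "(norm (\<Sum>z\<in>UNIV. V z ** adj (\<psi> z)))\<^sup>2
        = (\<Sum>x\<in>UNIV. \<Sum>q\<in>UNIV. (norm (sqrt (2 ^ LENGTH('m)) *\<^sub>R (N x ** adj (fourier \<psi> x)) $ q))\<^sup>2)"
      by (subst norm_sq_vec) (simp only: sum_prod_UNIV rows)
    moreover have "\<dots> = 2 ^ LENGTH('m) * (\<Sum>x\<in>UNIV. \<Sum>q\<in>UNIV. (norm ((N x ** adj (fourier \<psi> x)) $ q))\<^sup>2)"
      by (simp add: power_mult_distrib sum_distrib_left)
    ultimately show ?thesis by (simp only: norm_sq_vec[of "_ ** _"])
  qed
  ultimately show ?thesis using that by blast
qed

end

section \<open>Measurements\<close>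

lemma adj_eq_conj_transpose: "adj A = map_matrix cnj (transpose A)"
  by (simp add: adj_def cart_eq_iff map_matrix_def transpose_def)

lemma conj_mult: "map_matrix cnj (A ** B) = map_matrix cnj A ** map_matrix cnj B"
  by (simp add: cart_eq_iff map_matrix_def matrix_matrix_mult_def)

lemma conj_conj [simp]: "map_matrix cnj (map_matrix cnj A) = A"
  by (simp add: cart_eq_iff map_matrix_def)

lemma norm_conj [simp]: "norm (map_matrix cnj A) = norm A"
  by (simp add: norm_vec_def map_matrix_def)

lemma norm_conj_vector: "norm (map_matrix cnj A *v v) = norm (A *v (\<chi> i. cnj (v $ i)))"
proof -
  have "(map_matrix cnj A *v v) $ i = cnj ((A *v (\<chi> i. cnj (v $ i))) $ i)" for i
    by (simp add: matrix_vector_mult_def map_matrix_def)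
  then show ?thesis by (simp add: norm_vec_def)
qed

lemma norm_cnj_vec: "norm (\<chi> i. cnj (v $ i)) = norm v"
  by (simp add: norm_vec_def)

lemma povm_of_fiberwise_contraction:
  fixes N :: "'n::len0 bits \<Rightarrow> complex^'b::finite^'q::finite" and g :: "'n bits \<Rightarrow> 's"
  assumes "fiberwise_contraction g N"
  obtains M :: "'s \<Rightarrow> 'n bits \<Rightarrow> 'b op"
  where "\<And>s. povm (M s)" "\<And>x. psd (M (g x) x - adj (N x) ** N x)"
proof -
  define T where "T s = mat 1 - (\<Sum>x\<in>g -` {s}. adj (N x) ** N x)" for s
  have T: "psd (T s)" for s
    using assms
    by (auto simp: psd_iff T_def adj_diff adj_sum adj_mult matrix_vector_mult_diff_rdistrib inner_diff_right
        sum_matrix_vector inner_sum_right inner_mult_adj_vector fiberwise_contraction_def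
        simp flip: power2_norm_eq_inner)
  \<comment> \<open>Outcome \<open>0\<close> takes the weight missing from the identity, which can
    only raise the success probability.\<close>
  define M where "M s x = (if g x = s then adj (N x) ** N x else 0) + (if x = 0 then T s else 0)" for s x
  have "(\<Sum>x\<in>UNIV. if g x = s then adj (N x) ** N x else 0) = (\<Sum>x\<in>g -` {s}. adj (N x) ** N x)" for s
    by (simp add: sum.If_cases vimage_def)
  then have "povm (M s)" for s
    using T by (auto simp: povm_def M_def sum.distrib psd_adj_mult T_def intro!: psd_add)
  moreover have "psd (M (g x) x - adj (N x) ** N x)" for x
    using T by (simp add: M_def)
  ultimately show ?thesis by (rule that)
qed

text \<open>The Born rule, for a Kraus operator \<open>R\<close> and a purification \<open>H\<close>
  of the state.\<close>

lemma norm_sq_eq_trace: "(norm (R ** H))\<^sup>2 = Re (trace (H ** adj H ** (adj R ** R)))"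
proof -
  have "trace (adj H ** (adj R ** R ** H)) = trace (adj R ** R ** H ** adj H)"
    by (rule trace_mult_commute)
  also have "\<dots> = trace ((adj R ** R) ** (H ** adj H))" by (simp only: matrix_mul_assoc)
  also have "\<dots> = trace ((H ** adj H) ** (adj R ** R))" by (rule trace_mult_commute)
  finally show ?thesis
    by (simp add: power2_norm_eq_inner inner_eq_trace adj_mult matrix_mul_assoc)
qed

text \<open>
  \<open>decoded g S M\<close> is the probability that the decoder \<open>M\<close> finds \<open>x\<close>, where \<open>S x\<close> is the unnormalized
  state of the receiver given \<open>x\<close>.
\<close>

definition decoded :: "('n::len0 bits \<Rightarrow> 'l) \<Rightarrow> ('n bits \<Rightarrow> 'b::finite op) \<Rightarrow> ('l \<Rightarrow> 'n bits \<Rightarrow> 'b op) \<Rightarrow> real" where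
  "decoded g S M = (\<Sum>x\<in>UNIV. Re (trace (S x ** M (g x) x)))"

text \<open>
  For \<open>|\<Psi>\<rangle> = \<Sum>z. |z\<rangle> |\<psi> z\<rangle>\<close> the two alternatives say that the state of \<open>A E\<close> is classical in the \<open>z\<close>
  basis, respectively that the state of \<open>A B\<close> is classical in the \<open>x\<close> basis.
\<close>

definition standard_family :: "('n::len0 bits \<Rightarrow> complex^'b::finite^'e::finite) \<Rightarrow> bool" where
  "standard_family \<psi> \<longleftrightarrow> (\<forall>z z'. z \<noteq> z' \<longrightarrow> \<psi> z ** adj (\<psi> z') = 0) \<or>
     (\<forall>x x'. x \<noteq> x' \<longrightarrow> adj (fourier \<psi> x) ** fourier \<psi> x' = 0)"

text \<open>The same pure state expanded in the \<open>x\<close> basis, with matrices from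
  \<open>E\<close> to \<open>B\<close>. Exchanging \<open>z, E\<close> with \<open>x, B\<close>
  thereby becomes an involution on families.\<close>

definition dual_family :: "('n::len0 bits \<Rightarrow> complex^'b::finite^'e::finite) \<Rightarrow> 'n bits \<Rightarrow> complex^'e^'b" where
  "dual_family \<psi> x = transpose (fourier \<psi> x)"

lemma fourier_transpose: "fourier (\<lambda>z. transpose (\<psi> z)) x = transpose (fourier \<psi> x)"
  by (simp add: fourier_def cart_eq_iff transpose_def)

lemma fourier_dual_family: "fourier (dual_family \<psi>) z = transpose (\<psi> z)"
  by (simp add: dual_family_def[abs_def] fourier_transpose fourier_fourier)

lemma dual_family_dual_family: "dual_family (dual_family \<psi>) = \<psi>"
  by (rule ext) (simp add: dual_family_def[of "dual_family \<psi>"] fourier_dual_family)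

lemma standard_family_dual: "standard_family \<psi> \<Longrightarrow> standard_family (dual_family \<psi>)"
proof -
  have 1: "transpose A ** adj (transpose B) = map_matrix cnj (adj A ** B)"
    and 2: "adj (transpose A) ** transpose B = map_matrix cnj (A ** adj B)"
    for A B :: "complex^'x::finite^'y::finite"
    by (simp_all add: cart_eq_iff matrix_matrix_mult_def adj_def transpose_def map_matrix_def)
  have 3: "map_matrix cnj 0 = 0" by (simp add: cart_eq_iff map_matrix_def)
  assume "standard_family \<psi>"
  then show ?thesis by (auto simp: standard_family_def fourier_dual_family 2) (simp add: dual_family_def 1 3)+
qed

text \<open>Overlaps contain the adjoint of \<open>fourier \<psi> x\<close>, the receiver's state
  its transpose. Conjugating the decoder bridges the two and keeps it a fiberwise
  contraction.\<close>

lemma norm_mult_adj_fourier: "norm (N ** adj (fourier \<psi> x)) = norm (map_matrix cnj N ** dual_family \<psi> x)"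
proof -
  have "N ** adj (fourier \<psi> x) = map_matrix cnj (map_matrix cnj N ** dual_family \<psi> x)"
    by (simp add: conj_mult dual_family_def adj_eq_conj_transpose)
  then show ?thesis by simp
qed

lemma fiberwise_contraction_conj:
  "fiberwise_contraction g N \<Longrightarrow> fiberwise_contraction g (\<lambda>x. map_matrix cnj (N x))"
  unfolding fiberwise_contraction_def norm_conj_vector by (metis norm_cnj_vec)

context
  fixes f :: "'n::len0 bits \<Rightarrow> 'm::len0 bits" and g :: "'n bits \<Rightarrow> 'l::len0 bits"
    and \<psi> :: "'n bits \<Rightarrow> complex^'b::finite^'e::finite"
  assumes dual: "dual_maps f g"
begin

lemma decoded_le_fidelity:
  assumes M: "\<And>s. povm (M s)"
  obtains \<sigma> where "normalized_state \<sigma>"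
    "2 ^ LENGTH('m) * decoded g (gram (dual_family \<psi>)) M \<le> fidelity (gram (stack f \<psi>)) \<sigma>"
proof -
  define N where "N x = op_sqrt (M (g x) x)" for x
  have psd: "psd (M s x)" for s x using M by (simp add: povm_def)
  have N: "adj (N x) ** N x = M (g x) x" for x
    by (simp add: N_def psd_adj psd_op_sqrt op_sqrt_square psd)
  have "fiberwise_contraction g N"
    unfolding fiberwise_contraction_def
  proof (intro allI)
    fix s v
    have "(\<Sum>x\<in>g -` {s}. (norm (N x *v v))\<^sup>2) = (\<Sum>x\<in>g -` {s}. inner v (M s x *v v))"
      by (intro sum.cong refl) (auto simp: N simp flip: inner_mult_adj_vector)
    also have "\<dots> \<le> (\<Sum>x\<in>UNIV. inner v (M s x *v v))"
      using psd by (intro sum_mono2) (auto simp: psd_iff)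
    also have "\<dots> = inner v ((\<Sum>x\<in>UNIV. M s x) *v v)"
      by (simp add: sum_matrix_vector inner_sum_right)
    finally show "(\<Sum>x\<in>g -` {s}. (norm (N x *v v))\<^sup>2) \<le> (norm v)\<^sup>2"
      using M by (simp add: povm_def power2_norm_eq_inner)
  qed
  from overlap_of_decoder[OF dual fiberwise_contraction_conj[OF this], of \<psi>]
  obtain W :: "'m bits \<Rightarrow> complex^('n bits \<times> 'b)^('n bits \<times> 'b)" where W: "\<And>k. contraction (W k)"
    "(norm (\<Sum>k\<in>UNIV. W k ** adj (stack f \<psi> k)))\<^sup>2 =
      2 ^ LENGTH('m) * (\<Sum>x\<in>UNIV. (norm (map_matrix cnj (N x) ** adj (fourier \<psi> x)))\<^sup>2)"
    by blast
  obtain \<sigma> where \<sigma>: "normalized_state \<sigma>"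
    "(norm (\<Sum>k\<in>UNIV. W k ** adj (stack f \<psi> k)))\<^sup>2 \<le> fidelity (gram (stack f \<psi>)) \<sigma>"
    by (rule overlap_le_fidelity[OF W(1), where \<phi> = "stack f \<psi>"])
  have "decoded g (gram (dual_family \<psi>)) M
      = (\<Sum>x\<in>UNIV. (norm (map_matrix cnj (N x) ** adj (fourier \<psi> x)))\<^sup>2)"
    by (simp add: decoded_def gram_def norm_mult_adj_fourier norm_sq_eq_trace N)
  then show ?thesis using that[OF \<sigma>(1)] \<sigma>(2) W(2) by simp
qed

lemma fidelity_le_decoded:
  assumes \<sigma>: "normalized_state \<sigma>" and \<psi>: "standard_family \<psi>"
  obtains M where "\<And>s. povm (M s)"
    "fidelity (gram (stack f \<psi>)) \<sigma> \<le> 2 ^ LENGTH('m) * decoded g (gram (dual_family \<psi>)) M"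
proof -
  obtain W :: "'m bits \<Rightarrow> complex^('n bits \<times> 'b)^'e" where W: "\<And>k. contraction (W k)"
    "fidelity (gram (stack f \<psi>)) \<sigma> \<le> (norm (\<Sum>k\<in>UNIV. W k ** adj (stack f \<psi> k)))\<^sup>2"
    using fidelity_le_overlap[OF \<sigma>, where \<phi> = "stack f \<psi>"] by blast
  obtain N :: "'n bits \<Rightarrow> complex^'b^'e" where N: "fiberwise_contraction g N"
    "(norm (\<Sum>k\<in>UNIV. W k ** adj (stack f \<psi> k)))\<^sup>2 =
      2 ^ LENGTH('m) * (\<Sum>x\<in>UNIV. (norm (N x ** adj (fourier \<psi> x)))\<^sup>2)"
  proof (cases "\<forall>z z'. z \<noteq> z' \<longrightarrow> \<psi> z ** adj (\<psi> z') = 0")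
    case True
    then have Z: "\<psi> z ** adj (\<psi> z') = 0" if "z \<noteq> z'" for z z' using that by blast
    show ?thesis
      by (rule decoder_of_overlap_Z[OF dual, where W = W and \<psi> = \<psi>, OF W(1) Z]) (assumption, rule that)
  next
    case False
    then have X: "adj (fourier \<psi> x) ** fourier \<psi> x' = 0" if "x \<noteq> x'" for x x'
      using \<psi> that by (auto simp: standard_family_def)
    show ?thesis
      by (rule decoder_of_overlap_X[OF dual, where W = W and \<psi> = \<psi>, OF W(1) X]) (assumption, rule that)
  qed
  define N' where "N' x = map_matrix cnj (N x)" for x
  have "fiberwise_contraction g N'"
    unfolding N'_def by (rule fiberwise_contraction_conj[OF N(1)])
  then obtain M where M: "\<And>s. povm (M s)" "\<And>x. psd (M (g x) x - adj (N' x) ** N' x)"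
    using povm_of_fiberwise_contraction by blast
  have "(\<Sum>x\<in>UNIV. (norm (N x ** adj (fourier \<psi> x)))\<^sup>2) \<le> decoded g (gram (dual_family \<psi>)) M"
    unfolding decoded_def
  proof (rule sum_mono)
    fix x
    have "0 \<le> Re (trace (gram (dual_family \<psi>) x ** (M (g x) x - adj (N' x) ** N' x)))"
      by (intro psd_mult_trace_nonneg M psd_gram)
    then show "(norm (N x ** adj (fourier \<psi> x)))\<^sup>2 \<le> Re (trace (gram (dual_family \<psi>) x ** M (g x) x))"
      by (simp add: norm_mult_adj_fourier norm_sq_eq_trace N'_def gram_def matrix_mult_diff_right Re_trace_diff)
  qed
  then have "2 ^ LENGTH('m) * (\<Sum>x\<in>UNIV. (norm (N x ** adj (fourier \<psi> x)))\<^sup>2)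
      \<le> 2 ^ LENGTH('m) * decoded g (gram (dual_family \<psi>)) M"
    by simp
  then have "fidelity (gram (stack f \<psi>)) \<sigma> \<le> 2 ^ LENGTH('m) * decoded g (gram (dual_family \<psi>)) M"
    using W(2) N(2) by linarith
  then show ?thesis by (rule that[of M, OF M(1)])
qed

end

section \<open>Optimal decoding and maximal fidelity\<close>

lemma Re_trace_mult_povm:
  assumes "povm M"
  shows "(\<Sum>e | e \<noteq> x. Re (trace (S ** M e))) = Re (trace S) - Re (trace (S ** M x))"
proof -
  have "Re (trace S) = (\<Sum>e\<in>UNIV. Re (trace (S ** M e)))"
    using assms by (simp add: povm_def flip: Re_trace_sum matrix_mult_sum_right)
  also have "\<dots> = Re (trace (S ** M x)) + (\<Sum>e\<in>UNIV - {x}. Re (trace (S ** M e)))"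
    by (simp add: sum.remove)
  also have "UNIV - {x} = {e. e \<noteq> x}" by auto
  finally show ?thesis by simp
qed

context
  fixes f :: "'n::len0 bits \<Rightarrow> 'm::len0 bits" and g :: "'n bits \<Rightarrow> 'l::len0 bits"
    and \<psi> :: "'n bits \<Rightarrow> complex^'b::finite^'e::finite"
  assumes dual: "dual_maps f g" and \<psi>: "standard_family \<psi>"
    and normalized: "(\<Sum>x\<in>UNIV. Re (trace (gram (dual_family \<psi>) x))) = 1"
begin

lemma not_decoded_eq:
  assumes "\<And>s. povm (M s)"
  shows "(\<Sum>x\<in>UNIV. \<Sum>e | e \<noteq> x. Re (trace (gram (dual_family \<psi>) x ** M (g x) e)))
    = 1 - decoded g (gram (dual_family \<psi>)) M"
  using assms normalized by (simp add: Re_trace_mult_povm sum_subtractf decoded_def)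

lemma decoded_le_1:
  assumes "\<And>s. povm (M s)"
  shows "decoded g (gram (dual_family \<psi>)) M \<le> 1"
proof -
  have "0 \<le> (\<Sum>x\<in>UNIV. \<Sum>e | e \<noteq> x. Re (trace (gram (dual_family \<psi>) x ** M (g x) e)))"
    using assms by (intro sum_nonneg psd_mult_trace_nonneg psd_gram) (auto simp: povm_def)
  then show ?thesis using not_decoded_eq[of M, OF assms] by simp
qed

abbreviation "max_fidelity \<equiv> (SUP \<sigma> \<in> {\<sigma>. normalized_state \<sigma>}. fidelity (gram (stack f \<psi>)) \<sigma>)"

text \<open>Boundedness of the set under \<open>SUP\<close> comes from decoding: each fidelity is at
  most \<open>2 ^ m\<close> times a success probability.\<close>

lemma fidelity_le_max_fidelity: "normalized_state \<sigma> \<Longrightarrow> fidelity (gram (stack f \<psi>)) \<sigma> \<le> max_fidelity"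
proof (rule cSUP_upper)
  have "fidelity (gram (stack f \<psi>)) \<sigma> \<le> 2 ^ LENGTH('m)" if \<sigma>: "normalized_state \<sigma>" for \<sigma>
  proof -
    obtain M where "\<And>s. povm (M s)"
      "fidelity (gram (stack f \<psi>)) \<sigma> \<le> 2 ^ LENGTH('m) * decoded g (gram (dual_family \<psi>)) M"
      using fidelity_le_decoded[OF dual \<sigma> \<psi>] by blast
    moreover have "2 ^ LENGTH('m) * decoded g (gram (dual_family \<psi>)) M \<le> 2 ^ LENGTH('m) * 1"
      using decoded_le_1[of M] calculation(1) by (intro mult_left_mono) simp_all
    ultimately show ?thesis by linarith
  qed
  then show "bdd_above (fidelity (gram (stack f \<psi>)) ` {\<sigma>. normalized_state \<sigma>})" by (auto simp: bdd_above_def)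
qed simp

lemma decoded_le_max_fidelity:
  assumes "\<And>s. povm (M s)"
  shows "2 ^ LENGTH('m) * decoded g (gram (dual_family \<psi>)) M \<le> max_fidelity"
proof -
  obtain \<sigma> where \<sigma>: "normalized_state \<sigma>"
    "2 ^ LENGTH('m) * decoded g (gram (dual_family \<psi>)) M \<le> fidelity (gram (stack f \<psi>)) \<sigma>"
    using decoded_le_fidelity[OF dual, where M = M and \<psi> = \<psi>] assms by blast
  then show ?thesis using fidelity_le_max_fidelity[OF \<sigma>(1)] by simp
qed

text \<open>Uniform random guessing succeeds with probability \<open>1 / 2 ^ n\<close>. Positivity
  is what lets \<open>2 powr\<close> undo \<open>log 2\<close> in the indices and entropies.\<close>

lemma max_fidelity_pos: "0 < max_fidelity"
proof -
  let ?M = "\<lambda>s x :: 'n bits. (1 / 2 ^ LENGTH('n)) *\<^sub>R mat 1 :: 'b op"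
  have "povm (?M s)" for s :: "'l bits"
  proof -
    have "(\<Sum>x\<in>UNIV. ?M s x) = mat 1"
      by (simp only: sum_constant_scaleR scaleR_scaleR card_bits) simp
    then show ?thesis by (simp add: povm_def psd_scaleR)
  qed
  from decoded_le_max_fidelity[of ?M, OF this]
  have "2 ^ LENGTH('m) * decoded g (gram (dual_family \<psi>)) ?M \<le> max_fidelity" .
  moreover have "decoded g (gram (dual_family \<psi>)) ?M = 1 / 2 ^ LENGTH('n)"
    using normalized by (simp add: decoded_def matrix_mult_scaleR_right Re_trace_scaleR flip: sum_divide_distrib)
  ultimately show ?thesis by (smt (verit) divide_pos_pos mult_pos_pos zero_less_power)
qed

text \<open>Every decoder is matched by a state at least as good, and every state by a decoder, so
  infimum and supremum agree without being attained.\<close>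

lemma min_not_decoded_eq:
  "(INF M \<in> {M :: 'l bits \<Rightarrow> 'n bits \<Rightarrow> 'b op. \<forall>s. povm (M s)}.
     \<Sum>x\<in>UNIV. \<Sum>e | e \<noteq> x. Re (trace (gram (dual_family \<psi>) x ** M (g x) e)))
    = 1 - max_fidelity / 2 ^ LENGTH('m)" (is "Inf (?h ` ?P) = _")
proof (rule antisym)
  have ne: "?P \<noteq> {}" using trivial_povm by fastforce
  show "1 - max_fidelity / 2 ^ LENGTH('m) \<le> Inf (?h ` ?P)"
  proof (rule cINF_greatest[OF ne])
    fix M :: "'l bits \<Rightarrow> 'n bits \<Rightarrow> 'b op" assume "M \<in> ?P"
    then have M: "\<And>s. povm (M s)" by simp
    show "1 - max_fidelity / 2 ^ LENGTH('m) \<le> ?h M"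
      using decoded_le_max_fidelity[of M, OF M] by (simp add: not_decoded_eq[of M, OF M] field_simps)
  qed
  have bdd: "bdd_below (?h ` ?P)"
  proof (rule bdd_belowI2[of _ 0])
    fix M :: "'l bits \<Rightarrow> 'n bits \<Rightarrow> 'b op" assume "M \<in> ?P"
    then have M: "\<And>s. povm (M s)" by simp
    show "0 \<le> ?h M" using decoded_le_1[of M, OF M] by (simp add: not_decoded_eq[of M, OF M])
  qed
  have "max_fidelity \<le> 2 ^ LENGTH('m) * (1 - Inf (?h ` ?P))"
  proof (rule cSUP_least)
    show "{\<sigma> :: 'e op. normalized_state \<sigma>} \<noteq> {}"
      using decoded_le_fidelity[OF dual, of "\<lambda>_ z. if z = 0 then mat 1 else 0" \<psi>] trivial_povm by blast
    fix \<sigma> :: "'e op" assume "\<sigma> \<in> {\<sigma>. normalized_state \<sigma>}"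
    then obtain M where M: "\<And>s. povm (M s)"
      "fidelity (gram (stack f \<psi>)) \<sigma> \<le> 2 ^ LENGTH('m) * decoded g (gram (dual_family \<psi>)) M"
      using fidelity_le_decoded[OF dual _ \<psi>, of \<sigma>] by blast
    have "Inf (?h ` ?P) \<le> ?h M" using M(1) by (intro cINF_lower bdd) simp
    then have "2 ^ LENGTH('m) * decoded g (gram (dual_family \<psi>)) M \<le> 2 ^ LENGTH('m) * (1 - Inf (?h ` ?P))"
      by (simp add: not_decoded_eq[of M, OF M(1)])
    with M(2) show "fidelity (gram (stack f \<psi>)) \<sigma> \<le> 2 ^ LENGTH('m) * (1 - Inf (?h ` ?P))"
      by (rule order.trans)
  qed
  then show "Inf (?h ` ?P) \<le> 1 - max_fidelity / 2 ^ LENGTH('m)" by (simp add: field_simps)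
qed

end

lemma H_max_block_diag:
  assumes "orthonormal_basis ket" and "\<And>k. psd (R k)"
  shows "H_max (block_diag ket R) = log 2 (SUP \<sigma> \<in> {\<sigma>. normalized_state \<sigma>}. fidelity R \<sigma>)"
  unfolding H_max_def
  by (intro arg_cong[of _ _ "log 2"] SUP_cong refl fidelity_block_diag assms)
     (simp add: normalized_state_def)

text \<open>
  Privacy amplification with the identity map, applied to the dual family, expresses \<open>H_max\<close> by the
  probability of guessing \<open>z\<close> from \<open>E\<close> without side information, and \<open>H_min\<close> is the dual program.
\<close>

lemma H_min_eq_H_max:
  fixes \<psi> :: "'n::len0 bits \<Rightarrow> complex^'b::finite^'e::finite"
  assumes \<psi>: "standard_family \<psi>" and normalized: "(\<Sum>z\<in>UNIV. Re (trace (gram \<psi> z))) = 1"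
    and kz: "orthonormal_basis ket" and kx: "orthonormal_basis ket'"
  shows "H_min (block_diag ket (gram \<psi>)) = real LENGTH('n) - H_max (block_diag ket' (gram (dual_family \<psi>)))"
proof -
  let ?\<eta> = "dual_family \<psi>"
  let ?id = "\<lambda>z :: 'n bits. z" and ?g = "\<lambda>_ :: 'n bits. 0 :: 0 bits"
  note dual = dual_maps_id[of "0 :: 0 bits", where 'n = 'n]
  have \<eta>: "standard_family ?\<eta>" by (rule standard_family_dual[OF \<psi>])
  have norm': "(\<Sum>x\<in>UNIV. Re (trace (gram (dual_family ?\<eta>) x))) = 1"
    using normalized by (simp add: dual_family_dual_family)
  have stack: "gram (stack ?id ?\<eta>) = gram ?\<eta>"
    by (rule ext) (simp add: gram_def stack_mult_adj)
  define B where "B = (SUP \<tau> \<in> {\<tau>. normalized_state \<tau>}. fidelity (gram ?\<eta>) \<tau>)"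
  have B_pos: "B > 0"
    using max_fidelity_pos[OF dual \<eta> norm'] by (simp add: stack B_def)
  have dec: "decoded ?g (gram (dual_family ?\<eta>)) M = success (gram \<psi>) (M 0)" for M
    by (simp add: decoded_def success_def dual_family_dual_family)
  have le_B: "2 ^ LENGTH('n) * success (gram \<psi>) M \<le> B" if "povm M" for M
    using decoded_le_max_fidelity[OF dual \<eta> norm', of "\<lambda>_. M"] that by (simp add: dec stack B_def)
  let ?F = "{\<sigma>. psd \<sigma> \<and> op_le (block_diag ket (gram \<psi>)) (kron (mat 1) \<sigma>)}"
  have F: "?F = {\<sigma>. psd \<sigma> \<and> (\<forall>z. psd (\<sigma> - gram \<psi> z))}" by (simp add: op_le_block_diag_iff[OF kz])
  \<comment> \<open>\<open>success_duality\<close> asks for a strict bound on all measurements;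
    \<open>\<epsilon>\<close> provides it and is removed by a limit at the end.\<close>
  have feasible: "\<exists>\<sigma>\<in>?F. Re (trace \<sigma>) \<le> B / 2 ^ LENGTH('n) + \<epsilon>" if "\<epsilon> > 0" for \<epsilon>
  proof -
    have "success (gram \<psi>) M < B / 2 ^ LENGTH('n) + \<epsilon>" if "povm M" for M
    proof -
      have "success (gram \<psi>) M \<le> B / 2 ^ LENGTH('n)" using le_B[OF that] by (simp add: field_simps)
      then show ?thesis using \<open>\<epsilon> > 0\<close> by simp
    qed
    then obtain \<sigma> where \<sigma>: "\<And>z. psd (\<sigma> - gram \<psi> z)" "Re (trace \<sigma>) \<le> B / 2 ^ LENGTH('n) + \<epsilon>"
      using success_duality[of "gram \<psi>"] by (metis psd_adj psd_gram)
    have "psd \<sigma>" using psd_add[OF \<sigma>(1) psd_gram, of 0 \<psi> 0] by simp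
    then show ?thesis using \<sigma> unfolding F by blast
  qed
  let ?I = "INF \<sigma> \<in> ?F. Re (trace \<sigma>)"
  \<comment> \<open>Each fidelity is bounded by some guessing strategy, and each strategy by the
    trace of any feasible \<open>\<sigma>\<close>.\<close>
  have lower: "B / 2 ^ LENGTH('n) \<le> Re (trace \<sigma>)" if "\<sigma> \<in> ?F" for \<sigma>
  proof -
    have "B \<le> 2 ^ LENGTH('n) * Re (trace \<sigma>)"
      unfolding B_def
    proof (rule cSUP_least)
      show "{\<tau> :: 'b op. normalized_state \<tau>} \<noteq> {}"
        using decoded_le_fidelity[OF dual, of "\<lambda>_ z. if z = 0 then mat 1 else 0" ?\<eta>] trivial_povm by blast
      fix \<tau> :: "'b op" assume "\<tau> \<in> {\<tau>. normalized_state \<tau>}"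
      then obtain M where M: "\<And>s. povm (M s)"
        "fidelity (gram (stack ?id ?\<eta>)) \<tau> \<le> 2 ^ LENGTH('n) * decoded ?g (gram (dual_family ?\<eta>)) M"
        using fidelity_le_decoded[OF dual _ \<eta>, of \<tau>] by blast
      have "success (gram \<psi>) (M 0) \<le> Re (trace \<sigma>)"
        using that M(1) unfolding F by (intro success_le_trace) simp_all
      then have "2 ^ LENGTH('n) * success (gram \<psi>) (M 0) \<le> 2 ^ LENGTH('n) * Re (trace \<sigma>)" by simp
      moreover have "fidelity (gram ?\<eta>) \<tau> \<le> 2 ^ LENGTH('n) * success (gram \<psi>) (M 0)"
        using M(2) by (simp only: dec stack)
      ultimately show "fidelity (gram ?\<eta>) \<tau> \<le> 2 ^ LENGTH('n) * Re (trace \<sigma>)" by linarith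
    qed
    then show ?thesis by (simp add: field_simps)
  qed
  have "?I = B / 2 ^ LENGTH('n)"
  proof (rule antisym)
    show "?I \<le> B / 2 ^ LENGTH('n)"
    proof (rule field_le_epsilon)
      fix \<epsilon> :: real assume "\<epsilon> > 0"
      then obtain \<sigma> where \<sigma>: "\<sigma> \<in> ?F" "Re (trace \<sigma>) \<le> B / 2 ^ LENGTH('n) + \<epsilon>" using feasible by blast
      have "bdd_below ((\<lambda>\<sigma>. Re (trace \<sigma>)) ` ?F)" using lower by (rule bdd_belowI2)
      then have "?I \<le> Re (trace \<sigma>)" using \<sigma>(1) by (rule cINF_lower)
      then show "?I \<le> B / 2 ^ LENGTH('n) + \<epsilon>" using \<sigma>(2) by simp
    qed
    show "B / 2 ^ LENGTH('n) \<le> ?I" using feasible[of 1] by (intro cINF_greatest lower) auto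
  qed
  then have "H_min (block_diag ket (gram \<psi>)) = - log 2 (B / 2 ^ LENGTH('n))" by (simp add: H_min_def)
  also have "\<dots> = real LENGTH('n) - log 2 B" using B_pos by (simp add: log_divide log_nat_power)
  finally show ?thesis by (simp add: H_max_block_diag[OF kx] B_def)
qed

section \<open>The two bases\<close>

lemma zket_nth: "zket z $ a = (if a = z then 1 else 0)"
  by (simp add: zket_def axis_def)

lemma xket_nth: "xket x $ z = of_real (chi x z / sqrt (2 ^ LENGTH('n)))" for x :: "'n::len0 bits"
proof -
  have "qubit_x b c = of_real (if b = 1 \<and> c = 1 then - 1 else 1) / of_real (sqrt 2)" for b c
    by (simp add: qubit_x_def)
  then show ?thesis
    by (simp add: xket_def chi_def prod_dividef real_sqrt_power)
qed

lemma orthonormal_basis_zket: "orthonormal_basis zket"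
  by (auto simp: orthonormal_basis_def cinner_def zket_nth if_distrib[of cnj] if_distrib[of "\<lambda>x. x * _"] cong: if_cong)

lemma orthonormal_basis_xket: "orthonormal_basis (xket :: 'n::len0 bits \<Rightarrow> _)"
proof -
  have "cinner (xket x) (xket y) = of_real (\<Sum>z\<in>UNIV. chi z x * chi z y) / 2 ^ LENGTH('n)" for x y :: "'n bits"
    by (simp add: cinner_def xket_nth chi_commute[of x] chi_commute[of y] sum_divide_distrib
        of_real_mult[symmetric] del: of_real_mult)
  then show ?thesis by (simp add: orthonormal_basis_def sum_chi_mult)
qed

text \<open>The operator \<open><u| \<rho> |u'>\<close>. Classicality is used through the vanishing
  of these blocks for distinct \<open>u\<close> and \<open>u'\<close>.\<close>

definition cross_block :: "('n::len0 bits \<Rightarrow> complex^('n bits)) \<Rightarrow> 'n bits \<Rightarrow> 'n bits \<Rightarrow>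
    ('n bits \<times> 'v::finite) op \<Rightarrow> 'v op" where
  "cross_block ket u u' \<rho> = (\<chi> v w. \<Sum>a\<in>UNIV. \<Sum>a'\<in>UNIV. cnj (ket u $ a) * \<rho> $ (a, v) $ (a', w) * ket u' $ a')"

lemma block_eq_cross_block: "block ket u \<rho> = cross_block ket u u \<rho>"
  by (simp add: block_def cross_block_def)

lemma cross_block_block_diag:
  assumes "orthonormal_basis ket"
  shows "cross_block ket u u' (block_diag ket R) = (if u = u' then R u else 0)"
proof -
  have "cross_block ket u u' (block_diag ket R) $ v $ w =
      (\<Sum>k\<in>UNIV. cinner (ket u) (ket k) * cinner (ket k) (ket u') * R k $ v $ w)" for v w
  proof -
    have "cross_block ket u u' (block_diag ket R) $ v $ w =
        (\<Sum>a\<in>UNIV. \<Sum>a'\<in>UNIV. \<Sum>k\<in>UNIV. cnj (ket u $ a) * ket k $ a * (cnj (ket k $ a') * ket u' $ a') * R k $ v $ w)"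
      by (simp add: cross_block_def block_diag_def kron_def ket_bra_def sum_distrib_left sum_distrib_right mult_ac)
    also have "\<dots> = (\<Sum>a\<in>UNIV. \<Sum>k\<in>UNIV. \<Sum>a'\<in>UNIV. cnj (ket u $ a) * ket k $ a * (cnj (ket k $ a') * ket u' $ a') * R k $ v $ w)"
      by (intro sum.cong refl sum.swap)
    also have "\<dots> = (\<Sum>k\<in>UNIV. \<Sum>a\<in>UNIV. \<Sum>a'\<in>UNIV. cnj (ket u $ a) * ket k $ a * (cnj (ket k $ a') * ket u' $ a') * R k $ v $ w)"
      by (rule sum.swap)
    also have "\<dots> = (\<Sum>k\<in>UNIV. cinner (ket u) (ket k) * cinner (ket k) (ket u') * R k $ v $ w)"
      unfolding cinner_def sum_product by (simp only: sum_distrib_right)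
    finally show ?thesis .
  qed
  then show ?thesis
    using assms by (auto simp: cart_eq_iff orthonormal_basis_def if_distrib[of "\<lambda>x. x * _"] cong: if_cong)
qed

lemma
  assumes \<rho>: "\<And>a a' v w. \<rho> $ (a, v) $ (a', w) = (\<phi> a ** adj (\<phi> a')) $ v $ w"
  shows cross_block_zket: "cross_block zket z z' \<rho> = \<phi> z ** adj (\<phi> z')"
    and cross_block_xket: "cross_block xket x x' \<rho> = fourier \<phi> x ** adj (fourier \<phi> x')"
proof -
  show "cross_block zket z z' \<rho> = \<phi> z ** adj (\<phi> z')"
    by (simp add: cross_block_def cart_eq_iff \<rho> zket_nth if_distrib[of "\<lambda>x. x * _"] if_distrib[of cnj]
        if_distrib[of "\<lambda>x. _ * x"] cong: if_cong)
  have "fourier \<phi> x ** adj (fourier \<phi> x') =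
      (\<Sum>a\<in>UNIV. \<Sum>a'\<in>UNIV. (chi x a / sqrt (2 ^ LENGTH('a)) * (chi x' a' / sqrt (2 ^ LENGTH('a)))) *\<^sub>R (\<phi> a ** adj (\<phi> a')))"
    unfolding fourier_def adj_scaleR adj_sum matrix_mult_scaleR_left matrix_mult_scaleR_right
      matrix_mult_sum_left scaleR_sum_right
    by (simp add: matrix_mult_sum_right matrix_mult_scaleR_right scaleR_sum_right mult_ac)
  moreover have "complex_of_real (sqrt (2 ^ LENGTH('a))) * complex_of_real (sqrt (2 ^ LENGTH('a))) = 2 ^ LENGTH('a)"
    by (simp flip: of_real_mult)
  ultimately show "cross_block xket x x' \<rho> = fourier \<phi> x ** adj (fourier \<phi> x')"
    by (simp add: cross_block_def cart_eq_iff \<rho> xket_nth scaleR_conv_of_real[of _ "_ :: complex"] mult_ac)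
qed

lemma measured_eq_block_diag: "measured ket \<rho> = block_diag ket (\<lambda>u. block ket u \<rho>)"
  by (simp add: measured_eq_block block_diag_def)

lemma hashed_block_diag: "hashed f (block_diag zket (gram \<psi>)) = block_diag zket (gram (stack f \<psi>))"
  unfolding hashed_def block_eq_cross_block cross_block_block_diag[OF orthonormal_basis_zket]
  by (simp add: block_diag_def gram_def stack_mult_adj)

text \<open>In characteristic two \<open>x + e = 0\<close> means \<open>e = x\<close>, so both
  indices minimize the same expression.\<close>

lemma Q_EC_eq_Q_DC: "Q_EC g \<rho> = Q_DC g \<rho>" for g :: "'n::len0 bits \<Rightarrow> 'l::len0 bits"
proof -
  have "{e. x + e \<noteq> 0} = {e. e \<noteq> x}" for x :: "'n bits"
    by (auto simp: bits_add_eq_0_iff)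
  then show ?thesis by (simp only: Q_EC_def Q_DC_def)
qed

lemma Q_PA_eq_Q_DC:
  fixes \<psi> :: "'n::len0 bits \<Rightarrow> complex^'b::finite^'e::finite"
    and f :: "'n bits \<Rightarrow> 'm::len0 bits" and g :: "'n bits \<Rightarrow> 'l::len0 bits"
  assumes dual: "dual_maps f g" and \<psi>: "standard_family \<psi>"
    and normalized: "(\<Sum>z\<in>UNIV. Re (trace (gram \<psi> z))) = 1"
      "(\<Sum>x\<in>UNIV. Re (trace (gram (dual_family \<psi>) x))) = 1"
  shows "Q_PA f (block_diag zket (gram \<psi>)) = Q_DC g (block_diag xket (gram (dual_family \<psi>)))"
proof -
  let ?F = "SUP \<sigma> \<in> {\<sigma>. normalized_state \<sigma>}. fidelity (gram (stack f \<psi>)) \<sigma>"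
  have "?F > 0" by (rule max_fidelity_pos[OF dual \<psi> normalized(2)])
  have "H_max (hashed f (block_diag zket (gram \<psi>))) = log 2 ?F"
    unfolding hashed_block_diag by (rule H_max_block_diag[OF orthonormal_basis_zket psd_gram])
  then have "Q_PA f (block_diag zket (gram \<psi>)) = 1 - ?F / 2 ^ LENGTH('m)"
    using \<open>?F > 0\<close> normalized(1)
    by (simp add: Q_PA_def powr_diff powr_realpow Re_trace_block_diag[OF orthonormal_basis_zket])
  also have "\<dots> = Q_DC g (block_diag xket (gram (dual_family \<psi>)))"
    unfolding Q_DC_def block_eq_cross_block cross_block_block_diag[OF orthonormal_basis_xket]
    using min_not_decoded_eq[OF dual \<psi> normalized(2)] by simp
  finally show ?thesis .
qed

section \<open>Random functions, and the family of a state in standard form\<close>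

lemma dual_random_functions_expectation_eq:
  assumes "dual_random_functions F G"
    and eq: "\<And>f g. dual_functions f g \<Longrightarrow> p f = q g"
  shows "measure_pmf.expectation F p = measure_pmf.expectation G (q :: _ \<Rightarrow> real)"
proof -
  obtain k :: nat and f g where fg: "inj_on f {..<k}" "inj_on g {..<k}"
    "set_pmf F \<subseteq> f ` {..<k}" "set_pmf G \<subseteq> g ` {..<k}"
    "\<forall>i<k. dual_functions (f i) (g i) \<and> pmf F (f i) = pmf G (g i)"
    using assms(1) unfolding dual_random_functions_def by blast
  have "measure_pmf.expectation F p = (\<Sum>a\<in>f ` {..<k}. p a * pmf F a)"
    using fg(3) by (intro integral_measure_pmf_real) auto
  also have "\<dots> = (\<Sum>i<k. p (f i) * pmf F (f i))" by (simp add: sum.reindex[OF fg(1)])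
  also have "\<dots> = (\<Sum>i<k. q (g i) * pmf G (g i))"
    using fg(5) eq by (intro sum.cong refl) (metis lessThan_iff)
  also have "\<dots> = (\<Sum>b\<in>g ` {..<k}. q b * pmf G b)" by (simp add: sum.reindex[OF fg(2)])
  also have "\<dots> = measure_pmf.expectation G q"
    using fg(4) by (intro integral_measure_pmf_real[symmetric]) auto
  finally show ?thesis .
qed

lemma standard_form_family:
  fixes \<rho> :: "('n::len0 bits \<times> 'b::finite \<times> 'e::finite) op"
  assumes "normalized_state \<rho>" and "standard_form \<rho>"
  obtains \<psi> :: "'n bits \<Rightarrow> complex^'b^'e" where
    "standard_family \<psi>"
    "measured zket (reduce_AE \<rho>) = block_diag zket (gram \<psi>)"
    "measured xket (reduce_AB \<rho>) = block_diag xket (gram (dual_family \<psi>))"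
    "(\<Sum>z\<in>UNIV. Re (trace (gram \<psi> z))) = 1"
    "(\<Sum>x\<in>UNIV. Re (trace (gram (dual_family \<psi>) x))) = 1"
proof -
  have \<rho>: "psd \<rho>" "trace \<rho> = 1" "rank \<rho> = 1"
    using assms by (simp_all add: normalized_state_def standard_form_def)
  obtain v where v: "\<rho> = ket_bra v" by (rule pure_state_eq_ket_bra[OF \<rho>])
  \<comment> \<open>The component of \<open>v\<close> at \<open>z\<close>, reshaped into a matrix
    from \<open>B\<close> to \<open>E\<close>; partial traces then become matrix products.\<close>
  define \<psi> :: "'n bits \<Rightarrow> complex^'b^'e" where "\<psi> z = (\<chi> e b. v $ (z, b, e))" for z
  have AE: "reduce_AE \<rho> $ (a, e) $ (a', e') = (\<psi> a ** adj (\<psi> a')) $ e $ e'" for a a' e e'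
    by (simp add: reduce_AE_def v ket_bra_def \<psi>_def matrix_matrix_mult_def adj_def)
  have AB: "reduce_AB \<rho> $ (a, b) $ (a', b') = (transpose (\<psi> a) ** adj (transpose (\<psi> a'))) $ b $ b'" for a a' b b'
    by (simp add: reduce_AB_def v ket_bra_def \<psi>_def matrix_matrix_mult_def adj_def transpose_def)
  have cross_z: "cross_block zket z z' (reduce_AE \<rho>) = \<psi> z ** adj (\<psi> z')" for z z'
    by (rule cross_block_zket[OF AE])
  have cross_x: "cross_block xket x x' (reduce_AB \<rho>) = dual_family \<psi> x ** adj (dual_family \<psi> x')" for x x'
    using cross_block_xket[of "reduce_AB \<rho>" "\<lambda>z. transpose (\<psi> z)", OF AB]
    by (simp add: dual_family_def fourier_transpose)
  have mz: "measured zket (reduce_AE \<rho>) = block_diag zket (gram \<psi>)"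
    by (simp add: measured_eq_block_diag block_eq_cross_block cross_z gram_def[abs_def])
  have mx: "measured xket (reduce_AB \<rho>) = block_diag xket (gram (dual_family \<psi>))"
    by (simp add: measured_eq_block_diag block_eq_cross_block cross_x gram_def[abs_def])
  have "standard_family \<psi>"
  proof (cases "measured zket (reduce_AE \<rho>) = reduce_AE \<rho>")
    case True
    then have "\<psi> z ** adj (\<psi> z') = 0" if "z \<noteq> z'" for z z'
      using that cross_z[of z z'] mz by (metis cross_block_block_diag orthonormal_basis_zket)
    then show ?thesis by (simp add: standard_family_def)
  next
    case False
    then have "measured xket (reduce_AB \<rho>) = reduce_AB \<rho>" using assms(2) by (simp add: standard_form_def)
    then have "dual_family \<psi> x ** adj (dual_family \<psi> x') = 0" if "x \<noteq> x'" for x x'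
      using that cross_x[of x x'] mx by (metis cross_block_block_diag orthonormal_basis_xket)
    \<comment> \<open>Classicality in the \<open>x\<close> basis is the first alternative for the
      dual family; the involution carries it back to \<open>\<psi>\<close>.\<close>
    then have "standard_family (dual_family \<psi>)" by (simp add: standard_family_def)
    then show ?thesis using standard_family_dual dual_family_dual_family by metis
  qed
  moreover have nz: "(\<Sum>z\<in>UNIV. Re (trace (gram \<psi> z))) = 1"
  proof -
    have "(\<Sum>z\<in>UNIV. Re (trace (gram \<psi> z))) = Re (\<Sum>z\<in>UNIV. \<Sum>e\<in>UNIV. \<Sum>b\<in>UNIV. \<rho> $ (z, b, e) $ (z, b, e))"
      by (simp add: gram_def trace_def matrix_matrix_mult_def adj_def \<psi>_def v ket_bra_def)
    also have "(\<Sum>z\<in>UNIV. \<Sum>e\<in>UNIV. \<Sum>b\<in>UNIV. \<rho> $ (z, b, e) $ (z, b, e))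
        = (\<Sum>z\<in>UNIV. \<Sum>b\<in>UNIV. \<Sum>e\<in>UNIV. \<rho> $ (z, b, e) $ (z, b, e))"
      by (intro sum.cong refl sum.swap)
    also have "\<dots> = trace \<rho>" by (simp add: trace_def sum_prod_UNIV)
    finally show ?thesis using \<rho>(2) by simp
  qed
  moreover have "(\<Sum>x\<in>UNIV. Re (trace (gram (dual_family \<psi>) x))) = 1"
  proof -
    have n: "Re (trace (A ** adj A)) = (norm A)\<^sup>2" for A :: "complex^'x::finite^'y::finite"
      using norm_adj[of A] by (simp add: power2_norm_eq_inner inner_eq_trace trace_mult_commute[of A])
    have t: "norm (transpose A) = norm A" for A :: "complex^'b^'e"
      using norm_conj[of "transpose A"] by (simp flip: adj_eq_conj_transpose)
    have "(\<Sum>x\<in>UNIV. Re (trace (gram (dual_family \<psi>) x))) = (\<Sum>x\<in>UNIV. (norm (fourier \<psi> x))\<^sup>2)"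
      by (simp add: gram_def n dual_family_def t)
    also have "\<dots> = (\<Sum>z\<in>UNIV. (norm (\<psi> z))\<^sup>2)"
      using parseval[where Z = UNIV and y = \<psi>] by (simp add: fourier_def power_mult_distrib power_divide flip: sum_divide_distrib)
    also have "\<dots> = 1" using nz by (simp add: gram_def n)
    finally show ?thesis .
  qed
  ultimately show ?thesis using that mz mx by blast
qed

theorem theorem3:
  fixes n m :: nat
    and F :: "('n::len0 bits \<Rightarrow> 'm::len0 bits) pmf"
    and G :: "('n bits \<Rightarrow> 'l::len0 bits) pmf"
    and r :: "real \<Rightarrow> real"
    and \<rho> :: "('n bits \<times> 'b::finite \<times> 'e::finite) op"
  assumes "LENGTH('n) = n" and "LENGTH('m) = m" and "LENGTH('l) = n - m" and "m \<le> n"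
    and "dual_random_functions F G"
    and "normalized_state \<rho>" and "standard_form \<rho>"
  shows "let \<rho>ZE = measured zket (reduce_AE \<rho>);
             \<rho>XB = measured xket (reduce_AB \<rho>);
             As = {measure_pmf.expectation F (\<lambda>f. Q_PA f \<rho>ZE),
                   measure_pmf.expectation G (\<lambda>g. Q_EC g \<rho>XB),
                   measure_pmf.expectation G (\<lambda>g. Q_DC g \<rho>XB)};
             Bs = {H_min \<rho>ZE, real n - H_max \<rho>XB}
         in (\<exists>a\<in>As. \<exists>b\<in>Bs. a \<le> r b) \<longrightarrow> (\<forall>a\<in>As. \<forall>b\<in>Bs. a \<le> r b)"
proof -
  let ?ZE = "measured zket (reduce_AE \<rho>)" and ?XB = "measured xket (reduce_AB \<rho>)"
  obtain \<psi> :: "'n bits \<Rightarrow> complex^'b^'e" where \<psi>: "standard_family \<psi>"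
    "?ZE = block_diag zket (gram \<psi>)" "?XB = block_diag xket (gram (dual_family \<psi>))"
    "(\<Sum>z\<in>UNIV. Re (trace (gram \<psi> z))) = 1" "(\<Sum>x\<in>UNIV. Re (trace (gram (dual_family \<psi>) x))) = 1"
    by (rule standard_form_family[OF assms(6,7)])
  have len: "LENGTH('m) + LENGTH('l) = LENGTH('n)" using assms(1-4) by simp
  have "Q_PA f ?ZE = Q_DC g ?XB" if "dual_functions f g" for f :: "'n bits \<Rightarrow> 'm bits" and g :: "'n bits \<Rightarrow> 'l bits"
    unfolding \<psi>(2,3) by (rule Q_PA_eq_Q_DC[OF dual_functions_imp_dual_maps[OF that len] \<psi>(1,4,5)])
  then have "measure_pmf.expectation F (\<lambda>f. Q_PA f ?ZE) = measure_pmf.expectation G (\<lambda>g. Q_DC g ?XB)"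
    by (rule dual_random_functions_expectation_eq[OF assms(5)])
  moreover have "H_min ?ZE = real n - H_max ?XB"
    unfolding \<psi>(2,3) assms(1)[symmetric]
    by (rule H_min_eq_H_max[OF \<psi>(1,4) orthonormal_basis_zket orthonormal_basis_xket])
  \<comment> \<open>All members of \<open>As\<close> are equal, and so are those of
    \<open>Bs\<close>: the six inequalities are one and the same.\<close>
  ultimately show ?thesis by (simp add: Let_def Q_EC_eq_Q_DC)
qed

end
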